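(* Let $\mathbb{D}$ be a division ring with finite dimension $d$ over a central subfield $\mathbb{F}$. Let $V$ be a right $\mathbb{D}$-vector space with finite dimension $n>0$, and assume that $|\mathbb{F}|\geq nd$. (i) If $n=1$, then the irreducible optimal trivial spectrum subspaces of $\operatorname{End}_{\mathbb{D}}(V)$ are exactly the $\mathbb{F}$-linear hyperplanes of $\operatorname{End}_{\mathbb{D}}(V)$ that do not contain $\operatorname{id}_V$. (ii) If $n\geq 2$, then every irreducible optimal trivial spectrum subspace of $\operatorname{End}_{\mathbb{D}}(V)$ equals $\mathcal{A}_{b,\mathbb{D}}$ for some nonisotropic $\mathbb{F}$-bilinear form $b: V\times V\to\mathbb{F}$.
   Context: A central subfield of $\mathbb{D}$ is a subfield contained in the center of $\mathbb{D}$. $\operatorname{End}_{\mathbb{D}}(V)$ is the $\mathbb{F}$-algebra of $\mathbb{D}$-linear endomorphisms of $V$. An $\mathbb{F}$-linear subspace $S$ of $\operatorname{End}_{\mathbb{D}}(V)$ has trivial spectrum if $\operatorname{id}_V-u$ is invertible for all $u\in S$; a trivial spectrum subspace is optimal if it has the greatest possible dimension over $\mathbb{F}$ among all trivial spectrum $\mathbb{F}$-linear subspaces of $\operatorname{End}_{\mathbb{D}}(V)$. A subset $\mathcal{X}$ of $\operatorname{End}_{\mathbb{D}}(V)$ is irreducible if $V\neq\{0\}$ and the only $\mathbb{D}$-linear subspaces $V_0$ of $V$ such that $f(V_0)\subseteq V_0$ for all $f\in\mathcal{X}$ are $\{0\}$ and $V$. An $\mathbb{F}$-bilinear form $b:V\times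 V\to\mathbb{F}$ is nonisotropic if $b(x,x)\neq 0$ for all $x\in V\setminus\{0\}$. For such a form, $\mathcal{A}_{b,\mathbb{D}}$ is the $\mathbb{F}$-linear subspace of all $u\in\operatorname{End}_{\mathbb{D}}(V)$ such that $b(x,u(x))=0$ for all $x\in V$. *)

theory Defs
  imports Complex_Main "HOL-Library.Function_Algebras"
begin

text \<open>
  A subfield \<open>F\<close> contained in the center of a division ring \<open>D\<close> is given by a field type
  together with a unital ring homomorphism \<open>\<iota>\<close> into the center of \<open>D\<close>. Such a homomorphism is
  automatically injective; the subfield is the range of \<open>\<iota>\<close>.
\<close>

locale central_subfield =
  fixes \<iota> :: "'f::field \<Rightarrow> 'd::division_ring"
  assumes add: "\<iota> (a + b) = \<iota> a + \<iota> b"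
    and mult: "\<iota> (a * b) = \<iota> a * \<iota> b"
    and one: "\<iota> 1 = 1"
    and central: "\<iota> a * x = x * \<iota> a"

text \<open>
  The library locales \<open>module\<close> and \<open>vector_space\<close> require commutative scalars, so vector spaces
  over a division ring are introduced here; scalars are written on the right.
\<close>

locale right_vector_space =
  fixes smult :: "'v::ab_group_add \<Rightarrow> 'd::division_ring \<Rightarrow> 'v"
  assumes smult_add_left: "smult (x + y) a = smult x a + smult y a"
    and smult_add_right: "smult x (a + b) = smult x a + smult x b"
    and smult_assoc: "smult (smult x a) b = smult x (a * b)"
    and smult_one: "smult x 1 = x"

definition right_subspace :: "('v::ab_group_add \<Rightarrow> 'd::division_ring \<Rightarrow> 'v) \<Rightarrow> 'v set \<Rightarrow> bool" where
  "right_subspace smult W \<longleftrightarrow>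
     0 \<in> W \<and> (\<forall>x\<in>W. \<forall>y\<in>W. x + y \<in> W) \<and> (\<forall>x\<in>W. \<forall>a. smult x a \<in> W)"

definition right_basis :: "('v::ab_group_add \<Rightarrow> 'd::division_ring \<Rightarrow> 'v) \<Rightarrow> 'v set \<Rightarrow> bool" where
  "right_basis smult B \<longleftrightarrow> finite B
     \<and> (\<forall>c. (\<Sum>b\<in>B. smult b (c b)) = 0 \<longrightarrow> (\<forall>b\<in>B. c b = 0))
     \<and> (\<forall>x. \<exists>c. x = (\<Sum>b\<in>B. smult b (c b)))"

definition right_dimension :: "('v::ab_group_add \<Rightarrow> 'd::division_ring \<Rightarrow> 'v) \<Rightarrow> nat \<Rightarrow> bool" where
  "right_dimension smult n \<longleftrightarrow> (\<exists>B. right_basis smult B \<and> card B = n)"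

definition field_dimension :: "('f::field \<Rightarrow> 'd::division_ring) \<Rightarrow> nat \<Rightarrow> bool" where
  "field_dimension \<iota> d \<longleftrightarrow>
     (\<exists>B. finite_dimensional_vector_space (\<lambda>a x. \<iota> a * x) B \<and> card B = d)"

definition End :: "('v::ab_group_add \<Rightarrow> 'd::division_ring \<Rightarrow> 'v) \<Rightarrow> ('v \<Rightarrow> 'v) set" where
  "End smult =
     {u. (\<forall>x y. u (x + y) = u x + u y) \<and> (\<forall>x a. u (smult x a) = smult (u x) a)}"

definition scaleV ::
  "('f::field \<Rightarrow> 'd::division_ring) \<Rightarrow> ('v::ab_group_add \<Rightarrow> 'd \<Rightarrow> 'v) \<Rightarrow> 'f \<Rightarrow> 'v \<Rightarrow> 'v" where
  "scaleV \<iota> smult a x = smult x (\<iota> a)"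

text \<open>
  The scalar multiplication of \<open>F\<close> on \<open>End smult\<close>. Like the pointwise addition, it is defined on
  all maps \<open>'v \<Rightarrow> 'v\<close>, of which \<open>End smult\<close> is an \<open>F\<close>-linear subspace (lemma
  \<open>subspace_End\<close>).
\<close>

definition scaleE ::
  "('f::field \<Rightarrow> 'd::division_ring) \<Rightarrow> ('v::ab_group_add \<Rightarrow> 'd \<Rightarrow> 'v)
     \<Rightarrow> 'f \<Rightarrow> ('v \<Rightarrow> 'v) \<Rightarrow> 'v \<Rightarrow> 'v" where
  "scaleE \<iota> smult a u = (\<lambda>x. scaleV \<iota> smult a (u x))"

definition End_subspace ::
  "('f::field \<Rightarrow> 'd::division_ring) \<Rightarrow> ('v::ab_group_add \<Rightarrow> 'd \<Rightarrow> 'v) \<Rightarrow> ('v \<Rightarrow> 'v) set \<Rightarrow> bool" where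
  "End_subspace \<iota> smult S \<longleftrightarrow> S \<subseteq> End smult \<and> module.subspace (scaleE \<iota> smult) S"

text \<open>
  Codimension one and maximality of the dimension are expressed with the library's \<open>dim\<close>, which
  is \<open>0\<close> on infinite-dimensional spaces; they are meant for \<open>D\<close> and \<open>V\<close> of finite dimension
  over \<open>F\<close> and \<open>D\<close>, so that \<open>End smult\<close> is finite-dimensional over \<open>F\<close>.
\<close>

definition End_hyperplane ::
  "('f::field \<Rightarrow> 'd::division_ring) \<Rightarrow> ('v::ab_group_add \<Rightarrow> 'd \<Rightarrow> 'v) \<Rightarrow> ('v \<Rightarrow> 'v) set \<Rightarrow> bool" where
  "End_hyperplane \<iota> smult H \<longleftrightarrow> End_subspace \<iota> smult H
     \<and> vector_space.dim (scaleE \<iota> smult) (End smult) = vector_space.dim (scaleE \<iota> smult) H + 1"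

definition End_invertible ::
  "('v::ab_group_add \<Rightarrow> 'd::division_ring \<Rightarrow> 'v) \<Rightarrow> ('v \<Rightarrow> 'v) \<Rightarrow> bool" where
  "End_invertible smult u \<longleftrightarrow> u \<in> End smult \<and> (\<exists>w\<in>End smult. w \<circ> u = id \<and> u \<circ> w = id)"

definition trivial_spectrum ::
  "('f::field \<Rightarrow> 'd::division_ring) \<Rightarrow> ('v::ab_group_add \<Rightarrow> 'd \<Rightarrow> 'v) \<Rightarrow> ('v \<Rightarrow> 'v) set \<Rightarrow> bool" where
  "trivial_spectrum \<iota> smult S \<longleftrightarrow>
     End_subspace \<iota> smult S \<and> (\<forall>u\<in>S. End_invertible smult (id - u))"

definition optimal_trivial_spectrum ::
  "('f::field \<Rightarrow> 'd::division_ring) \<Rightarrow> ('v::ab_group_add \<Rightarrow> 'd \<Rightarrow> 'v) \<Rightarrow> ('v \<Rightarrow> 'v) set \<Rightarrow> bool" where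
  "optimal_trivial_spectrum \<iota> smult S \<longleftrightarrow> trivial_spectrum \<iota> smult S
     \<and> (\<forall>T. trivial_spectrum \<iota> smult T \<longrightarrow>
          vector_space.dim (scaleE \<iota> smult) T \<le> vector_space.dim (scaleE \<iota> smult) S)"

definition irreducible_End ::
  "('v::ab_group_add \<Rightarrow> 'd::division_ring \<Rightarrow> 'v) \<Rightarrow> ('v \<Rightarrow> 'v) set \<Rightarrow> bool" where
  "irreducible_End smult X \<longleftrightarrow> X \<subseteq> End smult \<and> (UNIV :: 'v set) \<noteq> {0}
     \<and> (\<forall>W. right_subspace smult W \<and> (\<forall>f\<in>X. f ` W \<subseteq> W) \<longrightarrow> W = {0} \<or> W = UNIV)"

definition bilinear_form ::
  "('f::field \<Rightarrow> 'd::division_ring) \<Rightarrow> ('v::ab_group_add \<Rightarrow> 'd \<Rightarrow> 'v) \<Rightarrow> ('v \<Rightarrow> 'v \<Rightarrow> 'f) \<Rightarrow> bool" where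
  "bilinear_form \<iota> smult b \<longleftrightarrow>
     (\<forall>x. Vector_Spaces.linear (scaleV \<iota> smult) (*) (\<lambda>y. b x y))
     \<and> (\<forall>y. Vector_Spaces.linear (scaleV \<iota> smult) (*) (\<lambda>x. b x y))"

definition nonisotropic :: "('v::ab_group_add \<Rightarrow> 'v \<Rightarrow> 'f::field) \<Rightarrow> bool" where
  "nonisotropic b \<longleftrightarrow> (\<forall>x. x \<noteq> 0 \<longrightarrow> b x x \<noteq> 0)"

definition form_space ::
  "('v::ab_group_add \<Rightarrow> 'd::division_ring \<Rightarrow> 'v) \<Rightarrow> ('v \<Rightarrow> 'v \<Rightarrow> 'f::field) \<Rightarrow> ('v \<Rightarrow> 'v) set" where
  "form_space smult b = {u \<in> End smult. \<forall>x. b x (u x) = 0}"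

text \<open>The library notions used above are applied to genuine \<open>F\<close>-vector spaces.\<close>

lemma (in central_subfield) vector_space_D: "vector_space (\<lambda>a x. \<iota> a * x)"
  by unfold_locales (simp_all add: algebra_simps add mult one)

lemma vector_space_scaleV:
  assumes "central_subfield \<iota>" "right_vector_space smult"
  shows "vector_space (scaleV \<iota> smult)"
proof -
  interpret central_subfield \<iota> by fact
  interpret right_vector_space smult by fact
  show ?thesis
  proof
    fix a b x
    show "scaleV \<iota> smult a (scaleV \<iota> smult b x) = scaleV \<iota> smult (a * b) x"
      by (simp add: scaleV_def smult_assoc mult central[of b "\<iota> a"])
  qed (simp_all add: scaleV_def smult_add_left smult_add_right smult_one add one)
qed

lemma vector_space_scaleE:
  assumes "central_subfield \<iota>" "right_vector_space smult"
  shows "vector_space (scaleE \<iota> smult)"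
proof -
  interpret vector_space "scaleV \<iota> smult" using assms by (rule vector_space_scaleV)
  show ?thesis
    by unfold_locales (auto simp: scaleE_def fun_eq_iff scale_left_distrib scale_right_distrib)
qed

lemma subspace_End:
  assumes "central_subfield \<iota>" "right_vector_space smult"
  shows "module.subspace (scaleE \<iota> smult) (End smult)"
proof -
  interpret central_subfield \<iota> by fact
  interpret right_vector_space smult by fact
  interpret E: vector_space "scaleE \<iota> smult" using assms by (rule vector_space_scaleE)
  have zero: "smult 0 a = 0" for a
    using smult_add_left[of 0 0 a] by simp
  have comm: "smult (smult x (\<iota> c)) a = smult (smult x a) (\<iota> c)" for x a c
    by (simp add: smult_assoc central[of c a])
  show ?thesis
    unfolding E.subspace_def
    by (auto simp: End_def scaleE_def scaleV_def smult_add_left zero comm algebra_simps)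
qed

end

theory Submission imports Defs begin

text \<open>
  For a subspace \<open>S\<close> with trivial spectrum no nonzero vector \<open>x\<close> lies in \<open>S x\<close>. If \<open>S x\<close> has the
  largest possible dimension (\<open>x\<close> is generic), then the operators of \<open>S\<close> that kill \<open>x\<close> map into
  \<open>S x\<close>; this needs \<open>|F|\<close> to exceed the dimension of \<open>S x\<close>. Compressing them to a complement of
  the line \<open>x D\<close> gives, by induction, the bound \<open>\<Sum>j\<le>n. (j d - 1)\<close> on the dimension, which is
  attained by block triangular spaces.

  Let \<open>S\<close> be irreducible and optimal, \<open>n \<ge> 2\<close>, and \<open>x\<close> generic. Then \<open>S x\<close> is the kernel of a
  functional \<open>\<phi>\<close>, the largest \<open>D\<close>-subspace \<open>H\<close> of \<open>S x\<close> is a complement of \<open>x D\<close>, and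
  \<open>T = {u \<in> S. u x = 0}\<close> is an optimal space of operators of \<open>H\<close>. The form \<open>b0 y (u x) = - \<phi> (u y)\<close>
  satisfies \<open>b0 y (v y) = 0\<close> for \<open>v \<in> T\<close>, which forces \<open>T\<close> to be irreducible. A nonzero form with
  this property for an irreducible optimal space is automatically nonisotropic, by a dimension
  count. Hence all nonzero vectors \<open>y\<close> of \<open>H\<close> are generic as well, the functionals vanishing on \<open>S y\<close>
  can be normalised so as to depend additively on \<open>y\<close>, and comparing \<open>b0 (y a)\<close> with
  \<open>b0 y\<close> for \<open>a \<in> D\<close> gives an involution of \<open>D\<close> with which the form is extended from \<open>H\<close> to the whole space.
\<close>

section \<open>Finite-dimensional subspaces\<close>

text \<open>The lower bound on \<open>|F|\<close> is what a generic vector costs: \<open>x\<close>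
  lies outside \<open>S x\<close>, so \<open>dim (S x) \<le> n d - 1\<close>. This is also the
  origin of the summands \<open>j d - 1\<close>. For a generic \<open>y\<close> the functional with
  kernel \<open>S y\<close> is determined only up to a factor in F, and the difficulty is to choose
  all factors so that it becomes additive in \<open>y\<close>. On the line \<open>x D\<close> the
  obvious choice for \<open>x a\<close> is \<open>\<phi> (p a\<^sup>-\<^sup>1)\<close>, because
  \<open>S (x a) = (S x) a\<close>, but the inverse is not additive in \<open>a\<close>. The
  involution cures this: every \<open>a\<close> turns out to satisfy a quadratic equation over F,
  and its conjugate is a multiple of the inverse by an element of F, yet additive. On
  \<open>H\<close> the factors are read off from \<open>b0\<close>, which works only if
  \<open>b0\<close> is nonisotropic; this is why the irreducibility of \<open>T\<close> has to be
  established. The form on \<open>H\<close> comes from \<open>S\<close> itself and not from a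
  classification of \<open>T\<close>, so the argument is uniform in \<open>n \<ge> 2\<close>,
  including the case where \<open>H\<close> is a line.\<close>

definition fin_dim :: "('a::field \<Rightarrow> 'b::ab_group_add \<Rightarrow> 'b) \<Rightarrow> 'b set \<Rightarrow> bool" where
  "fin_dim s S \<longleftrightarrow> (\<exists>B. finite B \<and> S \<subseteq> module.span s B)"

context vector_space begin

lemma fin_dim_mono: "fin_dim scale T \<Longrightarrow> S \<subseteq> T \<Longrightarrow> fin_dim scale S"
  unfolding fin_dim_def by blast

lemma fin_dim_basis:
  assumes "fin_dim scale S" "subspace S"
  obtains B where "finite B" "B \<subseteq> S" "\<not> dependent B" "span B = S" "card B = dim S"
proof -
  obtain B where B: "B \<subseteq> S" "\<not> dependent B" "S \<subseteq> span B" "card B = dim S"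
    using basis_exists by blast
  obtain C where "finite C" "S \<subseteq> span C" using assms unfolding fin_dim_def by auto
  then have "finite B" using independent_span_bound[of C B] B by auto
  moreover have "span B = S" using B assms(2) by (simp add: span_subspace)
  ultimately show ?thesis using that B by blast
qed

lemma fin_dim_dim_mono:
  assumes "fin_dim scale T" "S \<subseteq> T" shows "dim S \<le> dim T"
proof -
  obtain B where B: "B \<subseteq> T" "\<not> dependent B" "T \<subseteq> span B" "card B = dim T"
    using basis_exists by blast
  obtain C where "finite C" "T \<subseteq> span C" using assms unfolding fin_dim_def by auto
  then have "finite B" using independent_span_bound[of C B] B by auto
  then show ?thesis using dim_le_card[of S B] B assms(2) by auto
qed

lemma fin_dim_subspace_eq:
  assumes "fin_dim scale T" "subspace S" "subspace T" "S \<subseteq> T" "dim T \<le> dim S" shows "S = T"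
proof (rule ccontr)
  assume "S \<noteq> T"
  then obtain x where x: "x \<in> T" "x \<notin> S" using assms by auto
  obtain B where B: "finite B" "B \<subseteq> S" "\<not> dependent B" "span B = S" "card B = dim S"
    using fin_dim_basis fin_dim_mono assms by metis
  have "\<not> dependent (insert x B)" using independent_insertI B x by simp
  then have "dim (insert x B) = Suc (dim S)"
    using dim_eq_card_independent B x span_base by (metis card_insert_disjoint)
  moreover have "dim (insert x B) \<le> dim T"
    using fin_dim_dim_mono[OF assms(1)] B x assms by auto
  ultimately show False using assms by simp
qed

lemma independent_span_Int:
  assumes "\<not> dependent B" "C \<subseteq> B" shows "span C \<inter> span (B - C) = {0}"
proof -
  have "x = 0" if x: "x \<in> span C" "x \<in> span (B - C)" for x
  proof -
    have "representation C x = representation B x" "representation (B - C) x = representation B x"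
      using representation_extend[OF assms(1) x(1) assms(2)]
        representation_extend[OF assms(1) x(2)] by auto
    moreover have "representation C x b = 0 \<or> representation (B - C) x b = 0" for b
      using representation_ne_zero[of C x b] representation_ne_zero[of "B - C" x b] by blast
    ultimately have "representation B x b = 0" for b by metis
    then have "representation B x = representation B 0" by (auto simp: representation_zero)
    moreover have "x \<in> span B" using x(1) assms(2) span_mono by blast
    ultimately show ?thesis 
      using sum_nonzero_representation_eq[OF assms(1), of x] by (simp add: representation_zero)
  qed
  then show ?thesis using span_zero by blast
qed

lemma dim_le_1I:
  assumes "subspace S" "dim S \<le> 1" "fin_dim scale S" "x \<in> S" "x \<noteq> 0" "y \<in> S"
  shows "\<exists>c. y = scale c x"
proof -
  have "span {x} \<subseteq> S" using assms span_minimal by auto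
  moreover have "dim (span {x}) = 1" using dim_span_eq_card_independent[of "{x}"] assms by simp
  ultimately have "span {x} = S" using fin_dim_subspace_eq[of S "span {x}"] assms by auto
  then show ?thesis using assms span_singleton by auto
qed

end

context vector_space_pair begin

text \<open>Finiteness is a property of sets here, because \<open>End'\<close> is finite-dimensional
  while the ambient space of all maps need not be. The first conclusion passes it from image and
  kernel to \<open>S\<close>, which is how \<open>fin_dim_End\<close> is obtained.\<close>

lemma rank_nullity:
  assumes f: "Vector_Spaces.linear s1 s2 f" and S: "vs1.subspace S"
    and i: "fin_dim s2 (f ` S)" and k: "fin_dim s1 {x\<in>S. f x = 0}"
  shows "fin_dim s1 S" "vs1.dim S = vs2.dim (f ` S) + vs1.dim {x\<in>S. f x = 0}"
proof -
  let ?K = "{x\<in>S. f x = 0}"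
  have K: "vs1.subspace ?K"
    using S linear_0[OF f] linear_add[OF f] linear_scale[OF f]
    by (auto simp: vs1.subspace_def)
  obtain C where C: "finite C" "C \<subseteq> ?K" "vs1.independent C" "vs1.span C = ?K" "card C = vs1.dim ?K"
    using vs1.fin_dim_basis[OF k K] by blast
  obtain B where B: "C \<subseteq> B" "B \<subseteq> S" "vs1.independent B" "S \<subseteq> vs1.span B"
    using vs1.maximal_independent_subset_extend[of C S] C by blast
  have sB: "vs1.span B = S" using B S by (simp add: vs1.span_subspace)
  let ?D = "B - C"
  have inj: "inj_on f (vs1.span ?D)"
  proof (subst linear_inj_on_iff_eq_0[OF f])
    show "\<forall>x\<in>vs1.span ?D. f x = 0 \<longrightarrow> x = 0"
    proof (intro ballI impI)
      fix x assume x: "x \<in> vs1.span ?D" "f x = 0"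
      then have "x \<in> ?K" using sB vs1.span_mono[of ?D B] by auto
      then show "x = 0" using vs1.independent_span_Int[OF B(3,1)] x C by auto
    qed
  qed simp
  have ind: "vs2.independent (f ` ?D)"
    using linear_independent_injective_image[OF f _ inj] B vs1.independent_mono by blast
  have "f ` S = vs2.span (f ` B)" using sB linear_span_image[OF f] by auto
  also have "\<dots> = vs2.span (f ` ?D)"
  proof -
    have "f ` C \<subseteq> {0}" using C by auto
    then have "f ` B \<subseteq> insert 0 (f ` ?D)" by auto
    then have "vs2.span (f ` B) \<subseteq> vs2.span (f ` ?D)" using vs2.span_mono vs2.span_insert_0 by blast
    then show ?thesis using vs2.span_mono[of "f ` ?D" "f ` B"] by auto
  qed
  finally have im: "f ` S = vs2.span (f ` ?D)" .
  then have c: "vs2.dim (f ` S) = card (f ` ?D)" using vs2.dim_span_eq_card_independent[OF ind] by simp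
  have "finite (f ` ?D)"
    using i ind im vs2.independent_span_bound vs2.span_superset unfolding fin_dim_def by (metis subset_trans)
  moreover have inj': "inj_on f ?D" using inj vs1.span_superset inj_on_subset by blast
  ultimately have fD: "finite ?D" by (rule finite_imageD)
  then have fB: "finite B" using C by (metis finite_Diff2)
  then show "fin_dim s1 S" using B unfolding fin_dim_def by auto
  have "card B = card ?D + card C" using fB B C by (metis add.commute card_Diff_subset card_mono le_add_diff_inverse)
  then show "vs1.dim S = vs2.dim (f ` S) + vs1.dim ?K"
    using c C B card_image[OF inj'] vs1.basis_card_eq_dim[of B S] by simp
qed

end

section \<open>Operators of a right vector space\<close>

locale div_space = central_subfield \<iota> + right_vector_space smult
  + V: finite_dimensional_vector_space "scaleV \<iota> smult" BV
  + K: finite_dimensional_vector_space "\<lambda>a x. \<iota> a * x" BD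
  for \<iota> :: "'f::field \<Rightarrow> 'd::division_ring"
    and smult :: "'v::ab_group_add \<Rightarrow> 'd \<Rightarrow> 'v" (infixl "\<cdot>" 75)
    and BV :: "'v set" and BD :: "'d set"
begin

sublocale E: vector_space "scaleE \<iota> smult"
  by (rule vector_space_scaleE) unfold_locales

sublocale EV: vector_space_pair "scaleE \<iota> smult" "scaleV \<iota> smult" by unfold_locales
sublocale EE: vector_space_pair "scaleE \<iota> smult" "scaleE \<iota> smult" by unfold_locales
sublocale KV: finite_dimensional_vector_space_pair_1 "\<lambda>a x. \<iota> a * x" BD "scaleV \<iota> smult" by unfold_locales
sublocale VF: vector_space_pair "scaleV \<iota> smult" "(*)" by unfold_locales (simp_all add: algebra_simps)
sublocale VV: finite_dimensional_vector_space_pair_1 "scaleV \<iota> smult" BV "scaleV \<iota> smult" by unfold_locales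

abbreviation "End' \<equiv> End smult"
abbreviation "dsub \<equiv> right_subspace smult"
abbreviation "d \<equiv> card BD"
abbreviation scF (infixr "*f" 75) where "c *f x \<equiv> scaleV \<iota> smult c x"
abbreviation "dimV \<equiv> V.dim"
abbreviation "dimE \<equiv> E.dim"

lemma iota_0 [simp]: "\<iota> 0 = 0"
  using add[of 0 0] by simp

lemma iota_minus [simp]: "\<iota> (- a) = - \<iota> a"
  using add[of a "- a"] by (simp add: eq_neg_iff_add_eq_0 add.commute)

lemma iota_diff: "\<iota> (a - b) = \<iota> a - \<iota> b"
  using add[of a "- b"] by simp

lemma iota_eq_0 [simp]: "\<iota> a = 0 \<longleftrightarrow> a = 0"
  using mult[of a "inverse a"] one by (cases "a = 0") auto

lemma iota_inverse: "\<iota> (inverse a) = inverse (\<iota> a)"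
  using mult[of a "inverse a"] one by (cases "a = 0") (auto intro: inverse_unique[symmetric])

lemma iota_inj: "\<iota> a = \<iota> b \<longleftrightarrow> a = b"
  using iota_diff[of a b] iota_eq_0[of "a - b"] by auto

lemma smult_0_left [simp]: "0 \<cdot> a = 0"
  using smult_add_left[of 0 0 a] by simp

lemma smult_0_right [simp]: "x \<cdot> 0 = 0"
  using smult_add_right[of x 0 0] by simp

lemma smult_minus_left: "(- x) \<cdot> a = - (x \<cdot> a)"
  using smult_add_left[of x "- x" a] by (simp add: eq_neg_iff_add_eq_0 add.commute)

lemma smult_minus_right: "x \<cdot> (- a) = - (x \<cdot> a)"
  using smult_add_right[of x a "- a"] by (simp add: eq_neg_iff_add_eq_0 add.commute)

lemma smult_diff_left: "(x - y) \<cdot> a = x \<cdot> a - y \<cdot> a"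
  using smult_add_left[of x "- y" a] by (simp add: smult_minus_left)

lemma smult_diff_right: "x \<cdot> (a - b) = x \<cdot> a - x \<cdot> b"
  using smult_add_right[of x a "- b"] by (simp add: smult_minus_right)

lemma smult_eq_0 [simp]: "x \<cdot> a = 0 \<longleftrightarrow> x = 0 \<or> a = 0"
proof
  assume h: "x \<cdot> a = 0"
  show "x = 0 \<or> a = 0"
  proof (rule disjCI)
    assume "a \<noteq> 0"
    then have "x = (x \<cdot> a) \<cdot> inverse a" by (simp add: smult_assoc smult_one)
    then show "x = 0" using h by simp
  qed
qed auto

lemma scF_smult: "(c *f x) \<cdot> a = c *f (x \<cdot> a)"
  by (simp add: scaleV_def smult_assoc central)

section \<open>D-subspaces and their dimension over F\<close>

lemma dsub_0: "dsub W \<Longrightarrow> 0 \<in> W"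
  and dsub_add: "dsub W \<Longrightarrow> x \<in> W \<Longrightarrow> y \<in> W \<Longrightarrow> x + y \<in> W"
  and dsub_smult: "dsub W \<Longrightarrow> x \<in> W \<Longrightarrow> x \<cdot> a \<in> W"
  by (auto simp: right_subspace_def)

lemma dsub_neg: "dsub W \<Longrightarrow> x \<in> W \<Longrightarrow> - x \<in> W"
  using dsub_smult[of W x "- 1"] by (simp add: smult_minus_right smult_one)

lemma dsub_diff: "dsub W \<Longrightarrow> x \<in> W \<Longrightarrow> y \<in> W \<Longrightarrow> x - y \<in> W"
  using dsub_add[of W x "- y"] dsub_neg by simp

lemma dsub_smult_iff: "dsub W \<Longrightarrow> a \<noteq> 0 \<Longrightarrow> x \<cdot> a \<in> W \<longleftrightarrow> x \<in> W"
  using dsub_smult[of W x a] dsub_smult[of W "x \<cdot> a" "inverse a"]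
  by (auto simp: smult_assoc smult_one)

lemma dsub_subspace: "dsub W \<Longrightarrow> V.subspace W"
  by (auto simp: right_subspace_def V.subspace_def scaleV_def)

lemma dsub_singleton: "dsub {0}"
  by (auto simp: right_subspace_def)

lemma dsub_Int: "dsub A \<Longrightarrow> dsub B \<Longrightarrow> dsub (A \<inter> B)"
  by (auto simp: right_subspace_def)

definition dsum :: "'v set \<Rightarrow> 'v set \<Rightarrow> 'v set" where
  "dsum A B = {a + b | a b. a \<in> A \<and> b \<in> B}"

definition line :: "'v \<Rightarrow> 'v set" where "line x = range (smult x)"

lemma dsub_dsum: "dsub A \<Longrightarrow> dsub B \<Longrightarrow> dsub (dsum A B)"
  unfolding right_subspace_def dsum_def
proof (intro conjI ballI allI; elim conjE)
  assume "0 \<in> A" "0 \<in> B" then show "0 \<in> {a + b |a b. a \<in> A \<and> b \<in> B}" by force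
next
  fix x y assume *: "x \<in> {a + b |a b. a \<in> A \<and> b \<in> B}" "y \<in> {a + b |a b. a \<in> A \<and> b \<in> B}"
    "\<forall>x\<in>A. \<forall>y\<in>A. x + y \<in> A" "\<forall>x\<in>B. \<forall>y\<in>B. x + y \<in> B"
  then obtain a b a' b' where "x = a + b" "y = a' + b'" "a \<in> A" "b \<in> B" "a' \<in> A" "b' \<in> B" by auto
  then have "x + y = (a + a') + (b + b')" "a + a' \<in> A" "b + b' \<in> B" using * by (auto simp: algebra_simps)
  then show "x + y \<in> {a + b |a b. a \<in> A \<and> b \<in> B}" by blast
next
  fix x c assume *: "x \<in> {a + b |a b. a \<in> A \<and> b \<in> B}"
    "\<forall>x\<in>A. \<forall>c. x \<cdot> c \<in> A" "\<forall>x\<in>B. \<forall>c. x \<cdot> c \<in> B"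
  then obtain a b where "x = a + b" "a \<in> A" "b \<in> B" by auto
  then have "x \<cdot> c = a \<cdot> c + b \<cdot> c" "a \<cdot> c \<in> A" "b \<cdot> c \<in> B" using * by (auto simp: smult_add_left)
  then show "x \<cdot> c \<in> {a + b |a b. a \<in> A \<and> b \<in> B}" by blast
qed

lemma dsum_sub: "dsub A \<Longrightarrow> dsub B \<Longrightarrow> A \<subseteq> dsum A B" "dsub A \<Longrightarrow> dsub B \<Longrightarrow> B \<subseteq> dsum A B"
  unfolding dsum_def using dsub_0 by force+

lemma dsum_least: "dsub W \<Longrightarrow> A \<subseteq> W \<Longrightarrow> B \<subseteq> W \<Longrightarrow> dsum A B \<subseteq> W"
  unfolding dsum_def using dsub_add by blast

lemma dsub_line: "dsub (line x)"
  unfolding line_def right_subspace_def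
proof (intro conjI ballI allI)
  show "0 \<in> range ((\<cdot>) x)" using smult_0_right[of x] by (metis rangeI)
qed (auto simp: smult_assoc smult_add_right[symmetric])

lemma line_self: "x \<in> line x"
  unfolding line_def using smult_one[of x] by (metis rangeI)

lemma line_least: "dsub W \<Longrightarrow> x \<in> W \<Longrightarrow> line x \<subseteq> W"
  unfolding line_def using dsub_smult by auto

lemma line_Int: "dsub W \<Longrightarrow> x \<notin> W \<Longrightarrow> W \<inter> line x = {0}"
  using dsub_smult_iff[of W _ x] dsub_0 by (auto simp: line_def)

lemma dim_line: assumes "x \<noteq> 0" shows "dimV (line x) = d"
proof -
  have "Vector_Spaces.linear (\<lambda>a x. \<iota> a * x) (scaleV \<iota> smult) (smult x)"
    unfolding Vector_Spaces.linear_iff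
    by (auto simp: smult_add_right scaleV_def smult_assoc central K.vector_space_axioms V.vector_space_axioms)
  moreover have "inj (smult x)"
    using assms smult_eq_0[of x] by (auto intro!: injI simp: smult_diff_right)
      (metis eq_iff_diff_eq_0 smult_diff_right smult_eq_0)
  ultimately have "dimV (range (smult x)) = K.dim UNIV"
    using KV.dim_image_eq[of "smult x" UNIV] by auto
  then show ?thesis unfolding line_def by simp
qed

lemma d_pos: "0 < d"
proof -
  have "(1::'d) \<in> K.span BD" unfolding K.span_Basis by simp
  then have "BD \<noteq> {}" using K.span_empty by auto
  then show ?thesis using K.finite_Basis by (simp add: card_gt_0_iff)
qed

lemma dim_dsum: "dsub A \<Longrightarrow> dsub B \<Longrightarrow> dimV (dsum A B) + dimV (A \<inter> B) = dimV A + dimV B"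
  unfolding dsum_def using V.dim_sums_Int dsub_subspace by blast

lemma dim_dsum_line: "dsub A \<Longrightarrow> x \<notin> A \<Longrightarrow> dimV (dsum A (line x)) = dimV A + d"
  using dim_dsum[OF _ dsub_line, of A x] line_Int[of A x] dim_line[of x] dsub_0 by auto

text \<open>All dimensions are taken over F; the dimension over D survives only as this divisibility
  by \<open>d\<close>. Each step enlarges \<open>A\<close> by a line, which adds exactly
  \<open>d\<close>.\<close>

lemma dim_multiple:
  assumes "dsub A" "dsub B" "A \<subseteq> B" shows "\<exists>m. dimV B = dimV A + m * d"
  using assms
proof (induction "dimV B - dimV A" arbitrary: A rule: less_induct)
  case less
  show ?case
  proof (cases "A = B")
    case False
    then obtain x where x: "x \<in> B" "x \<notin> A" using less by auto
    let ?A = "dsum A (line x)"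
    have A: "dsub ?A" "?A \<subseteq> B" "dimV ?A = dimV A + d"
      using less x dsub_dsum dsub_line dsum_least line_least dim_dsum_line by auto
    then have "dimV ?A \<le> dimV B" using V.dim_subset by blast
    then have "dimV B - dimV ?A < dimV B - dimV A" using A d_pos by linarith
    then obtain m where "dimV B = dimV ?A + m * d" using less A by blast
    then have "dimV B = dimV A + Suc m * d" using A by simp
    then show ?thesis by blast
  qed (auto intro: exI[of _ 0])
qed

text \<open>Prescribing a part \<open>B\<close> of the complement lets
  \<open>projection_exists\<close> and \<open>coordinate_exists\<close> choose what is sent to
  zero.\<close>

lemma dsub_complement:
  assumes "dsub A" "dsub B" "A \<inter> B = {0}"
  shows "\<exists>C. dsub C \<and> B \<subseteq> C \<and> A \<inter> C = {0} \<and> dsum A C = UNIV"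
  using assms
proof (induction "dimV UNIV - dimV B" arbitrary: B rule: less_induct)
  case less
  show ?case
  proof (cases "dsum A B = UNIV")
    case False
    then obtain x where x: "x \<notin> dsum A B" by auto
    let ?B = "dsum B (line x)"
    have xB: "x \<notin> B" using x less.prems dsum_sub(2)[OF less.prems(1,2)] by blast
    have B: "dsub ?B" "dimV ?B = dimV B + d" "B \<subseteq> ?B"
      using dsub_dsum[OF less.prems(2) dsub_line] dim_dsum_line[OF less.prems(2) xB]
        dsum_sub(1)[OF less.prems(2) dsub_line] by blast+
    have "y = 0" if y: "y \<in> A" "y \<in> ?B" for y
    proof -
      obtain b a where ba: "b \<in> B" "y = b + x \<cdot> a" using y by (auto simp: dsum_def line_def)
      show ?thesis
      proof (cases "a = 0")
        case True
        then have "y \<in> A \<inter> B" using ba y by simp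
        then show ?thesis using less.prems(3) by blast
      next
        case False
        have "x \<cdot> a = y + (- b)" using ba by simp
        moreover have "- b \<in> B" using ba less.prems(2) dsub_neg by simp
        ultimately have "x \<cdot> a \<in> dsum A B" using y unfolding dsum_def by blast
        then show ?thesis using x False dsub_smult_iff[OF dsub_dsum[OF less.prems(1,2)]] by blast
      qed
    qed
    then have AB: "A \<inter> ?B = {0}" using dsub_0[OF less.prems(1)] dsub_0[OF B(1)] by blast
    have "dimV ?B \<le> dimV UNIV" using V.dim_subset by blast
    then have "dimV UNIV - dimV ?B < dimV UNIV - dimV B" using B(2) d_pos by linarith
    then obtain C where "dsub C" "?B \<subseteq> C" "A \<inter> C = {0}" "dsum A C = UNIV"
      using less.hyps[OF _ less.prems(1) B(1) AB] by blast
    then show ?thesis using B(3) by blast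
  next
    case True
    then show ?thesis using less.prems by blast
  qed
qed

section \<open>D-linear operators, projections and coordinates\<close>

lemma End_add: "u \<in> End' \<Longrightarrow> u (x + y) = u x + u y"
  and End_smult: "u \<in> End' \<Longrightarrow> u (x \<cdot> a) = u x \<cdot> a"
  by (auto simp: End_def)

lemma End_scF: "u \<in> End' \<Longrightarrow> u (c *f x) = c *f u x"
  by (simp add: scaleV_def End_smult)

lemma End_0: "u \<in> End' \<Longrightarrow> u 0 = 0"
  using End_smult[of u 0 0] by simp

lemma End_minus: "u \<in> End' \<Longrightarrow> u (- x) = - u x"
  using End_smult[of u x "- 1"] by (simp add: smult_minus_right smult_one)

lemma End_diff: "u \<in> End' \<Longrightarrow> u (x - y) = u x - u y"
  using End_add[of u x "- y"] End_minus by simp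

lemma End_comp: "u \<in> End' \<Longrightarrow> w \<in> End' \<Longrightarrow> (\<lambda>x. u (w x)) \<in> End'"
  by (simp add: End_def)

lemma End_minusI: "u \<in> End' \<Longrightarrow> w \<in> End' \<Longrightarrow> u - w \<in> End'"
  by (simp add: End_def smult_diff_left algebra_simps)

lemma End_kernel: "u \<in> End' \<Longrightarrow> dsub {x. u x = 0}"
  by (auto simp: right_subspace_def End_0 End_add End_smult)

lemma projection_exists:
  assumes "dsub A" "dsub B" "A \<inter> B = {0}"
  obtains p where "p \<in> End'" "\<And>x. p x \<in> A" "\<And>x. x \<in> A \<Longrightarrow> p x = x" "\<And>x. x \<in> B \<Longrightarrow> p x = 0"
proof -
  obtain C where C: "dsub C" "B \<subseteq> C" "A \<inter> C = {0}" "dsum A C = UNIV"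
    using dsub_complement assms by blast
  have "\<exists>a. a \<in> A \<and> x - a \<in> C" for x
  proof -
    have "x \<in> dsum A C" using C by simp
    then show ?thesis unfolding dsum_def by auto
  qed
  then obtain p where p: "\<And>x. p x \<in> A" "\<And>x. x - p x \<in> C" by metis
  have u: "p x = a" if "a \<in> A" "x - a \<in> C" for x a
  proof -
    have "p x - a \<in> A" using p that dsub_diff assms by blast
    moreover have "p x - a = (x - a) - (x - p x)" by simp
    then have "p x - a \<in> C" using p that dsub_diff C by metis
    ultimately have "p x - a \<in> A \<inter> C" by blast
    then show ?thesis using C by simp
  qed
  have "p (x + y) = p x + p y" for x y
  proof (rule u)
    have "x + y - (p x + p y) = (x - p x) + (y - p y)" by simp
    then show "x + y - (p x + p y) \<in> C" using p dsub_add C by metis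
  qed (use p dsub_add assms in auto)
  moreover have "p (x \<cdot> a) = p x \<cdot> a" for x a
    using p dsub_smult[of A] dsub_smult[OF C(1) p(2)[of x], of a] assms 
    by (intro u) (auto simp: smult_diff_left)
  ultimately have "p \<in> End'" by (simp add: End_def)
  moreover have "p x = x" if "x \<in> A" for x using u[of x x] that C dsub_0 by auto
  moreover have "p x = 0" if "x \<in> B" for x using u[of 0 x] that C dsub_0 assms by auto
  ultimately show ?thesis using that p by blast
qed

definition dlin :: "('v \<Rightarrow> 'd) \<Rightarrow> bool" where
  "dlin \<xi> \<longleftrightarrow> (\<forall>x y. \<xi> (x + y) = \<xi> x + \<xi> y) \<and> (\<forall>x a. \<xi> (x \<cdot> a) = \<xi> x * a)"

lemma rank1_End: "dlin \<xi> \<Longrightarrow> (\<lambda>v. p \<cdot> \<xi> v) \<in> End'"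
  by (simp add: dlin_def End_def smult_add_right smult_assoc)

lemma coordinate_exists:
  assumes "dsub B" "x \<notin> B"
  obtains \<xi> where "dlin \<xi>" "\<xi> x = 1" "\<And>b. b \<in> B \<Longrightarrow> \<xi> b = 0"
proof -
  have x0: "x \<noteq> 0" using assms dsub_0 by auto
  obtain p where p: "p \<in> End'" "\<And>v. p v \<in> line x" "\<And>v. v \<in> line x \<Longrightarrow> p v = v" "\<And>v. v \<in> B \<Longrightarrow> p v = 0"
    using projection_exists[of "line x" B] line_Int assms dsub_line by (metis inf_commute)
  have inj: "a = b" if "x \<cdot> a = x \<cdot> b" for a b
    using that x0 smult_eq_0[of x "a - b"] by (simp add: smult_diff_right)
  have "\<forall>v. \<exists>a. p v = x \<cdot> a" using p(2) unfolding line_def by auto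
  then obtain \<xi> where \<xi>: "\<And>v. p v = x \<cdot> \<xi> v" by metis
  have "dlin \<xi>" unfolding dlin_def
    using End_add[OF p(1)] End_smult[OF p(1)] \<xi> by (auto intro!: inj simp: smult_add_right smult_assoc)
  moreover have "\<xi> x = 1" using p(3)[OF line_self] \<xi> by (intro inj) (simp add: smult_one)
  moreover have "\<xi> b = 0" if "b \<in> B" for b using p(4)[OF that] \<xi> by (intro inj) simp
  ultimately show ?thesis using that by blast
qed

section \<open>Idempotents and their corners\<close>

definition fixs :: "('v \<Rightarrow> 'v) \<Rightarrow> 'v set" where "fixs e = {x. e x = x}"

definition idem :: "('v \<Rightarrow> 'v) \<Rightarrow> bool" where
  "idem e \<longleftrightarrow> e \<in> End' \<and> (\<forall>x. e (e x) = e x)"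

text \<open>The corner \<open>e End e\<close>: the operators of the image of the idempotent \<open>e\<close>, extended by
  zero. Working in corners avoids subspaces and quotient spaces as separate types.\<close>

definition corner :: "('v \<Rightarrow> 'v) \<Rightarrow> ('v \<Rightarrow> 'v) set" where
  "corner e = {u \<in> End'. (\<forall>x. e (u x) = u x) \<and> (\<forall>x. u (e x) = u x)}"

lemma fixsI: "e x = x \<Longrightarrow> x \<in> fixs e" and fixsD: "x \<in> fixs e \<Longrightarrow> e x = x"
  by (auto simp: fixs_def)

lemma dsub_fixs: "e \<in> End' \<Longrightarrow> dsub (fixs e)"
  by (auto simp: right_subspace_def fixs_def End_0 End_add End_smult)

lemma idem_fixs: "idem e \<Longrightarrow> e x \<in> fixs e"
  by (auto simp: fixs_def idem_def)

lemma cornerD: "u \<in> corner e \<Longrightarrow> u \<in> End'" "u \<in> corner e \<Longrightarrow> e (u x) = u x" "u \<in> corner e \<Longrightarrow> u (e x) = u x"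
  "u \<in> corner e \<Longrightarrow> u x \<in> fixs e"
  by (auto simp: corner_def fixs_def)

lemma corner_trans: "p \<in> corner e \<Longrightarrow> u \<in> corner p \<Longrightarrow> u \<in> corner e"
  unfolding corner_def mem_Collect_eq by metis

text \<open>The projection onto \<open>P\<close> is chosen to kill the kernel of \<open>e\<close>;
  this forces \<open>p (e x) = p x\<close> and puts \<open>p\<close> into the corner.\<close>

lemma sub_idem:
  assumes e: "idem e" and P: "dsub P" "P \<subseteq> fixs e"
  obtains p where "idem p" "p \<in> corner e" "fixs p = P"
proof -
  have e': "e \<in> End'" "\<And>x. e (e x) = e x" using e by (auto simp: idem_def)
  have "P \<inter> {x. e x = 0} = {0}" 
    using P dsub_0[OF P(1)] End_0[OF e'(1)] by (auto simp: fixs_def)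
  then obtain p where p: "p \<in> End'" "\<And>x. p x \<in> P" "\<And>x. x \<in> P \<Longrightarrow> p x = x" "\<And>x. e x = 0 \<Longrightarrow> p x = 0"
    using projection_exists[OF P(1) End_kernel[OF e'(1)]] by auto
  have 1: "idem p" using p by (simp add: idem_def)
  have "p (e x) = p x" for x
    using p(4)[of "e x - x"] End_diff[OF e'(1)] End_diff[OF p(1)] e'(2) by simp
  moreover have "e (p x) = p x" for x using p(2) P fixsD by blast
  ultimately have "p \<in> corner e" using p by (simp add: corner_def)
  moreover have "fixs p = P"
  proof
    show "fixs p \<subseteq> P" using p(2) fixsD by (metis subsetI)
    show "P \<subseteq> fixs p" using p(3) fixsI by blast
  qed
  ultimately show ?thesis using that 1 by blast
qed

lemma idem_diff:
  assumes e: "idem e" and p: "idem p" "p \<in> corner e"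
  shows "idem (e - p)" "e - p \<in> corner e" "fixs (e - p) = {x\<in>fixs e. p x = 0}"
    "dimV (fixs e) = dimV (fixs p) + dimV (fixs (e - p))"
proof -
  have e': "e \<in> End'" "\<And>x. e (e x) = e x" using e by (auto simp: idem_def)
  have p': "p \<in> End'" "\<And>x. p (p x) = p x" "\<And>x. e (p x) = p x" "\<And>x. p (e x) = p x"
    using p by (auto simp: idem_def corner_def)
  have q: "e - p \<in> End'" using e' p' End_minusI by blast
  show 1: "idem (e - p)" unfolding idem_def
    using q by (simp add: End_diff[OF e'(1)] End_diff[OF p'(1)] e' p')
  show 2: "e - p \<in> corner e" unfolding corner_def
    using q by (simp add: End_diff[OF e'(1)] e' p')
  show 3: "fixs (e - p) = {x\<in>fixs e. p x = 0}"
  proof (intro set_eqI iffI)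
    fix x assume "x \<in> fixs (e - p)"
    then have x: "e x - p x = x" by (simp add: fixs_def)
    have "e (e x - p x) = e x - p x" by (simp add: End_diff[OF e'(1)] e' p')
    moreover have "p (e x - p x) = 0" by (simp add: End_diff[OF p'(1)] p')
    ultimately show "x \<in> {x\<in>fixs e. p x = 0}" using x by (simp add: fixs_def)
  qed (auto simp: fixs_def)
  have "dsum (fixs p) (fixs (e - p)) = fixs e"
  proof
    show "dsum (fixs p) (fixs (e - p)) \<subseteq> fixs e"
    proof (rule dsum_least)
      show "dsub (fixs e)" using dsub_fixs e' by auto
      show "fixs p \<subseteq> fixs e" using p'(3) by (metis fixsD fixsI subsetI)
    qed (use 3 in auto)
    show "fixs e \<subseteq> dsum (fixs p) (fixs (e - p))"
    proof
      fix x assume "x \<in> fixs e"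
      then have "x = p x + (e - p) x" by (simp add: fixs_def)
      then show "x \<in> dsum (fixs p) (fixs (e - p))"
        unfolding dsum_def using idem_fixs 1 p by blast
    qed
  qed
  moreover have "fixs p \<inter> fixs (e - p) = {0}"
    unfolding 3 using fixsD[of _ p] fixsI[of p 0] fixsI[of e 0] End_0 e' p' by auto
  ultimately show "dimV (fixs e) = dimV (fixs p) + dimV (fixs (e - p))"
    using dim_dsum[OF dsub_fixs[OF p'(1)] dsub_fixs[OF q]] by simp
qed

lemma corner_coordinate:
  assumes e: "idem e" and x: "x \<in> fixs e" "x \<notin> H" and H: "dsub H"
  obtains \<xi> where "dlin \<xi>" "\<xi> x = 1" "\<And>v. \<xi> (e v) = \<xi> v" "\<And>h. h \<in> H \<Longrightarrow> h \<in> fixs e \<Longrightarrow> \<xi> h = 0"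
    "\<And>p. p \<in> fixs e \<Longrightarrow> (\<lambda>v. p \<cdot> \<xi> v) \<in> corner e"
proof -
  have e': "e \<in> End'" "\<And>x. e (e x) = e x" using e by (auto simp: idem_def)
  obtain \<xi> where \<xi>: "dlin \<xi>" "\<xi> x = 1" "\<And>b. b \<in> H \<Longrightarrow> \<xi> b = 0"
    using coordinate_exists[OF H x(2)] by blast
  let ?\<xi> = "\<lambda>v. \<xi> (e v)"
  have 1: "dlin ?\<xi>" using \<xi>(1) e' unfolding dlin_def by (simp add: End_add End_smult)
  show ?thesis
  proof (rule that[of ?\<xi>])
    show "(\<lambda>v. p \<cdot> \<xi> (e v)) \<in> corner e" if "p \<in> fixs e" for p
      using rank1_End[OF 1] that e' End_smult[OF e'(1)] by (simp add: corner_def fixs_def)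
  qed (use 1 \<xi> x e' in \<open>auto simp: fixs_def\<close>)
qed

section \<open>F-linear spaces of operators\<close>

lemma linear_ev: "Vector_Spaces.linear (scaleE \<iota> smult) (scaleV \<iota> smult) (\<lambda>u. u x)"
  unfolding Vector_Spaces.linear_iff
  by (simp add: E.vector_space_axioms V.vector_space_axioms scaleE_def)

lemma fin_dim_V: "fin_dim (scaleV \<iota> smult) S"
  unfolding fin_dim_def using V.finite_Basis V.span_Basis by auto

text \<open>An operator vanishing on the basis \<open>BV\<close> is zero. The set \<open>C\<close>
  collects the basis vectors released from this condition; each release adds at most the dimension
  of an evaluation image.\<close>

lemma fin_dim_End: "fin_dim (scaleE \<iota> smult) End'"
proof -
  have sub: "E.subspace {u\<in>End'. \<forall>x\<in>C. u x = 0}" for C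
    using subspace_End[OF central_subfield_axioms right_vector_space_axioms]
    unfolding E.subspace_def by (auto simp: scaleE_def)
  have "finite C \<Longrightarrow> fin_dim (scaleE \<iota> smult) {u\<in>End'. \<forall>x\<in>BV - C. u x = 0}" for C
  proof (induction C rule: finite_induct)
    case empty
    have "{u\<in>End'. \<forall>x\<in>BV - {}. u x = 0} \<subseteq> {0}"
    proof clarsimp
      fix u assume u: "u \<in> End'" "\<forall>x\<in>BV. u x = 0"
      have "V.span BV \<subseteq> {x. u x = 0}"
        using u dsub_subspace[OF End_kernel[OF u(1)]] by (intro V.span_minimal) auto
      then show "u = 0" using V.span_Basis by (auto simp: fun_eq_iff)
    qed
    then show ?case unfolding fin_dim_def by (intro exI[of _ "{}"]) auto
  next
    case (insert b C)
    have "{u \<in> {u\<in>End'. \<forall>x\<in>BV - insert b C. u x = 0}. u b = 0} \<subseteq> {u\<in>End'. \<forall>x\<in>BV - C. u x = 0}"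
      by auto
    then show ?case
      using EV.rank_nullity(1)[OF linear_ev[of b] sub fin_dim_V] insert E.fin_dim_mono by blast
  qed
  from this[of BV] show ?thesis using V.finite_Basis by auto
qed

lemma fin_dim_E: "S \<subseteq> End' \<Longrightarrow> fin_dim (scaleE \<iota> smult) S"
  using fin_dim_End E.fin_dim_mono by blast

abbreviation "Esub \<equiv> End_subspace \<iota> smult"

lemma EsubD: "Esub S \<Longrightarrow> u \<in> S \<Longrightarrow> u \<in> End'" "Esub S \<Longrightarrow> E.subspace S"
  and Esub_0: "Esub S \<Longrightarrow> (\<lambda>x. 0) \<in> S"
  and Esub_add: "Esub S \<Longrightarrow> u \<in> S \<Longrightarrow> w \<in> S \<Longrightarrow> (\<lambda>x. u x + w x) \<in> S"
  and Esub_diff: "Esub S \<Longrightarrow> u \<in> S \<Longrightarrow> w \<in> S \<Longrightarrow> (\<lambda>x. u x - w x) \<in> S"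
  and Esub_scF: "Esub S \<Longrightarrow> u \<in> S \<Longrightarrow> (\<lambda>x. c *f u x) \<in> S"
  unfolding End_subspace_def
  using E.subspace_0[of S] E.subspace_add[of S u w] E.subspace_diff[of S u w] E.subspace_scale[of S u c]
  by (auto simp: plus_fun_def fun_diff_def zero_fun_def scaleE_def)

lemma EsubI:
  assumes "S \<subseteq> End'" "(\<lambda>x. 0) \<in> S" "\<And>u w. u \<in> S \<Longrightarrow> w \<in> S \<Longrightarrow> (\<lambda>x. u x + w x) \<in> S"
    "\<And>u c. u \<in> S \<Longrightarrow> (\<lambda>x. c *f u x) \<in> S"
  shows "Esub S"
  using assms unfolding End_subspace_def E.subspace_def
  by (auto simp: plus_fun_def zero_fun_def scaleE_def)

lemma Esub_eq: "Esub S \<Longrightarrow> Esub T \<Longrightarrow> S \<subseteq> T \<Longrightarrow> dimE T \<le> dimE S \<Longrightarrow> S = T"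
  using E.fin_dim_subspace_eq fin_dim_E unfolding End_subspace_def by blast

lemma Esub_ev_kernel: "Esub S \<Longrightarrow> Esub {u\<in>S. u x = 0}"
  by (rule EsubI) (auto simp: EsubD Esub_0 Esub_add Esub_scF)

lemma Esub_into:
  assumes "Esub S" "dsub R"
  shows "Esub {u\<in>S. u x \<in> R}" "Esub {u\<in>S. \<forall>x. u x \<in> R}"
proof -
  have scale: "c *f p \<in> R" if "p \<in> R" for c p
    using dsub_smult[OF assms(2) that] by (simp add: scaleV_def)
  show "Esub {u\<in>S. u x \<in> R}"
    by (rule EsubI) (use EsubD(1)[OF assms(1)] Esub_0[OF assms(1)] Esub_add[OF assms(1)] Esub_scF[OF assms(1)]
      dsub_0[OF assms(2)] dsub_add[OF assms(2)] scale in auto)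
  show "Esub {u\<in>S. \<forall>x. u x \<in> R}"
    by (rule EsubI) (use EsubD(1)[OF assms(1)] Esub_0[OF assms(1)] Esub_add[OF assms(1)] Esub_scF[OF assms(1)]
      dsub_0[OF assms(2)] dsub_add[OF assms(2)] scale in auto)
qed

abbreviation orb :: "('v \<Rightarrow> 'v) set \<Rightarrow> 'v \<Rightarrow> 'v set" where "orb S x \<equiv> (\<lambda>u. u x) ` S"

lemma dim_orb_0: assumes "Esub S" shows "dimV (orb S 0) = 0"
proof -
  have "orb S 0 \<subseteq> {0}" using End_0 EsubD(1)[OF assms] by auto
  then show ?thesis using V.dim_eq_0[of "orb S 0"] by blast
qed

lemma orb_subspace: "Esub S \<Longrightarrow> V.subspace (orb S x)"
  using EV.linear_subspace_image[OF linear_ev] EsubD by blast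

lemma dim_orb: "Esub S \<Longrightarrow> dimE S = dimV (orb S x) + dimE {u\<in>S. u x = 0}"
  by (intro EV.rank_nullity(2)[OF linear_ev] fin_dim_V fin_dim_E EsubD) (auto simp: EsubD)

lemma dim_lcomp:
  assumes S: "Esub S" and p: "p \<in> End'"
  shows "dimE S = dimE ((\<lambda>u x. p (u x)) ` S) + dimE {u\<in>S. \<forall>x. p (u x) = 0}"
    "Esub ((\<lambda>u x. p (u x)) ` S)"
proof -
  let ?f = "\<lambda>u x. p (u x)"
  have l: "Vector_Spaces.linear (scaleE \<iota> smult) (scaleE \<iota> smult) ?f"
    unfolding Vector_Spaces.linear_iff
    using End_add[OF p] End_scF[OF p] by (auto simp: E.vector_space_axioms scaleE_def)
  have k: "{u\<in>S. ?f u = 0} = {u\<in>S. \<forall>x. p (u x) = 0}" by (auto simp: fun_eq_iff)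
  have k': "{u\<in>S. ?f u = 0} \<subseteq> End'" using EsubD(1)[OF S] by blast
  have i: "?f ` S \<subseteq> End'" using p End_comp EsubD(1)[OF S] by blast
  show "dimE S = dimE (?f ` S) + dimE {u\<in>S. \<forall>x. p (u x) = 0}"
    using EE.rank_nullity(2)[OF l EsubD(2)[OF S] fin_dim_E[OF i] fin_dim_E[OF k']]
    unfolding k .
  show "Esub (?f ` S)" unfolding End_subspace_def
    using i EE.linear_subspace_image[OF l] EsubD(2)[OF S] by blast
qed

lemma dim_rcomp:
  assumes S: "Esub S" and p: "p \<in> End'"
  shows "dimE S = dimE ((\<lambda>u x. u (p x)) ` S) + dimE {u\<in>S. \<forall>x. u (p x) = 0}"
    "Esub ((\<lambda>u x. u (p x)) ` S)"
proof -
  let ?f = "\<lambda>u x. u (p x)"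
  have l: "Vector_Spaces.linear (scaleE \<iota> smult) (scaleE \<iota> smult) ?f"
    unfolding Vector_Spaces.linear_iff
    by (auto simp: E.vector_space_axioms scaleE_def)
  have k: "{u\<in>S. ?f u = 0} = {u\<in>S. \<forall>x. u (p x) = 0}" by (auto simp: fun_eq_iff)
  have k': "{u\<in>S. ?f u = 0} \<subseteq> End'" using EsubD(1)[OF S] by blast
  have i: "?f ` S \<subseteq> End'" using p End_comp EsubD(1)[OF S] by blast
  show "dimE S = dimE (?f ` S) + dimE {u\<in>S. \<forall>x. u (p x) = 0}"
    using EE.rank_nullity(2)[OF l EsubD(2)[OF S] fin_dim_E[OF i] fin_dim_E[OF k']]
    unfolding k .
  show "Esub (?f ` S)" unfolding End_subspace_def
    using i EE.linear_subspace_image[OF l] EsubD(2)[OF S] by blast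
qed

end

section \<open>The dimension bound\<close>

primrec ts_dim :: "nat \<Rightarrow> nat \<Rightarrow> nat" where
  "ts_dim d 0 = 0"
| "ts_dim d (Suc k) = ts_dim d k + (Suc k * d - 1)"

text \<open>The cross term is the dimension over F of the D-linear maps from a space of D-dimension
  \<open>m\<close> to one of D-dimension \<open>j\<close>. So an optimal space in block triangular
  form has to contain the whole off-diagonal block (\<open>hom_sub\<close>).\<close>

lemma ts_dim_add:
  assumes "0 < d" shows "ts_dim d (j + m) = ts_dim d j + ts_dim d m + j * m * d"
proof (induction m)
  case (Suc m)
  have "1 \<le> Suc m * d" "1 \<le> Suc (j + m) * d" using assms by (simp_all add: Suc_leI)
  then show ?case using Suc by (simp add: algebra_simps)
qed simp

lemma (in vector_space) independent_eigenvectors: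
  assumes M: "Vector_Spaces.linear scale scale M" and T: "finite T"
    and e: "\<And>s. s \<in> T \<Longrightarrow> e s \<noteq> 0" "\<And>s. s \<in> T \<Longrightarrow> M (e s) = scale (l s) (e s)" and l: "inj_on l T"
  shows "\<not> dependent (e ` T)" "inj_on e T"
proof -
  interpret M: Vector_Spaces.linear scale scale M by fact
  show inj: "inj_on e T"
  proof (rule inj_onI)
    fix s t assume st: "s \<in> T" "t \<in> T" "e s = e t"
    then have "scale (l s) (e s) = scale (l t) (e s)" using e(2) by metis
    then have "l s = l t" using st e(1) scale_cancel_right by blast
    then show "s = t" using l st by (auto dest: inj_onD)
  qed
  have "\<forall>s\<in>T. c s = 0" if "(\<Sum>s\<in>T. scale (c s) (e s)) = 0" for c
    using T e l that
  proof (induction T arbitrary: c rule: finite_induct)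
    case (insert t T)
    let ?S = "\<Sum>s\<in>T. scale (c s) (e s)"
    have 0: "scale (c t) (e t) + ?S = 0" using insert by simp
    have "M (scale (c t) (e t) + ?S) = 0" using 0 by simp
    then have 1: "scale (c t) (scale (l t) (e t)) + (\<Sum>s\<in>T. scale (c s) (scale (l s) (e s))) = 0"
      using insert.prems by (simp add: M.add M.sum M.scale)
    \<comment> \<open>Applying \<open>M - l t\<close> to the relation removes the term of
      \<open>t\<close>.\<close>
    have "(\<Sum>s\<in>T. scale (c s * (l s - l t)) (e s))
      = (\<Sum>s\<in>T. scale (c s) (scale (l s) (e s))) - scale (l t) ?S"
      by (simp add: scale_sum_right sum_subtractf[symmetric] algebra_simps)
    also have "\<dots> = (scale (c t) (scale (l t) (e t)) + (\<Sum>s\<in>T. scale (c s) (scale (l s) (e s))))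
        - scale (l t) (scale (c t) (e t) + ?S)"
      by (simp add: algebra_simps)
    also have "\<dots> = 0" using 0 1 by simp
    finally have "\<forall>s\<in>T. c s * (l s - l t) = 0"
      using insert.IH[of "\<lambda>s. c s * (l s - l t)"] insert.prems by (simp add: inj_on_insert)
    moreover have "l s \<noteq> l t" if "s \<in> T" for s
      using insert.prems(3) insert.hyps that by (auto simp: inj_on_def)
    ultimately have T0: "\<forall>s\<in>T. c s = 0" by auto
    then have "?S = 0" by (intro sum.neutral) auto
    then have "c t = 0" using 0 insert.prems(1)[of t] by simp
    then show ?case using T0 by simp
  qed simp
  note 1 = this
  show "\<not> dependent (e ` T)"
  proof (rule independent_if_scalars_zero)
    fix f x assume "(\<Sum>x\<in>e ` T. scale (f x) x) = 0" "x \<in> e ` T"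
    then show "f x = 0" using 1[of "\<lambda>s. f (e s)"] by (auto simp: sum.reindex[OF inj])
  qed (use T in auto)
qed

context div_space begin

text \<open>\<open>range \<iota>\<close> has the cardinality of \<open>F\<close>; stating the condition for the type \<open>'f\<close> itself would
  make it depend on a hidden type argument.\<close>

abbreviation "big r \<equiv> infinite (range \<iota>) \<or> r \<le> card (range \<iota>)"
abbreviation "g \<equiv> ts_dim d"

lemma span_subspaceV: "V.subspace A \<Longrightarrow> V.span A = A"
  by simp

text \<open>If \<open>c\<close> were outside \<open>S x\<close>, then \<open>M (u x) = \<pi> (u y)\<close>, with a projection \<open>\<pi>\<close> onto \<open>S x\<close> killing
  \<open>c\<close>, would define an operator of \<open>S x\<close> with every element of \<open>F\<close> as an eigenvalue.\<close>

lemma generic_limit: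
  assumes S: "Esub S" and max: "\<And>y. dimV (orb S y) \<le> dimV (orb S x)"
    and big: "big (dimV (orb S x) + 1)" and c: "\<And>s. c \<in> orb S (s *f x + y)"
  shows "c \<in> orb S x"
proof (rule ccontr)
  assume cn: "c \<notin> orb S x"
  let ?A = "orb S x"
  have A: "V.subspace ?A" by (rule orb_subspace[OF S])
  obtain w where w: "range w \<subseteq> S" "Vector_Spaces.linear (scaleV \<iota> smult) (scaleE \<iota> smult) w"
    "\<And>a. a \<in> ?A \<Longrightarrow> w a x = a"
    using EV.linear_exists_right_inverse_on[OF linear_ev[of x] EsubD(2)[OF S]] by auto
  have wS: "w a \<in> S" for a using w(1) by auto
  have wE: "w a \<in> End'" for a using wS EsubD(1)[OF S] by blast
  have w_add: "w (a + b) = w a + w b" and w_scale: "w (t *f a) = scaleE \<iota> smult t (w a)" for a b t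
    using w(2) unfolding Vector_Spaces.linear_iff by auto
  obtain C where C: "finite C" "C \<subseteq> ?A" "\<not> V.dependent C" "V.span C = ?A" "card C = dimV ?A"
    using V.fin_dim_basis[OF fin_dim_V A] by blast
  have ind: "\<not> V.dependent (insert c C)" using V.independent_insertI C cn by simp
  obtain \<pi> where \<pi>: "Vector_Spaces.linear (scaleV \<iota> smult) (scaleV \<iota> smult) \<pi>"
    "\<forall>b\<in>insert c C. \<pi> b = (if b = c then 0 else b)"
    "range \<pi> = V.span ((\<lambda>b. if b = c then 0 else b) ` insert c C)"
    using VV.linear_independent_extend_subspace[OF ind, of "\<lambda>b. if b = c then 0 else b"] by blast
  interpret \<pi>: Vector_Spaces.linear "scaleV \<iota> smult" "scaleV \<iota> smult" \<pi> by fact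
  have "c \<notin> C" using cn C by auto
  then have "(\<lambda>b. if b = c then 0 else b) ` insert c C = insert 0 C" by auto
  then have \<pi>A: "\<pi> v \<in> ?A" for v using \<pi>(3) C(4) by auto
  have \<pi>c: "\<pi> c = 0" using \<pi>(2) by simp
  have \<pi>id: "\<pi> a = a" if "a \<in> ?A" for a
  proof -
    have "a \<in> V.span C" using that C(4) by simp
    then show ?thesis
    proof (rule VV.linear_eq_on[OF \<pi>(1) V.linear_ident])
      fix b assume "b \<in> C" then show "\<pi> b = b" using \<pi>(2) \<open>c \<notin> C\<close> by auto
    qed
  qed
  define M where "M = (\<lambda>a. \<pi> (w a y))"
  have M: "Vector_Spaces.linear (scaleV \<iota> smult) (scaleV \<iota> smult) M"
    unfolding Vector_Spaces.linear_iff M_def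
    by (auto simp: w_add w_scale scaleE_def \<pi>.add \<pi>.scale V.vector_space_axioms)
  \<comment> \<open>If \<open>- s\<close> were not an eigenvalue, evaluation at
    \<open>s x + y\<close> followed by \<open>\<pi>\<close> would be injective on
    \<open>S x\<close>. The image of \<open>?A\<close> under \<open>L\<close> would then have the
    dimension of \<open>S x\<close> and miss \<open>c\<close>; together with \<open>c\<close> it
    would make the orbit of \<open>s x + y\<close> larger than the maximum.\<close>
  have ex: "\<exists>a. a \<in> ?A \<and> a \<noteq> 0 \<and> M a = (- s) *f a" for s
  proof (rule ccontr)
    assume n: "\<not> ?thesis"
    define L where "L = (\<lambda>a. w a (s *f x + y))"
    have L: "Vector_Spaces.linear (scaleV \<iota> smult) (scaleV \<iota> smult) L"
      unfolding Vector_Spaces.linear_iff L_def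
      by (auto simp: w_add w_scale scaleE_def V.vector_space_axioms)
    have \<pi>L: "\<pi> (L a) = s *f a + M a" if "a \<in> ?A" for a
      unfolding L_def M_def using that w(3) wE by (simp add: End_add End_scF \<pi>.add \<pi>.scale \<pi>id)
    have L0: "a = 0" if "a \<in> ?A" "\<pi> (L a) = 0" for a
      using \<pi>L[of a] that n by (auto simp: add_eq_0_iff)
    have sA: "V.span ?A = ?A" using A by simp
    have "inj_on L (V.span ?A)"
      unfolding sA VV.linear_inj_on_iff_eq_0[OF L A]
    proof (intro ballI impI)
      fix a assume "a \<in> ?A" "L a = 0"
      then show "a = 0" using L0[of a] \<pi>.zero by simp
    qed
    then have dL: "dimV (L ` ?A) = dimV ?A" by (intro VV.dim_image_eq[OF L])
    have subL: "V.subspace (L ` ?A)" using VV.linear_subspace_image[OF L A] .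
    have "c \<notin> L ` ?A"
    proof
      assume "c \<in> L ` ?A"
      then obtain a where a: "a \<in> ?A" "c = L a" by auto
      then have "a = 0" using L0 \<pi>c by auto
      then have "c = 0" using a VV.linear_0[OF L] by simp
      then show False using cn V.subspace_0[OF A] by simp
    qed
    then have "dimV (insert c (L ` ?A)) = dimV ?A + 1"
      using dL V.dim_insert[of c "L ` ?A"] span_subspaceV[OF subL] by simp
    moreover have "L ` ?A \<subseteq> orb S (s *f x + y)"
      unfolding L_def using wS by blast
    then have "insert c (L ` ?A) \<subseteq> orb S (s *f x + y)" using c[of s] by blast
    note V.dim_subset[OF this]
    ultimately show False using max[of "s *f x + y"] by linarith
  qed
  have "\<exists>e. \<forall>s. e s \<in> ?A \<and> e s \<noteq> 0 \<and> M (e s) = (- s) *f e s"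
    using ex by (intro choice allI)
  then obtain e where e: "\<And>s. e s \<in> ?A" "\<And>s. e s \<noteq> 0" "\<And>s. M (e s) = (- s) *f e s"
    by blast
  \<comment> \<open>One eigenvalue more than the dimension of \<open>?A\<close> gives the
    contradiction. The values are picked in \<open>range \<iota>\<close>, the set that
    \<open>big\<close> counts, and pulled back to \<open>'f\<close>.\<close>
  obtain U where U: "finite U" "card U = dimV ?A + 1" "U \<subseteq> range \<iota>"
  proof (cases "finite (range \<iota>)")
    case True
    then show ?thesis using big that obtain_subset_with_card_n[of "dimV ?A + 1" "range \<iota>"] by blast
  next
    case False
    then show ?thesis using that infinite_arbitrarily_large[of "range \<iota>" "dimV ?A + 1"] by blast
  qed
  obtain T :: "'f set" where "inj_on \<iota> T" "U = \<iota> ` T"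
    using U(3) subset_image_inj[of U \<iota> UNIV] by blast
  then have T: "finite T" "card T = dimV ?A + 1"
    using U(1,2) card_image[of \<iota> T] finite_imageD[of \<iota> T] by simp_all
  have "\<not> V.dependent (e ` T)" "inj_on e T"
    using V.independent_eigenvectors[where M = M and T = T and e = e and l = uminus, OF M T(1) e(2,3)]
    by (simp_all add: inj_on_def)
  moreover have "e ` T \<subseteq> ?A" using e(1) by blast
  ultimately have "card (e ` T) \<le> dimV ?A" "card (e ` T) = card T"
    using V.independent_card_le_dim[of "e ` T" ?A] card_image[of e T] by blast+
  then show False using T by simp
qed

text \<open>Since \<open>u\<close> kills \<open>x\<close>, it takes the same value at
  \<open>y\<close> and at every \<open>s x + y\<close>.\<close>

lemma generic_kernel:
  assumes S: "Esub S" and max: "\<And>y. dimV (orb S y) \<le> dimV (orb S x)"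
    and big: "big (dimV (orb S x) + 1)" and u: "u \<in> S" "u x = 0"
  shows "u y \<in> orb S x"
proof (rule generic_limit[OF S max big])
  show "u y \<in> orb S (s *f x + y)" for s
    using u EsubD(1)[OF S] by (auto intro!: rev_image_eqI[OF u(1)] simp: End_add End_scF)
qed

text \<open>The operator \<open>w - s u\<close> sends \<open>s x + y\<close> to \<open>w y\<close>:
  the terms in \<open>s\<close> cancel by \<open>w x = u y\<close>, and the term in
  \<open>s\<^sup>2\<close> vanishes by \<open>u x = 0\<close>. This is the source of
  \<open>b0_T\<close>.\<close>

lemma generic_second:
  assumes S: "Esub S" and max: "\<And>y. dimV (orb S y) \<le> dimV (orb S x)"
    and big: "big (dimV (orb S x) + 1)" and u: "u \<in> S" "u x = 0" and w: "w \<in> S" "w x = u y"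
  shows "w y \<in> orb S x"
proof (rule generic_limit[OF S max big])
  fix s
  show "w y \<in> orb S (s *f x + y)"
  proof (rule rev_image_eqI)
    show "(\<lambda>v. w v - s *f u v) \<in> S" using Esub_diff[OF S w(1) Esub_scF[OF S u(1)]] .
    show "w y = w (s *f x + y) - s *f u (s *f x + y)"
      using u w EsubD(1)[OF S] by (simp add: End_add End_scF)
  qed
qed

text \<open>Injectivity of \<open>id - u\<close>, which in finite dimension amounts to invertibility
  (\<open>trivial_spectrum_iff\<close>). A vector fixed by an element of \<open>corner e\<close>
  lies in \<open>fixs e\<close>, so the condition means the same on a corner as on the whole
  space.\<close>

definition TS :: "('v \<Rightarrow> 'v) set \<Rightarrow> bool" where
  "TS S \<longleftrightarrow> (\<forall>u\<in>S. \<forall>x. u x = x \<longrightarrow> x = 0)"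

lemma TSD: "TS S \<Longrightarrow> u \<in> S \<Longrightarrow> u x = x \<Longrightarrow> x = 0" by (auto simp: TS_def)

lemma idem_split:
  assumes e: "idem e" and p: "idem p" "p \<in> corner e" and q: "q = e - p"
  shows "idem q" "q \<in> corner e" "fixs q = {x\<in>fixs e. p x = 0}"
    "dimV (fixs e) = dimV (fixs p) + dimV (fixs q)" "p x + q x = e x" "q (p x) = 0" "p (q x) = 0"
    "x \<in> fixs p \<Longrightarrow> q x = 0"
proof -
  show 1: "q (p x) = 0" "p (q x) = 0" for x
    using e p End_diff[of e] End_diff[of p] by (auto simp: q idem_def corner_def)
  show "q x = 0" if "x \<in> fixs p" for x
    using 1(1)[of x] fixsD[OF that] by simp
qed (use idem_diff[OF e p] q in simp_all)

text \<open>A vector \<open>y\<close> fixed by the compression of \<open>u\<close> yields the vector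
  \<open>p (u y) + y = u y\<close>, which \<open>u\<close> itself fixes because \<open>u\<close>
  kills \<open>fixs p\<close>.\<close>

lemma compress:
  assumes e: "idem e" and p: "idem p" "p \<in> corner e" and q: "q = e - p"
    and T: "Esub T" "T \<subseteq> corner e" "TS T" and k': "\<forall>u\<in>T. \<forall>y\<in>fixs p. u y = 0"
  shows "(\<lambda>u y. q (u y)) ` T \<subseteq> corner q" "TS ((\<lambda>u y. q (u y)) ` T)"
proof -
  have k: "\<And>u y. u \<in> T \<Longrightarrow> y \<in> fixs p \<Longrightarrow> u y = 0" using k' by blast
  note * = idem_split(1,2,3,5,6,7)[OF e p q]
  have qE: "q \<in> End'" "\<And>x. q (q x) = q x" using * by (auto simp: idem_def)
  have uq: "u (q y) = u y" if "u \<in> T" for u y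
  proof -
    have u: "u \<in> corner e" using that T by auto
    have "u (p y + q y) = u y" using * cornerD[OF u] by simp
    then show ?thesis using k[OF that idem_fixs[OF p(1)]] End_add[OF cornerD(1)[OF u]] by simp
  qed
  show "(\<lambda>u y. q (u y)) ` T \<subseteq> corner q"
  proof clarify
    fix u assume u: "u \<in> T"
    then show "(\<lambda>y. q (u y)) \<in> corner q"
      using uq[OF u] qE End_comp[OF qE(1) EsubD(1)[OF T(1) u]] by (simp add: corner_def)
  qed
  show "TS ((\<lambda>u y. q (u y)) ` T)" unfolding TS_def
  proof clarify
    fix u y assume u: "u \<in> T" and y: "q (u y) = y"
    have uc: "u \<in> corner e" using u T by auto
    have "u (p (u y) + y) = u y" using k[OF u idem_fixs[OF p(1)]] End_add[OF cornerD(1)[OF uc]] by simp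
    moreover have "p (u y) + y = u y" using *(4)[of "u y"] y cornerD(2)[OF uc] by simp
    ultimately have "p (u y) + y = 0" using TSD[OF T(3) u, of "p (u y) + y"] by simp
    then have "q (u y) = 0" using \<open>p (u y) + y = u y\<close> End_0[OF qE(1)] by simp
    then show "y = 0" using y by simp
  qed
qed

lemma zero_dim_E: "dimE {\<lambda>x. 0} = 0"
proof -
  have "{\<lambda>x. 0} = E.span {}" by (simp add: zero_fun_def)
  then show ?thesis using E.dim_le_card[of "{\<lambda>x. 0}" "{}"] by simp
qed

theorem ts_bound:
  assumes "idem e" "dimV (fixs e) = k * d" "Esub S" "S \<subseteq> corner e" "TS S" "big (k * d)"
  shows "dimE S \<le> g k"
  using assms
proof (induction k arbitrary: e S)
  case 0
  then have f0: "fixs e \<subseteq> {0}" using V.dim_eq_0 by simp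
  have "u = (\<lambda>x. 0)" if "u \<in> S" for u
    using cornerD(4)[of u e] that 0(4) f0 by (auto simp: fun_eq_iff)
  then have "S \<subseteq> {\<lambda>x. 0}" by blast
  then have "S = {\<lambda>x. 0}" using Esub_0[OF 0(3)] by auto
  then show ?case using zero_dim_E by simp
next
  case (Suc k)
  note S = Suc.prems(3) and SC = Suc.prems(4)
  have e': "e \<in> End'" "\<And>x. e (e x) = e x" using Suc.prems(1) by (auto simp: idem_def)
  have "\<not> fixs e \<subseteq> {0}" using Suc.prems(2) d_pos V.dim_eq_0[of "fixs e"] by fastforce
  then obtain x0 where "x0 \<in> fixs e \<and> x0 \<noteq> 0" by blast
  moreover have "\<And>y. dimV (orb S y) < dimV UNIV + 1" using V.dim_subset[OF subset_UNIV] by (simp add: le_imp_less_Suc)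
  ultimately obtain x where x: "x \<in> fixs e" "x \<noteq> 0"
    and xm: "\<And>y. y \<in> fixs e \<and> y \<noteq> 0 \<Longrightarrow> dimV (orb S y) \<le> dimV (orb S x)"
    using ex_has_greatest_nat[of "\<lambda>y. y \<in> fixs e \<and> y \<noteq> 0" x0 "\<lambda>y. dimV (orb S y)" "dimV UNIV + 1"] by metis
  have max: "dimV (orb S y) \<le> dimV (orb S x)" for y
  proof -
    have "orb S y = orb S (e y)" using SC by (intro image_cong) (auto simp: corner_def)
    moreover have "dimV (orb S 0) = 0" by (rule dim_orb_0[OF S])
    ultimately show ?thesis using xm[of "e y"] idem_fixs[OF Suc.prems(1)] by (cases "e y = 0") (auto simp del: V.dim_eq_0)
  qed
  have xo: "x \<notin> orb S x" using TSD[OF Suc.prems(5)] x by force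
  have of: "orb S x \<subseteq> fixs e" using SC cornerD(4) by blast
  have "dimV (orb S x) < dimV (fixs e)"
    using V.dim_psubset[of "orb S x" "fixs e"] span_subspaceV[OF orb_subspace[OF S]]
      span_subspaceV[OF dsub_subspace[OF dsub_fixs[OF e'(1)]]] of x xo by auto
  then have dx: "dimV (orb S x) + 1 \<le> Suc k * d" using Suc.prems(2) by simp
  then have big: "big (dimV (orb S x) + 1)" using Suc.prems(6) le_trans by blast
  let ?T = "{u\<in>S. u x = 0}"
  have T: "Esub ?T" "?T \<subseteq> corner e" "TS ?T" using Esub_ev_kernel[OF S] SC Suc.prems(5) by (auto simp: TS_def)
  obtain p where p: "idem p" "p \<in> corner e" "fixs p = line x"
    using sub_idem[OF Suc.prems(1) dsub_line line_least[OF dsub_fixs[OF e'(1)] x(1)]] by blast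
  define q where "q = e - p"
  note q = q_def idem_split(1,2,4,5)[OF Suc.prems(1) p(1,2) q_def]
  have k: "\<forall>u\<in>?T. \<forall>y\<in>fixs p. u y = 0"
    using p(3) EsubD(1)[OF S] by (auto simp: line_def End_smult)
  note c = compress[OF Suc.prems(1) p(1,2) q(1) T k]
  note l = dim_lcomp[OF T(1) cornerD(1)[OF q(3)]]
  have "dimE ((\<lambda>u y. q (u y)) ` ?T) \<le> g k"
  proof (rule Suc.IH[OF q(2) _ l(2) c])
    show "dimV (fixs q) = k * d" using q(4) p(3) dim_line[OF x(2)] Suc.prems(2) by simp
    show "big (k * d)" using Suc.prems(6) by auto
  qed
  \<comment> \<open>The compression loses nothing: a nonzero \<open>u\<close> in \<open>?T\<close>
    with values in the line of \<open>x\<close> would take the value \<open>x\<close>, and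
    \<open>generic_kernel\<close> would put \<open>x\<close> into \<open>S x\<close>.\<close>
  moreover have "{u\<in>?T. \<forall>y. q (u y) = 0} \<subseteq> {\<lambda>x. 0}"
  proof clarsimp
    fix u assume u: "u \<in> S" "u x = 0" "\<forall>y. q (u y) = 0"
    have "u y = 0" for y
    proof (rule ccontr)
      assume n: "u y \<noteq> 0"
      have "u y = p (u y)" using q(5)[of "u y"] u(3) cornerD(2)[of u e] SC u(1) by auto
      then have "u y \<in> line x" using idem_fixs[OF p(1)] p(3) by metis
      then obtain a where a: "u y = x \<cdot> a" by (auto simp: line_def)
      then have "a \<noteq> 0" using n by auto
      then have "u (y \<cdot> inverse a) = x"
        using a EsubD(1)[OF S u(1)] by (simp add: End_smult smult_assoc smult_one)
      then show False using generic_kernel[OF S max big u(1,2), of "y \<cdot> inverse a"] xo by simp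
    qed
    then show "u = (\<lambda>x. 0)" by auto
  qed
  then have "{u\<in>?T. \<forall>y. q (u y) = 0} = {\<lambda>x. 0}" using Esub_0[OF S] End_0 q(3) cornerD(1) by auto
  ultimately have "dimE ?T \<le> g k" using l(1) zero_dim_E by simp
  then show ?case using dim_orb[OF S, of x] dx by simp
qed

section \<open>Spaces that attain the bound\<close>

lemma hyperplane_exists:
  assumes "V.subspace P" "V.subspace W" "P \<subseteq> W" "x \<in> W" "x \<notin> P"
  obtains M where "V.subspace M" "P \<subseteq> M" "M \<subseteq> W" "x \<notin> M" "dimV M + 1 = dimV W"
proof -
  obtain C where C: "finite C" "C \<subseteq> P" "\<not> V.dependent C" "V.span C = P" "card C = dimV P"
    using V.fin_dim_basis[OF fin_dim_V assms(1)] by blast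
  have "\<not> V.dependent (insert x C)" using V.independent_insertI[of x C] C assms by simp
  then obtain B where B: "insert x C \<subseteq> B" "B \<subseteq> W" "\<not> V.dependent B" "W \<subseteq> V.span B"
    using V.maximal_independent_subset_extend[of "insert x C" W] C(2) assms(3,4) by blast
  have sB: "V.span B = W" using V.span_subspace[OF B(2,4) assms(2)] .
  let ?M = "V.span (B - {x})"
  have xM: "x \<notin> ?M" using B(1,3) V.dependent_def[of B] by blast
  have xC: "x \<notin> C" using C assms by auto
  have fB: "finite B" using V.finiteI_independent[OF B(3)] .
  have "dimV ?M = card (B - {x})"
    using V.dim_span_eq_card_independent[OF V.independent_mono[OF B(3)], of "B - {x}"] by simp
  moreover have "dimV W = card B" using V.dim_span_eq_card_independent[OF B(3)] sB by simp
  moreover have "card B = card (B - {x}) + 1" using card.remove[OF fB, of x] B(1) by simp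
  moreover have "?M \<subseteq> W" using sB V.span_mono[of "B - {x}" B] by auto
  moreover have "P \<subseteq> ?M" using C(4) B(1) xC V.span_mono[of C "B - {x}"] by blast
  ultimately show ?thesis using that[of ?M] xM V.subspace_span by simp
qed

text \<open>A space \<open>S'\<close> attaining the bound on a complement of the line of
  \<open>x\<close> is enlarged by the rank one maps that send \<open>x\<close> into a hyperplane
  \<open>M\<close> containing this complement but not \<open>x\<close>. A fixed vector with nonzero
  coordinate along \<open>x\<close> would force the component of \<open>m\<close> along
  \<open>x\<close> to be \<open>x\<close> itself, hence \<open>x\<close> into
  \<open>M\<close>.\<close>

theorem ts_exists:
  assumes "idem e" "dimV (fixs e) = k * d"
  shows "\<exists>S. Esub S \<and> S \<subseteq> corner e \<and> TS S \<and> dimE S = g k"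
  using assms
proof (induction k arbitrary: e)
  case 0
  have "Esub {\<lambda>x. 0}" by (rule EsubI) (auto simp: End_def)
  moreover have "{\<lambda>x. 0} \<subseteq> corner e" using End_0 0 by (auto simp: corner_def idem_def End_def)
  ultimately show ?case using zero_dim_E by (auto simp: TS_def intro!: exI[of _ "{\<lambda>x. 0}"])
next
  case (Suc k)
  have e': "e \<in> End'" "\<And>x. e (e x) = e x" using Suc.prems(1) by (auto simp: idem_def)
  have "\<not> fixs e \<subseteq> {0}" using Suc.prems(2) d_pos V.dim_eq_0[of "fixs e"] by fastforce
  then obtain x where x: "x \<in> fixs e" "x \<noteq> 0" by blast
  obtain p where p: "idem p" "p \<in> corner e" "fixs p = line x"
    using sub_idem[OF Suc.prems(1) dsub_line line_least[OF dsub_fixs[OF e'(1)] x(1)]] by blast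
  define q where "q = e - p"
  note q = q_def idem_split(1-7)[OF Suc.prems(1) p(1,2) q_def]
  have qE: "q \<in> End'" and pE: "p \<in> End'" using q p by (auto simp: idem_def)
  have dq: "dimV (fixs q) = k * d" using q(5) p(3) dim_line[OF x(2)] Suc.prems(2) by simp
  obtain S' where S': "Esub S'" "S' \<subseteq> corner q" "TS S'" "dimE S' = g k"
    using Suc.IH[OF q(2) dq] by blast
  have px: "p x = x" using p(3) line_self fixsD by blast
  have qx: "q x = 0" using q(7)[of x] px by simp
  have xq: "x \<notin> fixs q" using px x q(4) by auto
  have qe: "fixs q \<subseteq> fixs e" using q(4) by auto
  obtain M where M: "V.subspace M" "fixs q \<subseteq> M" "M \<subseteq> fixs e" "x \<notin> M" "dimV M + 1 = dimV (fixs e)"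
    using hyperplane_exists[OF dsub_subspace[OF dsub_fixs[OF qE]] dsub_subspace[OF dsub_fixs[OF e'(1)]] qe x(1) xq] .
  obtain \<xi> where \<xi>: "dlin \<xi>" "\<xi> x = 1" "\<And>v. \<xi> (e v) = \<xi> v" "\<And>h. h \<in> fixs q \<Longrightarrow> h \<in> fixs e \<Longrightarrow> \<xi> h = 0"
    "\<And>m. m \<in> fixs e \<Longrightarrow> (\<lambda>v. m \<cdot> \<xi> v) \<in> corner e"
    using corner_coordinate[OF Suc.prems(1) x(1) xq dsub_fixs[OF qE]] by blast
  let ?S = "{(\<lambda>v. s v + m \<cdot> \<xi> v) | s m. s \<in> S' \<and> m \<in> M}"
  have S'e: "s \<in> corner e" if "s \<in> S'" for s using S'(2) corner_trans[OF q(3)] that by blast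
  have SI: "(\<lambda>v. s v + m \<cdot> \<xi> v) \<in> ?S" if "s \<in> S'" "m \<in> M" for s m
    using that by blast
  have SC: "?S \<subseteq> corner e"
  proof clarify
    fix s m assume "s \<in> S'" "m \<in> M"
    then have "s \<in> corner e" "(\<lambda>v. m \<cdot> \<xi> v) \<in> corner e" using S'e \<xi>(5) M(3) by auto
    then show "(\<lambda>v. s v + m \<cdot> \<xi> v) \<in> corner e"
      using e' by (auto simp: corner_def End_def smult_add_left algebra_simps)
  qed
  have sx: "s x = 0" if "s \<in> S'" for s
    using cornerD(3)[of s q x] S'(2) that qx End_0[OF EsubD(1)[OF S'(1) that]] by auto
  have ES: "Esub ?S"
  proof (rule EsubI)
    show "?S \<subseteq> End'" using SC cornerD(1) by blast
    show "(\<lambda>x. 0) \<in> ?S" using Esub_0[OF S'(1)] V.subspace_0[OF M(1)] by force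
    fix u assume "u \<in> ?S"
    then obtain s m where u: "u = (\<lambda>v. s v + m \<cdot> \<xi> v)" "s \<in> S'" "m \<in> M" by auto
    show "(\<lambda>x. c *f u x) \<in> ?S" for c
    proof -
      have "(\<lambda>x. c *f u x) = (\<lambda>v. c *f s v + (c *f m) \<cdot> \<xi> v)"
        using u by (simp add: V.scale_right_distrib scF_smult)
      then show ?thesis using SI[OF Esub_scF[OF S'(1) u(2)] V.subspace_scale[OF M(1) u(3)], of c c] by simp
    qed
    fix w assume "w \<in> ?S"
    then obtain s' m' where w: "w = (\<lambda>v. s' v + m' \<cdot> \<xi> v)" "s' \<in> S'" "m' \<in> M" by auto
    have "(\<lambda>x. u x + w x) = (\<lambda>v. (s v + s' v) + (m + m') \<cdot> \<xi> v)"
      using u w by (simp add: smult_add_left algebra_simps)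
    then show "(\<lambda>x. u x + w x) \<in> ?S"
      using SI[OF Esub_add[OF S'(1) u(2) w(2)] V.subspace_add[OF M(1) u(3) w(3)]] by simp
  qed
  have "TS ?S" unfolding TS_def
  proof clarify
    fix s m v assume s: "s \<in> S'" "m \<in> M" and v: "s v + m \<cdot> \<xi> v = v"
    let ?a = "\<xi> v"
    have "(\<lambda>v. s v + m \<cdot> \<xi> v) \<in> corner e" using SC s by blast
    from cornerD(4)[OF this, of v] v have ve: "v \<in> fixs e" by simp
    have pl: "\<exists>b. p y = x \<cdot> b" for y
      using idem_fixs[OF p(1), of y] p(3) by (auto simp: line_def)
    have pa: "p v = x \<cdot> ?a"
    proof -
      obtain b where b: "p v = x \<cdot> b" using pl by blast
      have "\<xi> v = \<xi> (p v + q v)" using q(6) \<xi>(3) by simp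
      also have "\<dots> = b" using b \<xi>(1,2) \<xi>(4)[of "q v"] idem_fixs[OF q(2)] qe by (auto simp: dlin_def)
      finally show ?thesis using b by simp
    qed
    obtain l where l: "p m = x \<cdot> l" using pl by blast
    have "s v = q (s v)" using S'(2) s cornerD(2)[of s q] by auto
    then have "p (s v) = 0" using q(8) by metis
    then have "x \<cdot> (l * ?a) = x \<cdot> ?a"
      using arg_cong[OF v, of p] pa l by (simp add: End_add[OF pE] End_smult[OF pE] smult_assoc)
    then have "x \<cdot> ((l - 1) * ?a) = 0" by (simp add: smult_diff_right algebra_simps)
    then have "l = 1 \<or> ?a = 0" using x by simp
    moreover have "l \<noteq> 1"
    proof
      assume "l = 1"
      then have "m = x + q m" using q(6)[of m] l M(3) s fixsD[of m e] by (auto simp: smult_one)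
      then have "x = m - q m" by (metis add_diff_cancel_right')
      then have "x \<in> M" using V.subspace_diff[OF M(1) s(2)] M(2) idem_fixs[OF q(2)] by (metis subsetD)
      then show False using M by simp
    qed
    ultimately have "s v = v" using v by simp
    then show "v = 0" using TSD[OF S'(3) s(1)] by simp
  qed
  moreover have "dimE ?S = g (Suc k)"
  proof -
    have "orb ?S x = M"
    proof
      show "orb ?S x \<subseteq> M"
      proof clarify
        fix s m assume "s \<in> S'" "m \<in> M"
        then show "s x + m \<cdot> \<xi> x \<in> M" using sx[of s] \<xi>(2) by (simp add: smult_one)
      qed
      show "M \<subseteq> orb ?S x"
      proof
        fix m assume "m \<in> M"
        then have "(\<lambda>v. 0 + m \<cdot> \<xi> v) \<in> ?S" using SI[OF Esub_0[OF S'(1)]] by simp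
        then show "m \<in> orb ?S x"
          by (rule rev_image_eqI) (simp add: \<xi>(2) smult_one)
      qed
    qed
    moreover have "{u\<in>?S. u x = 0} = S'"
    proof
      show "{u\<in>?S. u x = 0} \<subseteq> S'"
      proof clarify
        fix s m assume s: "s \<in> S'" "m \<in> M" "s x + m \<cdot> \<xi> x = 0"
        then have "m = 0" using sx[of s] \<xi>(2) by (simp add: smult_one)
        then show "(\<lambda>v. s v + m \<cdot> \<xi> v) \<in> S'" using s(1) by simp
      qed
      show "S' \<subseteq> {u\<in>?S. u x = 0}"
      proof
        fix s assume s: "s \<in> S'"
        have "s \<in> ?S" using SI[OF s V.subspace_0[OF M(1)]] by simp
        then show "s \<in> {u\<in>?S. u x = 0}" using sx[OF s] by simp
      qed
    qed
    moreover have "dimV M = Suc k * d - 1" using M(5) Suc.prems(2) by simp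
    ultimately show ?thesis using dim_orb[OF ES, of x] S'(4) by simp
  qed
  ultimately show ?case using ES SC by blast
qed

end

section \<open>Invariant subspaces\<close>

context div_space begin

declare V.dim_eq_0 [simp del]

section \<open>F-linear functionals\<close>

definition lf :: "('v \<Rightarrow> 'f) \<Rightarrow> bool" where
  "lf f \<longleftrightarrow> (\<forall>x y. f (x + y) = f x + f y) \<and> (\<forall>c x. f (c *f x) = c * f x)"

lemma lf_iff_linear: "lf f \<longleftrightarrow> Vector_Spaces.linear (scaleV \<iota> smult) (*) f"
  unfolding lf_def Vector_Spaces.linear_iff
  by (auto simp: V.vector_space_axioms VF.vs2.vector_space_axioms)

lemma lfD: "lf f \<Longrightarrow> f (x + y) = f x + f y" "lf f \<Longrightarrow> f (c *f x) = c * f x"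
  by (auto simp: lf_def)

lemma lf_0: "lf f \<Longrightarrow> f 0 = 0"
  using lfD(2)[of f 0 0] by simp

lemma lf_neg: "lf f \<Longrightarrow> f (- x) = - f x"
  using lfD(1)[of f x "- x"] lf_0[of f] by (simp add: eq_neg_iff_add_eq_0 add.commute)

lemma lf_diff: "lf f \<Longrightarrow> f (x - y) = f x - f y"
  using lfD(1)[of f x "- y"] lf_neg[of f y] by simp

lemma lf_kernel_subspace: "lf f \<Longrightarrow> V.subspace A \<Longrightarrow> V.subspace {x\<in>A. f x = 0}"
  using lf_0[of f] lfD[of f] unfolding V.subspace_def by auto

lemma lf_kernel_dim:
  assumes f: "lf f" and A: "V.subspace A" and x: "x \<in> A" "f x \<noteq> 0"
  shows "dimV A = dimV {x\<in>A. f x = 0} + 1"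
proof -
  let ?K = "{x\<in>A. f x = 0}"
  have K: "V.span ?K = ?K" by (rule span_subspaceV[OF lf_kernel_subspace[OF f A]])
  have "A \<subseteq> V.span (insert x ?K)"
  proof
    fix y assume y: "y \<in> A"
    have "y - (f y / f x) *f x \<in> ?K"
      using V.subspace_diff[OF A y V.subspace_scale[OF A x(1)]] x(2) by (simp add: lf_diff[OF f] lfD(2)[OF f])
    then show "y \<in> V.span (insert x ?K)" unfolding V.span_breakdown_eq using K by blast
  qed
  moreover have "V.span (insert x ?K) \<subseteq> A" using A x by (intro V.span_minimal) auto
  ultimately have "dimV A = dimV (insert x ?K)" using V.dim_span by (metis subset_antisym)
  then show ?thesis using V.dim_insert[of x ?K] K x by simp
qed

lemma lf_kernel_dim_le:
  assumes f: "lf f" and A: "V.subspace A"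
  shows "dimV A \<le> dimV {x\<in>A. f x = 0} + 1"
proof (cases "\<exists>x\<in>A. f x \<noteq> 0")
  case True then show ?thesis using lf_kernel_dim[OF f A] by auto
next
  case False then have "{x\<in>A. f x = 0} = A" by auto
  then show ?thesis by simp
qed

lemma lf_proportional:
  assumes "lf f" "lf h" "V.subspace A" "\<And>y. y \<in> A \<Longrightarrow> f y = 0 \<Longrightarrow> h y = 0" "x \<in> A" "f x \<noteq> 0" "y \<in> A"
  shows "h y = (h x / f x) * f y"
proof -
  have "y - (f y / f x) *f x \<in> A"
    using V.subspace_diff[OF assms(3,7) V.subspace_scale[OF assms(3,5)]] .
  moreover have "f (y - (f y / f x) *f x) = 0" using assms by (simp add: lf_diff lfD(2))
  ultimately have "h (y - (f y / f x) *f x) = 0" using assms(4) by blast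
  then show ?thesis using assms(2) by (simp add: lf_diff lfD(2))
qed

lemma lf_exists:
  assumes M: "V.subspace M" "x \<notin> M"
  obtains f where "lf f" "f x = 1" "\<And>m. m \<in> M \<Longrightarrow> f m = 0"
proof -
  obtain C where C: "finite C" "C \<subseteq> M" "\<not> V.dependent C" "V.span C = M" "card C = dimV M"
    using V.fin_dim_basis[OF fin_dim_V M(1)] by blast
  have "\<not> V.dependent (insert x C)" using V.independent_insertI[of x C] C M by simp
  from VF.linear_independent_extend[OF this, of "\<lambda>b. if b = x then 1 else 0"]
  obtain f where f: "Vector_Spaces.linear (scaleV \<iota> smult) (*) f"
    "\<forall>b\<in>insert x C. f b = (if b = x then 1 else 0)" by blast
  have l: "lf f" using f lf_iff_linear by blast
  have "x \<notin> C" using C M by auto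
  then have "C \<subseteq> {y \<in> UNIV. f y = 0}" using f(2) by auto
  then have "V.span C \<subseteq> {y \<in> UNIV. f y = 0}"
    using lf_kernel_subspace[OF l V.subspace_UNIV] by (rule V.span_minimal)
  then show ?thesis using that[OF l] f(2) C(4) by auto
qed

lemma lf_smult: "lf f \<Longrightarrow> lf (\<lambda>p. f (p \<cdot> a))"
  unfolding lf_def by (simp add: smult_add_left scF_smult)

text \<open>For a D-subspace \<open>P\<close> this is the largest D-subspace of \<open>P\<close> on
  which \<open>f\<close> vanishes.\<close>

definition Dker :: "('v \<Rightarrow> 'f) \<Rightarrow> 'v set \<Rightarrow> 'v set" where
  "Dker f P = {p\<in>P. \<forall>a. f (p \<cdot> a) = 0}"

lemma dsub_Dker: "lf f \<Longrightarrow> dsub P \<Longrightarrow> dsub (Dker f P)"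
  unfolding right_subspace_def Dker_def
  by (auto simp: smult_add_left lfD lf_0 smult_assoc)

text \<open>The conditions for \<open>a\<close> in the basis \<open>BD\<close> suffice, so the
  codimension is at most \<open>d\<close>; it is at least \<open>d\<close> because the line of
  \<open>x\<close> meets \<open>Dker f P\<close> only in zero.\<close>

lemma Dker_dim:
  assumes f: "lf f" and P: "dsub P" and x: "x \<in> P" "f x \<noteq> 0"
  shows "dimV P = dimV (Dker f P) + d" "dsum (Dker f P) (line x) = P" "x \<notin> Dker f P"
proof -
  show xn: "x \<notin> Dker f P" 
  proof
    assume "x \<in> Dker f P"
    then have "f (x \<cdot> 1) = 0" unfolding Dker_def by blast
    then show False using x(2) smult_one[of x] by simp
  qed
  have step: "finite B \<Longrightarrow> V.subspace {p\<in>P. \<forall>a\<in>B. f (p \<cdot> a) = 0} \<and> dimV P \<le> dimV {p\<in>P. \<forall>a\<in>B. f (p \<cdot> a) = 0} + card B" for B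
  proof (induction B rule: finite_induct)
    case empty
    then show ?case using dsub_subspace[OF P] by simp
  next
    case (insert b B)
    let ?A = "{p\<in>P. \<forall>a\<in>B. f (p \<cdot> a) = 0}"
    have eq: "{p\<in>P. \<forall>a\<in>insert b B. f (p \<cdot> a) = 0} = {p\<in>?A. f (p \<cdot> b) = 0}" by auto
    show ?case unfolding eq
      using insert lf_kernel_subspace[OF lf_smult[OF f], of ?A b] lf_kernel_dim_le[OF lf_smult[OF f], of ?A b]
      by simp
  qed
  have "Dker f P = {p\<in>P. \<forall>a\<in>BD. f (p \<cdot> a) = 0}"
  proof -
    have "f (p \<cdot> a) = 0" if p: "\<forall>a\<in>BD. f (p \<cdot> a) = 0" for p a
    proof -
      have "K.subspace {a. f (p \<cdot> a) = 0}"
      proof (rule K.subspaceI)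
        show "0 \<in> {a. f (p \<cdot> a) = 0}" using lf_0[OF f] by simp
        show "x + y \<in> {a. f (p \<cdot> a) = 0}" if "x \<in> {a. f (p \<cdot> a) = 0}" "y \<in> {a. f (p \<cdot> a) = 0}" for x y
          using that lfD[OF f] by (simp add: smult_add_right)
        show "\<iota> c * x \<in> {a. f (p \<cdot> a) = 0}" if "x \<in> {a. f (p \<cdot> a) = 0}" for c x
        proof -
          have "p \<cdot> (\<iota> c * x) = c *f (p \<cdot> x)" by (simp add: central[of c x] scaleV_def smult_assoc)
          then show ?thesis using that lfD[OF f] by simp
        qed
      qed
      then have "K.span BD \<subseteq> {a. f (p \<cdot> a) = 0}" using p by (intro K.span_minimal) auto
      then show ?thesis using K.span_Basis by auto
    qed
    then show ?thesis unfolding Dker_def by auto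
  qed
  then have ge: "dimV P \<le> dimV (Dker f P) + d" using step[OF K.finite_Basis] by simp
  have D: "dsub (Dker f P)" using dsub_Dker[OF f P] .
  have sub: "dsum (Dker f P) (line x) \<subseteq> P"
    by (rule dsum_least[OF P]) (auto simp: Dker_def line_def dsub_smult[OF P x(1)])
  have dd: "dimV (dsum (Dker f P) (line x)) = dimV (Dker f P) + d"
    using dim_dsum_line[OF D xn] .
  show "dsum (Dker f P) (line x) = P"
    using V.subspace_dim_equal[OF dsub_subspace[OF dsub_dsum[OF D dsub_line]] dsub_subspace[OF P] sub] dd ge
    by simp
  then show "dimV P = dimV (Dker f P) + d" using dd by simp
qed

text \<open>The D-linear maps from \<open>fixs e / P\<close> to \<open>P\<close>, realised inside
  the corner: the off-diagonal block of the operators that preserve \<open>P\<close>.\<close>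

definition Hm :: "('v \<Rightarrow> 'v) \<Rightarrow> 'v set \<Rightarrow> ('v \<Rightarrow> 'v) set" where
  "Hm e P = {u\<in>corner e. (\<forall>y\<in>P. u y = 0) \<and> (\<forall>y. u y \<in> P)}"

lemma Esub_corner: "idem e \<Longrightarrow> Esub (corner e)"
  unfolding idem_def
  by (intro EsubI; clarsimp simp: corner_def End_0 End_add End_scF)
    (auto simp: End_def smult_add_left scF_smult algebra_simps V.scale_right_distrib)

lemma Esub_Hm: assumes "idem e" "dsub P" shows "Esub (Hm e P)"
proof (rule EsubI)
  note c = Esub_corner[OF assms(1)]
  show "Hm e P \<subseteq> End'" using EsubD(1)[OF c] by (auto simp: Hm_def)
  show "(\<lambda>x. 0) \<in> Hm e P" using Esub_0[OF c] dsub_0[OF assms(2)] by (simp add: Hm_def)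
  show "(\<lambda>x. u x + w x) \<in> Hm e P" if "u \<in> Hm e P" "w \<in> Hm e P" for u w
    using that Esub_add[OF c, of u w] dsub_add[OF assms(2)] by (simp add: Hm_def)
  show "(\<lambda>x. a *f u x) \<in> Hm e P" if "u \<in> Hm e P" for u a
    using that Esub_scF[OF c, of u a] dsub_smult[OF assms(2)] by (simp add: Hm_def scaleV_def)
qed

lemma Esub_Int: "Esub A \<Longrightarrow> Esub B \<Longrightarrow> Esub (A \<inter> B)"
  by (rule EsubI) (auto simp: EsubD Esub_0 Esub_add Esub_scF)

text \<open>Adding a vector \<open>x\<close> to \<open>Q\<close> costs one evaluation, whose image
  lies in \<open>P\<close>; after \<open>m\<close> lines nothing is left.\<close>

lemma dim_hom_le:
  assumes "idem e" "Esub T" "T \<subseteq> corner e" "dsub Q" "Q \<subseteq> fixs e" "dimV (fixs e) = dimV Q + m * d"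
    "\<forall>u\<in>T. \<forall>y\<in>Q. u y = 0" "\<forall>u\<in>T. \<forall>y. u y \<in> P"
  shows "dimE T \<le> m * dimV P"
  using assms
proof (induction m arbitrary: T Q)
  case 0
  have fe: "dsub (fixs e)" using 0(1) dsub_fixs by (auto simp: idem_def)
  have Q: "Q = fixs e"
    using V.subspace_dim_equal[OF dsub_subspace[OF 0(4)] dsub_subspace[OF fe] 0(5)] 0(6) by simp
  have "u = (\<lambda>x. 0)" if "u \<in> T" for u
  proof
    fix x
    have "u (e x) = 0" using 0(7) that idem_fixs[OF 0(1)] Q by blast
    then show "u x = 0" using cornerD(3)[of u e x] that 0(3) by auto
  qed
  then have "T = {\<lambda>x. 0}" using Esub_0[OF 0(2)] by blast
  then show ?case using zero_dim_E by simp
next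
  case (Suc m)
  have "Q \<noteq> fixs e" using Suc.prems(6) d_pos by auto
  then obtain x where x: "x \<in> fixs e" "x \<notin> Q" using Suc.prems by blast
  have fe: "dsub (fixs e)" using Suc.prems(1) dsub_fixs by (auto simp: idem_def)
  let ?T = "{u\<in>T. u x = 0}" and ?Q = "dsum Q (line x)"
  have "dimE ?T \<le> m * dimV P"
  proof (rule Suc.IH[of ?T ?Q])
    show "idem e" by fact
    show "Esub ?T" using Esub_ev_kernel[OF Suc.prems(2)] .
    show "?T \<subseteq> corner e" using Suc.prems(3) by auto
    show "dsub ?Q" using dsub_dsum[OF Suc.prems(4) dsub_line] .
    show "?Q \<subseteq> fixs e" using dsum_least[OF fe Suc.prems(5) line_least[OF fe x(1)]] .
    show "dimV (fixs e) = dimV ?Q + m * d" using Suc.prems(6) dim_dsum_line[OF Suc.prems(4) x(2)] by simp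
    show "\<forall>u\<in>?T. \<forall>y\<in>?Q. u y = 0"
    proof (intro ballI)
      fix u y assume u: "u \<in> ?T" and "y \<in> ?Q"
      then obtain q a where y: "y = q + x \<cdot> a" "q \<in> Q" by (auto simp: dsum_def line_def)
      have uE: "u \<in> End'" using u EsubD(1)[OF Suc.prems(2)] by auto
      show "u y = 0" using u y Suc.prems(7) by (simp add: End_add[OF uE] End_smult[OF uE])
    qed
    show "\<forall>u\<in>?T. \<forall>y. u y \<in> P" using Suc.prems(8) by auto
  qed
  moreover have "orb T x \<subseteq> P" using Suc.prems(8) by auto
  then have "dimV (orb T x) \<le> dimV P" by (rule V.dim_subset)
  ultimately show ?case using dim_orb[OF Suc.prems(2), of x] by simp
qed

lemma dsub_dim_multiple: assumes "dsub P" obtains j where "dimV P = j * d"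
proof -
  have "dimV {0} = 0" using V.dim_eq_0 by blast
  then show ?thesis using that dim_multiple[OF dsub_singleton assms] dsub_0[OF assms] by auto
qed

text \<open>The restrictions to \<open>P\<close> again have trivial spectrum, so
  \<open>ts_bound\<close> limits this diagonal block; left over are the operators that restrict to
  zero.\<close>

lemma restrict_bound:
  assumes e: "idem e" and S: "Esub S" "S \<subseteq> corner e" "TS S" and P: "dsub P" "P \<subseteq> fixs e" "dimV P = j * d"
    and big: "big (j * d)" and inv: "\<forall>u\<in>S. \<forall>y\<in>P. u y \<in> P"
  shows "dimE S \<le> g j + dimE {u\<in>S. \<forall>y\<in>P. u y = 0}"
proof -
  obtain p where p: "idem p" "p \<in> corner e" "fixs p = P" using sub_idem[OF e P(1,2)] by blast
  note r = dim_rcomp[OF S(1) cornerD(1)[OF p(2)]]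
  have "dimE ((\<lambda>u x. u (p x)) ` S) \<le> g j"
  proof (rule ts_bound[OF p(1) _ r(2) _ _ big])
    show "dimV (fixs p) = j * d" using p P by simp
    show "(\<lambda>u x. u (p x)) ` S \<subseteq> corner p"
    proof clarify
      fix u assume u: "u \<in> S"
      have "u (p x) \<in> P" for x using inv u idem_fixs[OF p(1)] p(3) by blast
      then have "p (u (p x)) = u (p x)" for x using p(3) fixsD by blast
      then show "(\<lambda>x. u (p x)) \<in> corner p"
        using p(1) End_comp[OF EsubD(1)[OF S(1) u]] by (auto simp: corner_def idem_def)
    qed
    show "TS ((\<lambda>u x. u (p x)) ` S)" unfolding TS_def
    proof clarify
      fix u x assume u: "u \<in> S" "u (p x) = x"
      have "x \<in> P" using inv u idem_fixs[OF p(1)] p(3) by metis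
      then have "p x = x" using p(3) fixsD by blast
      then show "x = 0" using TSD[OF S(3) u(1)] u(2) by simp
    qed
  qed
  moreover have "{u\<in>S. \<forall>x. u (p x) = 0} = {u\<in>S. \<forall>y\<in>P. u y = 0}"
  proof -
    have "(\<forall>x. u (p x) = 0) \<longleftrightarrow> (\<forall>y\<in>P. u y = 0)" for u :: "'v \<Rightarrow> 'v"
      using idem_fixs[OF p(1)] p(3) fixsD[of _ p] by metis
    then show ?thesis by simp
  qed
  ultimately show ?thesis using r(1) by simp
qed

text \<open>With a zero block on \<open>P\<close>, \<open>compress\<close> turns the block on the
  quotient into a space with trivial spectrum, and the kernel of this compression is the
  off-diagonal block.\<close>

lemma quotient_bound:
  assumes e: "idem e" and S: "Esub S" "S \<subseteq> corner e" "TS S" and P: "dsub P" "P \<subseteq> fixs e"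
    and dim: "dimV (fixs e) = dimV P + m * d"
    and big: "big (m * d)" and kill: "\<forall>u\<in>S. \<forall>y\<in>P. u y = 0"
  shows "dimE S \<le> g m + dimE (S \<inter> Hm e P)"
proof -
  obtain p where p: "idem p" "p \<in> corner e" "fixs p = P" using sub_idem[OF e P(1,2)] by blast
  define q where "q = e - p"
  note q = q_def idem_split[OF e p(1,2) q_def]
  note r = dim_lcomp[OF S(1) cornerD(1)[OF q(3)]]
  have "\<forall>u\<in>S. \<forall>y\<in>fixs p. u y = 0" using kill p(3) by simp
  note c = compress[OF e p(1,2) q(1) S this]
  have dq: "dimV (fixs q) = m * d" using q(5) p(3) dim by simp
  have "dimE ((\<lambda>u y. q (u y)) ` S) \<le> g m"
    using ts_bound[OF q(2) dq r(2) c big] .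
  moreover have "{u\<in>S. \<forall>x. q (u x) = 0} = S \<inter> Hm e P"
  proof -
    have "(\<forall>x. q (u x) = 0) \<longleftrightarrow> (\<forall>x. u x \<in> P)" if "u \<in> S" for u
    proof
      assume *: "\<forall>x. q (u x) = 0"
      show "\<forall>x. u x \<in> P"
      proof
        fix x
        have "u x = e (u x)" using cornerD(2)[of u e x] that S(2) by auto
        then have "u x = p (u x)" using q(6)[of "u x"] * by simp
        then show "u x \<in> P" using idem_fixs[OF p(1)] p(3) by metis
      qed
    next
      assume "\<forall>x. u x \<in> P" then show "\<forall>x. q (u x) = 0" using q(9) p(3) by blast
    qed
    then show ?thesis using kill S(2) unfolding Hm_def by blast
  qed
  ultimately show ?thesis using r(1) by simp
qed

text \<open>By \<open>ts_dim_add\<close> the last hypothesis says that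
  \<open>S \<inter> Hm e P\<close> has dimension at least \<open>j m d\<close>, which is the most
  that \<open>Hm e P\<close> can have.\<close>

lemma hom_sub:
  assumes e: "idem e" "dimV (fixs e) = (j + m) * d" and S: "Esub S"
    and P: "dsub P" "P \<subseteq> fixs e" "dimV P = j * d"
    and le: "g (j + m) \<le> g j + g m + dimE (S \<inter> Hm e P)"
  shows "Hm e P \<subseteq> S"
proof -
  have "dimE (Hm e P) \<le> m * dimV P"
  proof (rule dim_hom_le[OF e(1) Esub_Hm[OF e(1) P(1)] _ P(1,2)])
    show "dimV (fixs e) = dimV P + m * d" using e P by (simp add: algebra_simps)
  qed (auto simp: Hm_def)
  then have "dimE (Hm e P) \<le> dimE (S \<inter> Hm e P)"
    using le ts_dim_add[OF d_pos, of j m] P(3) by (simp add: algebra_simps)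
  then have "S \<inter> Hm e P = Hm e P"
    using Esub_eq[OF Esub_Int[OF S Esub_Hm[OF e(1) P(1)]] Esub_Hm[OF e(1) P(1)]] by blast
  then show ?thesis by blast
qed

text \<open>The estimates for the two diagonal blocks add up to the hypothesis of
  \<open>hom_sub\<close>. The converse is \<open>hom_sub_invariant\<close>; together they detect
  invariant subspaces by dimension counts.\<close>

lemma invariant_hom_sub:
  assumes e: "idem e" "dimV (fixs e) = k * d" and S: "Esub S" "S \<subseteq> corner e" "TS S" "g k \<le> dimE S"
    and big: "big (k * d)" and P: "dsub P" "P \<subseteq> fixs e" and inv: "\<forall>u\<in>S. \<forall>y\<in>P. u y \<in> P"
  shows "Hm e P \<subseteq> S"
proof -
  obtain j where j: "dimV P = j * d" using dsub_dim_multiple[OF P(1)] .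
  obtain m where m: "dimV (fixs e) = dimV P + m * d"
    using dim_multiple[OF P(1) dsub_fixs P(2)] e(1) by (auto simp: idem_def)
  have "k * d = (j + m) * d" using m j e by (simp add: algebra_simps)
  then have k: "k = j + m" using d_pos by (metis mult_right_cancel less_not_refl)
  have "j * d \<le> k * d" "m * d \<le> k * d" using k by simp_all
  then have bj: "big (j * d)" "big (m * d)" using big le_trans by blast+
  let ?T = "{u\<in>S. \<forall>y\<in>P. u y = 0}"
  have T: "Esub ?T" "?T \<subseteq> corner e" "TS ?T"
    using S by (auto simp: TS_def intro!: EsubI simp: EsubD Esub_0 Esub_add Esub_scF)
  have "?T \<inter> Hm e P = S \<inter> Hm e P" by (auto simp: Hm_def)
  then have "g k \<le> g j + g m + dimE (S \<inter> Hm e P)"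
    using restrict_bound[OF e(1) S(1,2,3) P j bj(1) inv] quotient_bound[OF e(1) T P m bj(2)] S(4) by simp
  then have "g (j + m) \<le> g j + g m + dimE (S \<inter> Hm e P)" using k by simp
  moreover have "dimV (fixs e) = (j + m) * d" using e(2) k by simp
  ultimately show ?thesis using hom_sub[OF e(1) _ S(1) P j] by blast
qed

text \<open>If \<open>w x \<notin> P\<close>, then \<open>w\<close> fixes some \<open>y \<notin> P\<close> modulo \<open>P\<close>, and adding an element of \<open>Hm e P\<close> makes
  it fix \<open>y\<close> itself.\<close>

lemma hom_sub_invariant:
  assumes e: "idem e" and S: "Esub S" "S \<subseteq> corner e" "TS S" and P: "dsub P" "P \<subseteq> fixs e"
    and hom: "Hm e P \<subseteq> S" and w: "w \<in> S" and x: "x \<in> P"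
  shows "w x \<in> P"
proof (rule ccontr)
  assume n: "w x \<notin> P"
  obtain p where p: "idem p" "p \<in> corner e" "fixs p = P" using sub_idem[OF e P] by blast
  define q where "q = e - p"
  note q = q_def idem_split[OF e p(1,2) q_def]
  have qE: "q \<in> End'" using q(2) by (simp add: idem_def)
  have qq: "q (q v) = q v" for v using q(2) by (simp add: idem_def)
  have wc: "w \<in> corner e" and wE: "w \<in> End'" using w S EsubD by auto
  have inP: "z \<in> P" if "z \<in> fixs e" "q z = 0" for z
  proof -
    have "z = p z" using q(6)[of z] that fixsD[OF that(1)] by simp
    then show ?thesis using idem_fixs[OF p(1), of z] p(3) by simp
  qed
  define a where "a = q (w x)"
  have a0: "a \<noteq> 0" using inP[of "w x"] n cornerD(4)[OF wc] by (auto simp: a_def)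
  \<comment> \<open>If \<open>q w\<close> has no nonzero fixed vector on \<open>fixs q\<close>, then
    \<open>1 - q w q\<close> is injective, hence surjective; solving for the right side
    \<open>a = q (w x)\<close> lets the vector \<open>x\<close> of \<open>P\<close> supply the
    missing term.\<close>
  obtain y0 r where y0: "q y0 = y0" "y0 \<noteq> 0" "r \<in> P" "q (w (y0 + r)) = y0"
  proof (cases "\<exists>y. q y = y \<and> y \<noteq> 0 \<and> q (w y) = y")
    case True
    then show ?thesis using that[of _ 0] dsub_0[OF P(1)] by auto
  next
    case False
    define N where "N = (\<lambda>v. v - q (w (q v)))"
    have N: "Vector_Spaces.linear (scaleV \<iota> smult) (scaleV \<iota> smult) N"
      unfolding Vector_Spaces.linear_iff N_def
      using End_add[OF qE] End_add[OF wE] End_scF[OF qE] End_scF[OF wE]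
      by (auto simp: V.vector_space_axioms V.scale_right_diff_distrib)
    have "N v = 0 \<Longrightarrow> v = 0" for v
    proof -
      assume "N v = 0"
      then have v: "v = q (w (q v))" by (simp add: N_def)
      then have "q v = v" using qq by metis
      then show "v = 0" using v False by metis
    qed
    then have "inj N" unfolding VV.linear_inj_iff_eq_0[OF N] by blast
    then have "surj N" using V.linear_inj_imp_surj[OF N] by blast
    then obtain v where "N v = a" by (metis surjD)
    then have v: "a = v - q (w (q v))" by (simp add: N_def)
    have qa: "q a = a" using qq a_def by simp
    have "q a = q v - q (w (q v))" using arg_cong[OF v, of q] qq by (simp add: End_diff[OF qE])
    then have *: "q (w (q v)) + a = q v" using qa by simp
    show ?thesis
    proof (rule that[of "q v" x])
      show "q v \<noteq> 0"
      proof
        assume "q v = 0"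
        then have "q (w (q v)) = 0" using End_0[OF wE] End_0[OF qE] by simp
        then show False using * \<open>q v = 0\<close> a0 by simp
      qed
      show "q (w (q v + x)) = q v" using * by (simp add: End_add[OF wE] End_add[OF qE] a_def)
    qed (use qq x in auto)
  qed
  define y where "y = y0 + r"
  have qr: "q r = 0" using q(9)[of r] p(3) y0(3) by simp
  have qy: "q y = y0" using y0(1) qr by (simp add: y_def End_add[OF qE])
  have y0e: "y0 \<in> fixs e" using q(4) fixsI[of q y0, OF y0(1)] by auto
  have fe: "dsub (fixs e)" using dsub_fixs e by (auto simp: idem_def)
  have "y \<in> fixs e" unfolding y_def using dsub_add[OF fe y0e] y0(3) P(2) by blast
  then have "w y - y \<in> fixs e" using dsub_diff[OF fe] cornerD(4)[OF wc] by blast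
  moreover have "q (w y - y) = 0" using y0(4) qy by (simp add: End_diff[OF qE] y_def)
  ultimately have zP: "w y - y \<in> P" using inP by blast
  have y0P: "y0 \<notin> P" using q(9)[of y0] p(3) y0(1,2) by auto
  obtain \<xi> where \<xi>: "dlin \<xi>" "\<xi> y0 = 1" "\<And>h. h \<in> P \<Longrightarrow> h \<in> fixs e \<Longrightarrow> \<xi> h = 0"
    "\<And>m. m \<in> fixs e \<Longrightarrow> (\<lambda>v. m \<cdot> \<xi> v) \<in> corner e"
    using corner_coordinate[OF e y0e y0P P(1)] by metis
  \<comment> \<open>The correction sends \<open>y\<close> to \<open>y - w y\<close>, since the
    coordinate \<open>\<xi>\<close> is 1 at \<open>y0\<close> and 0 at \<open>r\<close>.\<close>
  let ?C = "\<lambda>v. (y - w y) \<cdot> \<xi> v"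
  have zP': "y - w y \<in> P" using dsub_neg[OF P(1) zP] by simp
  have "?C \<in> Hm e P" unfolding Hm_def
    using \<xi>(3,4) P zP' dsub_smult[OF P(1)] by auto
  then have "(\<lambda>v. w v + ?C v) \<in> S" using Esub_add[OF S(1) w] hom by blast
  moreover have "w y + ?C y = y"
    using \<xi>(1,2) \<xi>(3)[OF y0(3)] y0(3) P(2) by (simp add: y_def dlin_def smult_one subsetD)
  ultimately have "y = 0" using TSD[OF S(3)] by blast
  then show False using qy y0(2) End_0[OF qE] by simp
qed

end

section \<open>Forms on irreducible optimal spaces\<close>

context div_space begin

definition irr :: "('v \<Rightarrow> 'v) \<Rightarrow> ('v \<Rightarrow> 'v) set \<Rightarrow> bool" where
  "irr e S \<longleftrightarrow> (\<forall>W. dsub W \<and> W \<subseteq> fixs e \<and> (\<forall>u\<in>S. \<forall>x\<in>W. u x \<in> W) \<longrightarrow> W = {0} \<or> W = fixs e)"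

lemma irrD:
  assumes "irr e S" "dsub W" "W \<subseteq> fixs e" "\<forall>u\<in>S. \<forall>x\<in>W. u x \<in> W"
  shows "W = {0} \<or> W = fixs e"
  using assms unfolding irr_def by blast

definition bil :: "('v \<Rightarrow> 'v \<Rightarrow> 'f) \<Rightarrow> bool" where
  "bil b \<longleftrightarrow> (\<forall>x. lf (b x)) \<and> (\<forall>y. lf (\<lambda>x. b x y))"

lemma bilD: "bil b \<Longrightarrow> lf (b x)" "bil b \<Longrightarrow> lf (\<lambda>x. b x y)"
  by (auto simp: bil_def)

lemma bil_add: "bil b \<Longrightarrow> b (x + y) z = b x z + b y z" "bil b \<Longrightarrow> b z (x + y) = b z x + b z y"
  using lfD(1)[OF bilD(2)[of b z]] lfD(1)[OF bilD(1)[of b z]] by auto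

lemma bil_scF: "bil b \<Longrightarrow> b (c *f y) z = c * b y z" "bil b \<Longrightarrow> b z (c *f y) = c * b z y"
  using lfD(2)[OF bilD(2)[of b z]] lfD(2)[OF bilD(1)[of b z]] by auto

lemma bil_0: "bil b \<Longrightarrow> b 0 z = 0" "bil b \<Longrightarrow> b z 0 = 0"
  using lf_0[OF bilD(2)[of b z]] lf_0[OF bilD(1)[of b z]] by auto

definition alt :: "('v \<Rightarrow> 'v) \<Rightarrow> ('v \<Rightarrow> 'v \<Rightarrow> 'f) \<Rightarrow> ('v \<Rightarrow> 'v) set \<Rightarrow> bool" where
  "alt e b S \<longleftrightarrow> bil b \<and> (\<forall>u\<in>S. \<forall>y\<in>fixs e. b y (u y) = 0)"

lemma alt_polar:
  assumes "alt e b S" "Esub S" "idem e" "u \<in> S" "y \<in> fixs e" "z \<in> fixs e"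
  shows "b y (u z) = - b z (u y)"
proof -
  have b: "bil b" and a: "\<And>y. y \<in> fixs e \<Longrightarrow> b y (u y) = 0" using assms by (auto simp: alt_def)
  have "dsub (fixs e)" using dsub_fixs assms(3) by (auto simp: idem_def)
  then have "b (y + z) (u (y + z)) = 0" using a dsub_add assms by blast
  moreover have "u (y + z) = u y + u z" using End_add EsubD(1) assms by blast
  ultimately have "b y (u z) + b z (u y) = 0"
    using a[OF assms(5)] a[OF assms(6)] by (simp add: bil_add[OF b] add.commute)
  then show ?thesis by (simp add: eq_neg_iff_add_eq_0)
qed

text \<open>The right radical of \<open>b\<close> on \<open>fixs e\<close> is in general only an
  F-subspace; this is its largest D-subspace.\<close>

definition rad :: "('v \<Rightarrow> 'v) \<Rightarrow> ('v \<Rightarrow> 'v \<Rightarrow> 'f) \<Rightarrow> 'v set" where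
  "rad e b = {p\<in>fixs e. \<forall>y\<in>fixs e. \<forall>a. b y (p \<cdot> a) = 0}"

lemma dsub_rad:
  assumes "idem e" "bil b" shows "dsub (rad e b)"
proof -
  have fe: "dsub (fixs e)" using dsub_fixs assms(1) by (auto simp: idem_def)
  show ?thesis
    using fe bil_add(2)[OF assms(2)] bil_0(2)[OF assms(2)]
    unfolding right_subspace_def rad_def by (auto simp: smult_add_left smult_assoc)
qed

text \<open>Take \<open>x\<close> such that \<open>b x\<close> is nonzero on \<open>P\<close>.
  Modulo the radical the values \<open>u x\<close> fill at most a hyperplane of \<open>P\<close>,
  which accounts for \<open>Suc m * d - 1\<close>. If \<open>u x\<close> lies in the radical,
  \<open>alt_polar\<close> forces all values of \<open>u\<close> into \<open>Dker (b x) P\<close>,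
  whose D-dimension is smaller by one.\<close>

lemma alt_chain:
  assumes e: "idem e" and S: "Esub S" "S \<subseteq> corner e" "alt e b S"
    and P: "dsub P" "rad e b \<subseteq> P" "P \<subseteq> fixs e" "dimV P = dimV (rad e b) + m * d"
    and T: "Esub T" "T \<subseteq> S" "\<forall>u\<in>T. \<forall>y. u y \<in> P"
  shows "dimE T \<le> dimE {u\<in>T. \<forall>y. u y \<in> rad e b} + g m"
  using P T
proof (induction m arbitrary: P T)
  case 0
  have b: "bil b" using S(3) by (simp add: alt_def)
  have "rad e b = P"
    using V.subspace_dim_equal[OF dsub_subspace[OF dsub_rad[OF e b]] dsub_subspace[OF 0(1)] 0(2)] 0(4) by simp
  then have "{u\<in>T. \<forall>y. u y \<in> rad e b} = T" using 0(7) by blast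
  then show ?case by simp
next
  case (Suc m)
  let ?R = "rad e b"
  have b: "bil b" using S(3) by (simp add: alt_def)
  have fe: "dsub (fixs e)" using dsub_fixs e by (auto simp: idem_def)
  have R: "dsub ?R" "?R \<subseteq> fixs e" using dsub_rad[OF e b] by (auto simp: rad_def)
  have "P \<noteq> ?R" using Suc.prems(4) d_pos by auto
  then obtain p where "p \<in> P" "p \<notin> ?R" using Suc.prems(2) by blast
  then obtain x a where x: "x \<in> fixs e" "b x (p \<cdot> a) \<noteq> 0" using Suc.prems(3) by (auto simp: rad_def)
  have pa: "p \<cdot> a \<in> P" using \<open>p \<in> P\<close> dsub_smult[OF Suc.prems(1)] by blast
  have lx: "lf (b x)" using bilD(1)[OF b] .
  let ?P = "Dker (b x) P"
  have dP: "dimV P = dimV ?P + d" using Dker_dim(1)[OF lx Suc.prems(1) pa x(2)] .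
  have RP: "?R \<subseteq> ?P" using Suc.prems(2) x(1) unfolding Dker_def rad_def by blast
  obtain r where r: "idem r" "r \<in> corner e" "fixs r = ?R" using sub_idem[OF e R] by blast
  define q where "q = e - r"
  note q = q_def idem_split[OF e r(1,2) q_def]
  have qE: "q \<in> End'" using q(2) by (simp add: idem_def)
  have q0: "q z = 0 \<longleftrightarrow> z \<in> ?R" if "z \<in> fixs e" for z
  proof
    assume "q z = 0"
    then have "z = r z" using q(6)[of z] fixsD[OF that] by simp
    then show "z \<in> ?R" using idem_fixs[OF r(1), of z] r(3) by simp
  next
    assume "z \<in> ?R" then show "q z = 0" using q(9)[of z] r(3) by simp
  qed
  have Tc: "u \<in> corner e" if "u \<in> T" for u using that Suc.prems(6) S(2) by blast
  let ?T = "{u\<in>T. u x \<in> ?R}"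
  have ET: "Esub ?T" by (rule Esub_into(1)[OF Suc.prems(5) R(1)])
  have "dimE ?T \<le> dimE {u\<in>?T. \<forall>y. u y \<in> ?R} + g m"
  proof (rule Suc.IH[of ?P ?T])
    show "dsub ?P" using dsub_Dker[OF lx Suc.prems(1)] .
    show "?R \<subseteq> ?P" by (rule RP)
    show "?P \<subseteq> fixs e" using Suc.prems(3) by (auto simp: Dker_def)
    show "dimV ?P = dimV ?R + m * d" using Suc.prems(4) dP by simp
    show "Esub ?T" by (rule ET)
    show "?T \<subseteq> S" using Suc.prems(6) by blast
    show "\<forall>u\<in>?T. \<forall>y. u y \<in> ?P"
    proof (intro ballI allI)
      fix u y assume u: "u \<in> ?T"
      have uc: "u \<in> corner e" using Tc u by blast
      have "b x (u y \<cdot> c) = 0" for c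
      proof -
        have "u y \<cdot> c = u (e (y \<cdot> c))" using cornerD(3)[OF uc] End_smult[OF cornerD(1)[OF uc]] by simp
        moreover have "b x (u (e (y \<cdot> c))) = - b (e (y \<cdot> c)) (u x)"
          using alt_polar[OF S(3,1) e _ x(1) idem_fixs[OF e]] u Suc.prems(6) by blast
        moreover have "b (e (y \<cdot> c)) (u x \<cdot> 1) = 0" using u idem_fixs[OF e] unfolding rad_def by blast
        ultimately show ?thesis by (simp add: smult_one)
      qed
      then show "u y \<in> ?P" using Suc.prems(7) u by (simp add: Dker_def)
    qed
  qed
  moreover have "{u\<in>?T. \<forall>y. u y \<in> ?R} = {u\<in>T. \<forall>y. u y \<in> ?R}" by blast
  moreover have "dimE T \<le> dimE ?T + (Suc m * d - 1)"
  proof -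
    let ?f = "\<lambda>u. q (u x)"
    have l: "Vector_Spaces.linear (scaleE \<iota> smult) (scaleV \<iota> smult) ?f"
      unfolding Vector_Spaces.linear_iff
      using End_add[OF qE] End_scF[OF qE] by (auto simp: E.vector_space_axioms V.vector_space_axioms scaleE_def)
    have k: "{u\<in>T. ?f u = 0} = ?T" using q0 cornerD(4)[OF Tc] by blast
    have "dimE T = dimV (?f ` T) + dimE ?T"
      using EV.rank_nullity(2)[OF l EsubD(2)[OF Suc.prems(5)] fin_dim_V] fin_dim_E[of ?T] EsubD(1)[OF ET]
      unfolding k by blast
    moreover have "dimV (?f ` T) \<le> Suc m * d - 1"
    proof -
      let ?A = "{z\<in>P. b x z = 0}"
      have A: "V.subspace ?A" using lf_kernel_subspace[OF lx dsub_subspace[OF Suc.prems(1)]] .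
      have "?f ` T \<subseteq> q ` ?A"
      proof clarify
        fix u assume u: "u \<in> T"
        have "b x (u x) = 0" using S(3) u Suc.prems(6) x(1) unfolding alt_def by blast
        then show "q (u x) \<in> q ` ?A" using Suc.prems(7) u by blast
      qed
      then have "dimV (?f ` T) \<le> dimV (q ` ?A)" by (rule V.dim_subset)
      moreover have "dimV ?A + 1 = dimV P"
        using lf_kernel_dim[OF lx dsub_subspace[OF Suc.prems(1)] pa x(2)] by simp
      moreover have "dimV ?A = dimV (q ` ?A) + dimV ?R"
      proof -
        have ql: "Vector_Spaces.linear (scaleV \<iota> smult) (scaleV \<iota> smult) q"
          unfolding Vector_Spaces.linear_iff
          using End_add[OF qE] End_scF[OF qE] by (auto simp: V.vector_space_axioms)
        have "b x z = 0" if "z \<in> ?R" for z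
        proof -
          have "b x (z \<cdot> 1) = 0" using that x(1) unfolding rad_def by blast
          then show ?thesis by (simp add: smult_one)
        qed
        then have "{z\<in>?A. q z = 0} = ?R" using q0 Suc.prems(2,3) by blast
        then show ?thesis using VV.rank_nullity(2)[OF ql A fin_dim_V fin_dim_V] by simp
      qed
      ultimately show ?thesis using Suc.prems(4) by simp
    qed
    ultimately show ?thesis by simp
  qed
  ultimately show ?case by simp
qed

text \<open>\<open>alt_chain\<close> bounds the dimension of \<open>S\<close> tightly, so there is no room for an isotropic vector, at
  which the first step of the chain would lose one dimension.\<close>

theorem alt_nonisotropic:
  assumes e: "idem e" "dimV (fixs e) = k * d" and S: "Esub S" "S \<subseteq> corner e" "TS S" "dimE S = g k"
    and big: "big (k * d)" and irr: "irr e S" and alt: "alt e b S"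
    and nz: "x0 \<in> fixs e" "y0 \<in> fixs e" "b x0 y0 \<noteq> 0" and z: "z \<in> fixs e" "z \<noteq> 0"
  shows "b z z \<noteq> 0" "dimV (orb S z) + 1 = k * d"
proof -
  let ?R = "rad e b" and ?E = "fixs e"
  have b: "bil b" using alt by (simp add: alt_def)
  have fe: "dsub ?E" using dsub_fixs e by (auto simp: idem_def)
  have R: "dsub ?R" "?R \<subseteq> ?E" using dsub_rad[OF e(1) b] by (auto simp: rad_def)
  have RE: "?R \<noteq> ?E"
  proof
    assume "?R = ?E"
    then have "b x0 (y0 \<cdot> 1) = 0" using nz(1,2) unfolding rad_def by blast
    then show False using nz(3) by (simp add: smult_one)
  qed
  have Sc: "u \<in> corner e" if "u \<in> S" for u using that S(2) by blast
  have SE: "u y \<in> ?E" if "u \<in> S" for u y using cornerD(4)[OF Sc[OF that]] .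
  have orbE: "orb S y \<subseteq> ?E" for y using SE by blast
  have Simg: "u y \<in> W" if "u \<in> S" "\<And>y. y \<in> ?E \<Longrightarrow> u y \<in> W" for u y W
    using that(2)[OF idem_fixs[OF e(1), of y]] cornerD(3)[OF Sc[OF that(1)]] by simp
  have k0: "0 < k" 
  proof (rule ccontr)
    assume "\<not> 0 < k"
    then have "?E \<subseteq> {0}" using e(2) V.dim_eq_0 by simp
    then show False using z by auto
  qed
  then have gk: "g k = g (k - 1) + (k * d - 1)" by (cases k) auto
  have kd: "1 \<le> k * d" using k0 d_pos by (simp add: Suc_leI)
  have chain: "dimE T \<le> dimE {u\<in>T. \<forall>y. u y \<in> ?R} + g m"
    if "dsub P" "?R \<subseteq> P" "P \<subseteq> ?E" "dimV P = dimV ?R + m * d" "Esub T" "T \<subseteq> S" "\<forall>u\<in>T. \<forall>y. u y \<in> P" for P m T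
    using alt_chain[OF e(1) S(1,2) alt that] .
  \<comment> \<open>The chain bounds \<open>S\<close> modulo the operators with values in the
    radical, and \<open>restrict_bound\<close> bounds these. Equality puts \<open>Hm e ?R\<close>
    into \<open>S\<close>, so the radical is invariant.\<close>
  have R0: "?R = {0}"
  proof -
    obtain j where j: "dimV ?R = j * d" using dsub_dim_multiple[OF R(1)] .
    obtain m where m: "dimV ?E = dimV ?R + m * d" using dim_multiple[OF R(1) fe R(2)] by blast
    have "k * d = (j + m) * d" using m j e by (simp add: algebra_simps)
    then have k: "k = j + m" using d_pos by (metis mult_right_cancel less_not_refl)
    have "j * d \<le> k * d" using k by simp
    then have bj: "big (j * d)" using big le_trans by blast
    have 1: "dimE S \<le> dimE {u\<in>S. \<forall>y. u y \<in> ?R} + g m"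
      using chain[OF fe R(2) subset_refl m S(1) subset_refl] SE by blast
    let ?T = "{u\<in>S. \<forall>y. u y \<in> ?R}"
    have T: "Esub ?T" by (rule Esub_into(2)[OF S(1) R(1)])
    have "dimE ?T \<le> g j + dimE {u\<in>?T. \<forall>y\<in>?R. u y = 0}"
    proof (rule restrict_bound[OF e(1) T _ _ R j bj])
      show "?T \<subseteq> corner e" using S(2) by blast
      show "TS ?T" using S(3) by (auto simp: TS_def)
    qed auto
    moreover have "{u\<in>?T. \<forall>y\<in>?R. u y = 0} = S \<inter> Hm e ?R" using S(2) by (auto simp: Hm_def)
    ultimately have "g (j + m) \<le> g j + g m + dimE (S \<inter> Hm e ?R)" using 1 S(4) k by simp
    moreover have "dimV ?E = (j + m) * d" using e(2) k by simp
    ultimately have "Hm e ?R \<subseteq> S" using hom_sub[OF e(1) _ S(1) R j] by blast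
    then have "\<forall>u\<in>S. \<forall>x\<in>?R. u x \<in> ?R" using hom_sub_invariant[OF e(1) S(1,2,3) R] by blast
    then show ?thesis using irr R RE unfolding irr_def by blast
  qed
  then have dR: "dimV ?R = 0" using V.dim_eq_0 by simp
  have R0D: "p = 0" if "p \<in> ?E" "\<And>y a. y \<in> ?E \<Longrightarrow> b y (p \<cdot> a) = 0" for p
    using that R0 unfolding rad_def by blast
  have TR: "dimE {u\<in>T. \<forall>y. u y \<in> ?R} = 0" if "Esub T" for T
  proof -
    have "{u\<in>T. \<forall>y. u y \<in> ?R} = {\<lambda>x. 0}" using Esub_0[OF that] unfolding R0 by auto
    then show ?thesis using zero_dim_E by simp
  qed
  \<comment> \<open>The chain started at \<open>Dker (b y) ?E\<close> bounds the stabiliser of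
    \<open>y\<close> by \<open>g (k - 1)\<close>. So \<open>S y\<close> is the whole kernel of
    \<open>b y\<close> in \<open>?E\<close>, and \<open>y\<close> is not in
    \<open>S y\<close>.\<close>
  have nz1: "b y y \<noteq> 0 \<and> dimV (orb S y) + 1 = k * d" if y: "y \<in> ?E" "\<exists>w\<in>?E. b y w \<noteq> 0" for y
  proof -
    obtain w where w: "w \<in> ?E" "b y w \<noteq> 0" using y by blast
    have ly: "lf (b y)" using bilD(1)[OF b] .
    have y0: "y \<noteq> 0" using w bil_0(1)[OF b] by auto
    let ?A = "{p\<in>?E. b y p = 0}" and ?P = "Dker (b y) ?E"
    have dA: "dimV ?A + 1 = k * d" using lf_kernel_dim[OF ly dsub_subspace[OF fe] w] e(2) by simp
    have A: "V.subspace ?A" using lf_kernel_subspace[OF ly dsub_subspace[OF fe]] .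
    have oA: "orb S y \<subseteq> ?A" using SE alt y(1) unfolding alt_def by blast
    let ?T = "{u\<in>S. u y = 0}"
    have dP: "dimV ?P + d = k * d" using Dker_dim(1)[OF ly fe w] e(2) by simp
    have "dimE ?T \<le> dimE {u\<in>?T. \<forall>y. u y \<in> ?R} + g (k - 1)"
    proof (rule chain[of ?P])
      show "dsub ?P" using dsub_Dker[OF ly fe] .
      show "?R \<subseteq> ?P" unfolding R0 using dsub_0[OF \<open>dsub ?P\<close>] by blast
      show "?P \<subseteq> ?E" by (auto simp: Dker_def)
      have "k * d = (k - 1) * d + d" using k0 by (cases k) auto
      then show "dimV ?P = dimV ?R + (k - 1) * d" using dP dR by simp
      show "Esub ?T" using Esub_ev_kernel[OF S(1)] .
      show "?T \<subseteq> S" by blast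
      show "\<forall>u\<in>?T. \<forall>v. u v \<in> ?P"
      proof (intro ballI allI)
        fix u v assume u: "u \<in> ?T"
        have uc: "u \<in> corner e" using Sc u by blast
        have "b y (u v \<cdot> c) = 0" for c
        proof -
          have "u v \<cdot> c = u (e (v \<cdot> c))" using cornerD(3)[OF uc] End_smult[OF cornerD(1)[OF uc]] by simp
          moreover have "b y (u (e (v \<cdot> c))) = - b (e (v \<cdot> c)) (u y)"
            using alt_polar[OF alt S(1) e(1) _ y(1) idem_fixs[OF e(1)]] u by blast
          ultimately show ?thesis using u bil_0(2)[OF b] by simp
        qed
        then show "u v \<in> ?P" using SE u by (simp add: Dker_def)
      qed
    qed
    then have "dimE ?T \<le> g (k - 1)" using TR[OF Esub_ev_kernel[OF S(1)]] by simp
    then have "k * d - 1 \<le> dimV (orb S y)" using dim_orb[OF S(1), of y] S(4) gk by simp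
    then have ge: "dimV ?A \<le> dimV (orb S y)" using dA by simp
    then have "orb S y = ?A" using V.subspace_dim_equal[OF orb_subspace[OF S(1)] A oA] by blast
    moreover have "y \<notin> orb S y" using TSD[OF S(3)] y0 by force
    ultimately show ?thesis using y(1) dA by auto
  qed
  \<comment> \<open>It remains to keep \<open>z\<close> out of the left radical. As the left radical
    need not be a D-subspace, the D-multiples of \<open>z\<close> are examined first.\<close>
  have "\<exists>w\<in>?E. b z w \<noteq> 0"
  proof (rule ccontr)
    assume "\<not> ?thesis"
    then have bz: "b z w = 0" if "w \<in> ?E" for w using that by blast
    have lz: "line z \<subseteq> ?E" using line_least[OF fe z(1)] .
    have "\<exists>a. \<exists>w\<in>?E. b (z \<cdot> a) w \<noteq> 0"
    proof (rule ccontr)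
      assume "\<not> ?thesis"
      then have za: "b (z \<cdot> a) w = 0" if "w \<in> ?E" for w a using that by blast
      have uz: "u z = 0" if u: "u \<in> S" for u
      proof (rule R0D[OF SE[OF u]])
        fix y a assume y: "y \<in> ?E"
        have "u z \<cdot> a = u (z \<cdot> a)" using End_smult[OF EsubD(1)[OF S(1) u]] by simp
        moreover have "b y (u (z \<cdot> a)) = - b (z \<cdot> a) (u y)"
          using alt_polar[OF alt S(1) e(1) u y dsub_smult[OF fe z(1)]] .
        ultimately show "b y (u z \<cdot> a) = 0" using za[OF SE[OF u]] by simp
      qed
      have "\<forall>u\<in>S. \<forall>x\<in>line z. u x \<in> line z"
      proof (intro ballI)
        fix u x assume u: "u \<in> S" "x \<in> line z"
        then have "u x = 0" using uz[OF u(1)] by (auto simp: line_def End_smult[OF EsubD(1)[OF S(1) u(1)]])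
        then show "u x \<in> line z" using dsub_0[OF dsub_line] by simp
      qed
      then have "line z = {0} \<or> line z = ?E" using irr lz dsub_line unfolding irr_def by blast
      then have "line z = ?E" using line_self z(2) by blast
      then obtain a where "x0 = z \<cdot> a" using nz(1) by (auto simp: line_def)
      then show False using za nz by blast
    qed
    then obtain a w where a: "w \<in> ?E" "b (z \<cdot> a) w \<noteq> 0" by blast
    have a0: "a \<noteq> 0" using a bil_0(1)[OF b] by auto
    have zaE: "z \<cdot> a \<in> ?E" using dsub_smult[OF fe z(1)] .
    have dza: "dimV (orb S (z \<cdot> a)) + 1 = k * d" using nz1[OF zaE] a by blast
    have dz: "dimV (orb S z) + 1 = k * d"
    proof -
      have "orb S (z \<cdot> a) = (\<lambda>x. x \<cdot> a) ` orb S z"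
        using EsubD(1)[OF S(1)] by (auto simp: End_smult image_image)
      moreover have "Vector_Spaces.linear (scaleV \<iota> smult) (scaleV \<iota> smult) (\<lambda>x. x \<cdot> a)"
        unfolding Vector_Spaces.linear_iff by (auto simp: V.vector_space_axioms smult_add_left scF_smult)
      then have "dimV ((\<lambda>x. x \<cdot> a) ` orb S z) \<le> dimV (orb S z)" by (rule VV.dim_image_le)
      moreover have "dimV (orb S z) < k * d"
      proof -
        have "z \<notin> orb S z" using TSD[OF S(3)] z(2) by force
        then have "orb S z \<noteq> ?E" using z(1) by blast
        then have "\<not> dimV ?E \<le> dimV (orb S z)"
          using V.subspace_dim_equal[OF orb_subspace[OF S(1)] dsub_subspace[OF fe] orbE] by blast
        then show ?thesis using e(2) by simp
      qed
      ultimately show ?thesis using dza by simp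
    qed
    \<comment> \<open>The right radical contains \<open>S z\<close>, so its codimension is at most
      one and it is the kernel of every nonzero \<open>b y\<close>. Hence all of \<open>S\<close>
      maps into it, and closing under D makes \<open>S\<close> vanish on \<open>?E\<close> by
      \<open>R0D\<close>.\<close>
    let ?Q = "{p\<in>?E. \<forall>y\<in>?E. b y p = 0}"
    have Q: "V.subspace ?Q"
      using V.subspace_0[OF dsub_subspace[OF fe]] V.subspace_add[OF dsub_subspace[OF fe]]
        V.subspace_scale[OF dsub_subspace[OF fe]] bil_0(2)[OF b] bil_add(2)[OF b] bil_scF(2)[OF b]
      unfolding V.subspace_def by auto
    have "orb S z \<subseteq> ?Q"
    proof clarify
      fix u assume u: "u \<in> S"
      have "b y (u z) = 0" if "y \<in> ?E" for y
        using alt_polar[OF alt S(1) e(1) u that z(1)] bz[OF SE[OF u]] by simp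
      then show "u z \<in> ?E \<and> (\<forall>y\<in>?E. b y (u z) = 0)" using SE[OF u] by blast
    qed
    from V.dim_subset[OF this] have dQ: "k * d \<le> dimV ?Q + 1" using dz by linarith
    have sub: "u y \<in> ?Q" if h: "u \<in> S" "y \<in> ?E" "\<exists>w\<in>?E. b y w \<noteq> 0" for u y
    proof -
      obtain w where w: "w \<in> ?E" "b y w \<noteq> 0" using h(3) by blast
      let ?A = "{p\<in>?E. b y p = 0}"
      have ly: "lf (b y)" using bilD(1)[OF b] .
      have "?Q \<subseteq> ?A" using h(2) by blast
      moreover have "dimV ?A \<le> dimV ?Q"
        using dQ lf_kernel_dim[OF ly dsub_subspace[OF fe] w] e(2) by simp
      ultimately have "?Q = ?A"
        using V.subspace_dim_equal[OF Q lf_kernel_subspace[OF ly dsub_subspace[OF fe]]] by blast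
      moreover have "u y \<in> ?A" using h SE alt unfolding alt_def by blast
      ultimately show ?thesis by blast
    qed
    have all: "u y \<in> ?Q" if u: "u \<in> S" and y: "y \<in> ?E" for u y
    proof (cases "\<exists>w\<in>?E. b y w \<noteq> 0")
      case False
      have "b (y + x0) y0 \<noteq> 0" using False nz by (simp add: bil_add(1)[OF b])
      then have "u (y + x0) \<in> ?Q" using sub[OF u dsub_add[OF fe y nz(1)]] nz(2) by blast
      moreover have "u x0 \<in> ?Q" using sub[OF u nz(1)] nz(2,3) by blast
      ultimately have "u (y + x0) - u x0 \<in> ?Q" using V.subspace_diff[OF Q] by blast
      then show ?thesis by (simp add: End_add[OF EsubD(1)[OF S(1) u]])
    qed (use sub u y in blast)
    have S0: "u y = 0" if u: "u \<in> S" and y: "y \<in> ?E" for u y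
    proof (rule R0D[OF SE[OF u]])
      fix v a assume v: "v \<in> ?E"
      have "u (y \<cdot> a) \<in> ?Q" using all[OF u dsub_smult[OF fe y]] .
      then show "b v (u y \<cdot> a) = 0" using v End_smult[OF EsubD(1)[OF S(1) u]] by simp
    qed
    \<comment> \<open>Once \<open>S\<close> vanishes, \<open>?E\<close> is a line by irreducibility
      and \<open>dz\<close> gives \<open>k * d = 1\<close>. Then \<open>z \<cdot> a\<close> is an
      F-multiple of \<open>z\<close>, against the choice of \<open>a\<close>.\<close>
    have "\<forall>u\<in>S. \<forall>x\<in>line z. u x \<in> line z" using S0 lz dsub_0[OF dsub_line] by (metis subsetD)
    then have "line z = {0} \<or> line z = ?E" using irr lz dsub_line unfolding irr_def by blast
    then have "line z = ?E" using line_self z(2) by blast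
    then have "dimV ?E = d" using dim_line[OF z(2)] by simp
    moreover have "orb S z \<subseteq> {0}" using S0[OF _ z(1)] by blast
    then have "dimV (orb S z) = 0" using V.dim_eq_0 by blast
    ultimately have "dimV ?E = 1" using dz e(2) by simp
    then obtain c where "z \<cdot> a = c *f z"
      using V.dim_le_1I[OF dsub_subspace[OF fe] _ fin_dim_V z zaE] by auto
    then show False using a(2) bz[OF a(1)] bil_scF(1)[OF b] by simp
  qed
  then show "b z z \<noteq> 0" "dimV (orb S z) + 1 = k * d" using nz1[OF z(1)] by blast+
qed

end

section \<open>Generic vectors\<close>

context div_space begin

text \<open>Optimality inside the corner of \<open>e\<close>: by \<open>ts_bound\<close> and
  \<open>ts_exists\<close>, \<open>g k\<close> is the greatest possible dimension.\<close>

definition tight :: "('v \<Rightarrow> 'v) \<Rightarrow> nat \<Rightarrow> ('v \<Rightarrow> 'v) set \<Rightarrow> bool" where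
  "tight e k S \<longleftrightarrow> idem e \<and> dimV (fixs e) = k * d \<and> Esub S \<and> S \<subseteq> corner e \<and> TS S
     \<and> dimE S = g k \<and> big (k * d)"

lemma tightD:
  assumes "tight e k S"
  shows "idem e" "dimV (fixs e) = k * d" "Esub S" "S \<subseteq> corner e" "TS S" "dimE S = g k" "big (k * d)"
    "dsub (fixs e)" "\<And>u. u \<in> S \<Longrightarrow> u \<in> corner e" "e \<in> End'" "\<And>u x. u \<in> S \<Longrightarrow> u x \<in> fixs e"
    "\<And>x. e x \<in> fixs e"
  using assms dsub_fixs idem_fixs cornerD(4) unfolding tight_def idem_def by blast+

lemma orb_corner: "S \<subseteq> corner e \<Longrightarrow> orb S (e y) = orb S y"
  by (intro image_cong) (auto simp: corner_def)

lemma orb_bound: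
  assumes t: "tight e (Suc m) S" shows "dimV (orb S y) + 1 \<le> Suc m * d"
proof -
  note t = tightD[OF t]
  show ?thesis
  proof (cases "e y = 0")
    case True
    then show ?thesis using dim_orb_0[OF t(3)] orb_corner[OF t(4), of y] True d_pos by simp
  next
    case False
    have "e y \<notin> orb S (e y)" using TSD[OF t(5)] False by force
    then have "orb S y \<noteq> fixs e" using orb_corner[OF t(4), of y] t(12) by blast
    moreover have "orb S y \<subseteq> fixs e" using t(11) by blast
    ultimately have "\<not> dimV (fixs e) \<le> dimV (orb S y)"
      using V.subspace_dim_equal[OF orb_subspace[OF t(3)] dsub_subspace[OF t(8)]] by blast
    then show ?thesis using t(2) by simp
  qed
qed

lemma stabilizer_bound:
  assumes t: "tight e (Suc m) S" and x: "x \<in> fixs e" "x \<noteq> 0"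
  shows "dimE {u\<in>S. u x = 0} \<le> g m + dimE (S \<inter> Hm e (line x))"
proof -
  note t = tightD[OF t]
  let ?T = "{u\<in>S. u x = 0}"
  have "dimE ?T \<le> g m + dimE (?T \<inter> Hm e (line x))"
  proof (rule quotient_bound[OF t(1) Esub_ev_kernel[OF t(3)]])
    show "?T \<subseteq> corner e" using t(4) by blast
    show "TS ?T" using t(5) by (auto simp: TS_def)
    show "dsub (line x)" by (rule dsub_line)
    show "line x \<subseteq> fixs e" using line_least[OF t(8) x(1)] .
    show "dimV (fixs e) = dimV (line x) + m * d" using t(2) dim_line[OF x(2)] by simp
    show "big (m * d)" using t(7) by auto
    show "\<forall>u\<in>?T. \<forall>y\<in>line x. u y = 0"
      using EsubD(1)[OF t(3)] by (auto simp: line_def End_smult)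
  qed
  moreover have "?T \<inter> Hm e (line x) = S \<inter> Hm e (line x)" using line_self by (auto simp: Hm_def)
  ultimately show ?thesis by simp
qed

text \<open>An orbit that is too small leaves a stabiliser of dimension greater than
  \<open>g m\<close>, more than its compression to a complement of the line can hold.\<close>

lemma line_hom_nonzero:
  assumes t: "tight e (Suc m) S" and x: "x \<in> fixs e" "x \<noteq> 0" and l: "dimV (orb S x) + 1 \<noteq> Suc m * d"
  obtains u where "u \<in> S" "u x = 0" "\<And>y. u y \<in> line x" "u \<noteq> (\<lambda>y. 0)"
proof -
  have "dimV (orb S x) + 1 < Suc m * d" using orb_bound[OF t, of x] l by simp
  moreover have "dimE S = g m + (Suc m * d - 1)" using tightD(6)[OF t] by simp
  ultimately have "g m < dimE {u\<in>S. u x = 0}" using dim_orb[OF tightD(3)[OF t], of x] by linarith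
  then have "dimE (S \<inter> Hm e (line x)) \<noteq> 0" using stabilizer_bound[OF t x] by linarith
  then have "S \<inter> Hm e (line x) \<noteq> {\<lambda>y. 0}" using zero_dim_E by auto
  moreover have "(\<lambda>y. 0) \<in> S \<inter> Hm e (line x)"
    using Esub_0[OF Esub_Int[OF tightD(3)[OF t] Esub_Hm[OF tightD(1)[OF t] dsub_line]]] .
  ultimately obtain u where "u \<in> S \<inter> Hm e (line x)" "u \<noteq> (\<lambda>y. 0)" by blast
  then show ?thesis using that[of u] line_self[of x] unfolding Hm_def by blast
qed

text \<open>A vector with the largest orbit works. Otherwise \<open>line_hom_nonzero\<close> gives a
  nonzero operator that kills \<open>x\<close> and has values in its line, and
  \<open>generic_kernel\<close> puts \<open>x\<close> into \<open>S x\<close>.\<close>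

lemma generic_exists:
  assumes t: "tight e (Suc m) S"
  obtains x where "x \<in> fixs e" "x \<noteq> 0" "dimV (orb S x) + 1 = Suc m * d"
proof -
  note tD = tightD[OF t]
  have "\<not> fixs e \<subseteq> {0}" using tD(2) d_pos V.dim_eq_0[of "fixs e"] by fastforce
  then obtain x0 where "x0 \<in> fixs e \<and> x0 \<noteq> 0" by blast
  moreover have "\<And>y. dimV (orb S y) < Suc m * d" using orb_bound[OF t] by (simp add: Suc_le_eq)
  ultimately obtain x where x: "x \<in> fixs e" "x \<noteq> 0"
    and xm: "\<And>y. y \<in> fixs e \<and> y \<noteq> 0 \<Longrightarrow> dimV (orb S y) \<le> dimV (orb S x)"
    using ex_has_greatest_nat[of "\<lambda>y. y \<in> fixs e \<and> y \<noteq> 0" x0 "\<lambda>y. dimV (orb S y)" "Suc m * d"] by metis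
  have max: "dimV (orb S y) \<le> dimV (orb S x)" for y
  proof (cases "e y = 0")
    case True
    then show ?thesis using dim_orb_0[OF tD(3)] orb_corner[OF tD(4), of y] True by simp
  next
    case False
    then show ?thesis using xm[of "e y"] tD(12) orb_corner[OF tD(4), of y] by simp
  qed
  have big: "big (dimV (orb S x) + 1)" using tD(7) orb_bound[OF t, of x] le_trans by blast
  have xo: "x \<notin> orb S x" using TSD[OF tD(5)] x by force
  have "dimV (orb S x) + 1 = Suc m * d"
  proof (rule ccontr)
    assume "\<not> ?thesis"
    from line_hom_nonzero[OF t x this]
    obtain u where u: "u \<in> S" "u x = 0" "\<And>y. u y \<in> line x" "u \<noteq> (\<lambda>y. 0)" by metis
    obtain y where y: "u y \<noteq> 0" using u(4) by (auto simp: fun_eq_iff)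
    obtain a where a: "u y = x \<cdot> a" using u(3)[of y] by (auto simp: line_def)
    then have "a \<noteq> 0" using y by auto
    then have "u (y \<cdot> inverse a) = x"
      using a EsubD(1)[OF tD(3) u(1)] by (simp add: End_smult smult_assoc smult_one)
    then show False using generic_kernel[OF tD(3) max big u(1,2), of "y \<cdot> inverse a"] xo by simp
  qed
  then show ?thesis using that x by blast
qed

end

text \<open>\<open>w\<close> is a linear section of the evaluation at the generic vector \<open>x\<close>.\<close>

locale generic_vector = div_space +
  fixes e :: "'c \<Rightarrow> 'c" and m :: nat and S :: "('c \<Rightarrow> 'c) set" and x :: 'c and \<phi> :: "'c \<Rightarrow> 'a"
    and \<xi> :: "'c \<Rightarrow> 'b" and w :: "'c \<Rightarrow> 'c \<Rightarrow> 'c"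
  assumes t: "tight e (Suc m) S" and xE: "x \<in> fixs e" and dx: "dimV (orb S x) + 1 = Suc m * d"
    and lphi: "lf \<phi>" and phi_x: "\<phi> x = 1" and phi_S: "\<And>u. u \<in> S \<Longrightarrow> \<phi> (u x) = 0"
    and dxi: "dlin \<xi>" and xi_x: "\<xi> x = 1" and xi_e: "\<And>v. \<xi> (e v) = \<xi> v"
    and xi_H: "\<And>v. v \<in> Dker \<phi> (fixs e) \<Longrightarrow> \<xi> v = 0"
    and rank1: "\<And>p. p \<in> fixs e \<Longrightarrow> (\<lambda>v. p \<cdot> \<xi> v) \<in> corner e"
    and w_add: "\<And>s t. w (s + t) = w s + w t" and w_scale: "\<And>c s. w (c *f s) = scaleE \<iota> smult c (w s)"
    and wS: "\<And>s. w s \<in> S" and w_x: "\<And>u. u \<in> S \<Longrightarrow> w (u x) x = u x"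
begin

abbreviation "H \<equiv> Dker \<phi> (fixs e)"
abbreviation "T \<equiv> {u\<in>S. u x = 0}"

text \<open>The projection of \<open>fixs e\<close> onto \<open>H\<close> along the line of
  \<open>x\<close>.\<close>

definition h :: "'c \<Rightarrow> 'c" where "h v = e v - x \<cdot> \<xi> v"

text \<open>The section \<open>w\<close> makes the form total and bilinear. For \<open>s\<close> in
  \<open>S x\<close> the value does not depend on \<open>w\<close> (\<open>phi_b0\<close>):
  operators that agree at \<open>x\<close> differ by an element of \<open>T\<close>, and
  \<open>\<phi>\<close> vanishes on the values of \<open>T\<close>.\<close>

definition b0 :: "'c \<Rightarrow> 'c \<Rightarrow> 'a" where "b0 y s = - \<phi> (w s y)"

lemmas tD = tightD[OF t]

section \<open>The complement and the stabiliser of a generic vector\<close>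

lemma x0: "x \<noteq> 0" using phi_x lf_0[OF lphi] by auto

lemma max: "dimV (orb S y) \<le> dimV (orb S x)"
  using orb_bound[OF t, of y] dx by simp

lemma bigx: "big (dimV (orb S x) + 1)"
  using tD(7) dx by simp

lemma orbE: "orb S y \<subseteq> fixs e"
  using tD(11) by blast

lemma phi_iff: assumes "y \<in> fixs e" shows "\<phi> y = 0 \<longleftrightarrow> y \<in> orb S x"
proof -
  let ?A = "{y\<in>fixs e. \<phi> y = 0}"
  have sub: "orb S x \<subseteq> ?A" using orbE phi_S by blast
  have "dimV (fixs e) = dimV ?A + 1"
    using lf_kernel_dim[OF lphi dsub_subspace[OF tD(8)] xE] phi_x by simp
  then have "dimV ?A \<le> dimV (orb S x)" using tD(2) dx by simp
  then have "orb S x = ?A"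
    using V.subspace_dim_equal[OF orb_subspace[OF tD(3)] lf_kernel_subspace[OF lphi dsub_subspace[OF tD(8)]] sub]
    by blast
  then show ?thesis using assms by blast
qed

lemma H: "dsub H" "H \<subseteq> fixs e" "dimV H = m * d" "x \<notin> H" "dsum H (line x) = fixs e" "H \<subseteq> orb S x"
proof -
  have "\<phi> x \<noteq> 0" using phi_x by simp
  note D = Dker_dim[OF lphi tD(8) xE this]
  show "dsub H" using dsub_Dker[OF lphi tD(8)] .
  show 1: "H \<subseteq> fixs e" by (auto simp: Dker_def)
  show "dimV H = m * d" using D(1) tD(2) by simp
  show "x \<notin> H" "dsum H (line x) = fixs e" by fact+
  show "H \<subseteq> orb S x"
  proof
    fix y assume y: "y \<in> H"
    then have "\<phi> (y \<cdot> 1) = 0" unfolding Dker_def by blast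
    then show "y \<in> orb S x" using phi_iff y 1 by (auto simp: smult_one)
  qed
qed

lemma phi_H: "y \<in> H \<Longrightarrow> \<phi> (y \<cdot> a) = 0" "y \<in> H \<Longrightarrow> \<phi> y = 0"
proof -
  assume "y \<in> H" then have *: "\<And>a. \<phi> (y \<cdot> a) = 0" by (simp add: Dker_def)
  show "\<phi> (y \<cdot> a) = 0" by (rule *)
  show "\<phi> y = 0" using *[of 1] by (simp add: smult_one)
qed

lemma h_H: "v \<in> H \<Longrightarrow> h v = v"
  using xi_H H(2) fixsD by (auto simp: h_def)

lemma h_in: "h v \<in> H"
proof -
  have "e v \<in> dsum H (line x)" by (subst H(5)) (rule tD(12))
  then obtain p a where pa: "p \<in> H" "e v = p + x \<cdot> a" by (auto simp: dsum_def line_def)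
  have "\<xi> v = \<xi> (p + x \<cdot> a)" using pa xi_e by metis
  also have "\<dots> = a" using dxi xi_x xi_H[OF pa(1)] by (simp add: dlin_def)
  finally show ?thesis using pa by (simp add: h_def)
qed

lemma e_split: "e v = h v + x \<cdot> \<xi> v"
  by (simp add: h_def)

lemma h_End: "h \<in> End'"
proof -
  have "e - (\<lambda>v. x \<cdot> \<xi> v) \<in> End'" using End_minusI[OF tD(10) rank1_End[OF dxi]] .
  moreover have "h = e - (\<lambda>v. x \<cdot> \<xi> v)" by (auto simp: h_def)
  ultimately show ?thesis by simp
qed

lemma h_idem: "idem h"
  unfolding idem_def using h_End h_H[OF h_in] by blast

lemma h_fixs: "fixs h = H"
  using h_H h_in fixsI[of h] fixsD[of _ h] by (metis subsetI subset_antisym)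

lemma h_x: "h x = 0"
  using fixsD[OF xE] xi_x by (simp add: h_def smult_one)

lemma S_End: "u \<in> S \<Longrightarrow> u \<in> End'" 
  using EsubD(1)[OF tD(3)] .

lemma S_split: assumes "u \<in> S" shows "u v = u (h v) + u x \<cdot> \<xi> v"
proof -
  have "u v = u (h v + x \<cdot> \<xi> v)" using cornerD(3)[OF tD(9)[OF assms], of v] e_split by simp
  then show ?thesis by (simp add: End_add[OF S_End[OF assms]] End_smult[OF S_End[OF assms]])
qed

text \<open>The image of \<open>u\<close> is closed under D, so it lies in \<open>H\<close> as soon
  as \<open>\<phi>\<close> vanishes on it.\<close>

lemma in_HI: assumes "u \<in> S" "\<And>v. \<phi> (u v) = 0" shows "u v \<in> H"
proof -
  have "\<phi> (u v \<cdot> a) = 0" for a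
    using assms(2)[of "v \<cdot> a"] End_smult[OF S_End[OF assms(1)]] by simp
  then show ?thesis using tD(11)[OF assms(1)] by (simp add: Dker_def)
qed

lemma T_H: assumes "u \<in> T" shows "u v \<in> H"
proof (rule in_HI[of u v])
  show "\<phi> (u v) = 0" for v
    using generic_kernel[OF tD(3) max bigx, of u v] assms phi_iff tD(11) by blast
qed (use assms in blast)

lemma ET: "Esub T" using Esub_ev_kernel[OF tD(3)] .

lemma dT: "dimE T = g m"
  using dim_orb[OF tD(3), of x] tD(6) dx by simp

lemma T_tight: "tight h m T"
proof -
  have "T \<subseteq> corner h"
  proof
    fix u assume u: "u \<in> T"
    have "h (u v) = u v" for v using h_H T_H[OF u] by blast
    moreover have "u (h v) = u v" for v using S_split[of u v] u by simp
    ultimately show "u \<in> corner h" using u S_End by (simp add: corner_def)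
  qed
  moreover have "TS T" using tD(5) by (auto simp: TS_def)
  moreover have "big (m * d)" using tD(7) by auto
  ultimately show ?thesis using h_idem h_fixs H(3) ET dT by (simp add: tight_def)
qed

section \<open>The form on the complement\<close>

lemma w_End: "w s \<in> End'" using wS S_End by blast

lemma b0_bil: "bil b0"
  unfolding bil_def lf_def b0_def
  using lfD[OF lphi] by (auto simp: w_add w_scale scaleE_def End_add[OF w_End] End_scF[OF w_End])

lemma phi_b0: assumes u: "u \<in> S" shows "\<phi> (u y) = - b0 y (u x)"
proof -
  have "(\<lambda>v. u v - w (u x) v) \<in> T"
    using Esub_diff[OF tD(3) u wS] w_x[OF u] by simp
  then have "\<phi> (u y - w (u x) y) = 0" using T_H phi_H(2) by blast
  then show ?thesis by (simp add: b0_def lf_diff[OF lphi])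
qed

text \<open>The operator \<open>w (v y)\<close> sends \<open>x\<close> to \<open>v y\<close>, so
  \<open>generic_second\<close> puts its value at \<open>y\<close> into \<open>S x\<close>, where
  \<open>\<phi>\<close> vanishes.\<close>

lemma b0_T: assumes v: "v \<in> T" shows "b0 y (v y) = 0"
proof -
  have "v y \<in> orb S x" using T_H[OF v] H(6) by blast
  then have "w (v y) x = v y" using w_x by auto
  then have "w (v y) y \<in> orb S x" using generic_second[OF tD(3) max bigx _ _ wS] v by blast
  then show ?thesis using phi_iff[OF tD(11)[OF wS]] by (simp add: b0_def)
qed

lemma b0_alt: "alt h b0 T"
  using b0_bil b0_T by (simp add: alt_def)

lemma b0_xH: assumes "p \<in> H" shows "b0 (x \<cdot> a) p = 0"
proof -
  have "p \<in> orb S x" using assms H(6) by blast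
  then have "w p x = p" using w_x by auto
  then show ?thesis using phi_H(1)[OF assms] by (simp add: b0_def End_smult[OF w_End])
qed

lemma b0_h: assumes "p \<in> H" shows "b0 y p = b0 (h y) p"
proof -
  have "w p y = w p (h y + x \<cdot> \<xi> y)"
    using cornerD(3)[OF tD(9)[OF wS], of p y] e_split by simp
  then have "b0 y p = b0 (h y + x \<cdot> \<xi> y) p" by (simp add: b0_def)
  then show ?thesis using b0_xH[OF assms] by (simp add: bil_add[OF b0_bil])
qed

text \<open>The operators of \<open>S\<close> sending \<open>x\<close> into \<open>P\<close> map into \<open>H\<close>, and by optimality of \<open>T\<close> they agree on
  \<open>H\<close> with operators of \<open>T\<close>. So \<open>S\<close> contains all maps from \<open>x D\<close> to \<open>P\<close> and \<open>P\<close> is invariant.\<close>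

lemma null_zero:
  assumes irr: "irr e S" and P: "dsub P" "P \<subseteq> H" and bP: "\<And>y p. p \<in> P \<Longrightarrow> b0 y p = 0" and hom: "Hm h P \<subseteq> T"
  shows "P = {0}"
proof -
  have PE: "P \<subseteq> fixs e" using P(2) H(2) by (rule subset_trans)
  let ?U = "{u\<in>S. u x \<in> P}"
  have EU: "Esub ?U" by (rule Esub_into(1)[OF tD(3) P(1)])
  have UH: "u v \<in> H" if "u \<in> ?U" for u v
  proof (rule in_HI[of u v])
    show "u \<in> S" using that by blast
    show "\<phi> (u v) = 0" for v using phi_b0[of u v] bP[of "u x" v] that by simp
  qed
  note r = dim_rcomp(2)[OF EU h_End]
  let ?Uh = "(\<lambda>u v. u (h v)) ` ?U"
  have "dimE ?Uh \<le> g m"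
  proof (rule ts_bound[OF h_idem _ r])
    show "dimV (fixs h) = m * d" using h_fixs H(3) by simp
    show "?Uh \<subseteq> corner h"
    proof clarify
      fix u assume u: "u \<in> S" "u x \<in> P"
      have "h (u v) = u v" for v using h_H UH[of u v] u by simp
      then show "(\<lambda>v. u (h v)) \<in> corner h"
        using End_comp[OF S_End[OF u(1)] h_End] h_idem by (simp add: corner_def idem_def)
    qed
    show "TS ?Uh" unfolding TS_def
    proof clarify
      fix u v assume u: "u \<in> S" "u x \<in> P" "u (h v) = v"
      have "v \<in> H" using UH[of u "h v"] u by simp
      then show "v = 0" using h_H TSD[OF tD(5) u(1)] u(3) by simp
    qed
    show "big (m * d)" using tD(7) by auto
  qed
  moreover have "T \<subseteq> ?Uh"
  proof
    fix u assume u: "u \<in> T"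
    then have "u = (\<lambda>v. u (h v))" using S_split[of u] by (auto simp: fun_eq_iff)
    moreover have "u \<in> ?U" using u dsub_0[OF P(1)] by simp
    ultimately show "u \<in> ?Uh" by blast
  qed
  ultimately have UT: "?Uh = T" using Esub_eq[OF ET r] dT by simp
  have rk: "(\<lambda>v. p \<cdot> \<xi> v) \<in> S" if p: "p \<in> P" for p
  proof -
    have "p \<in> orb S x" using p P(2) H(6) by blast
    then have wp: "w p x = p" using w_x by auto
    have "w p \<in> ?U" using p wS wp by simp
    from imageI[OF this, of "\<lambda>u v. u (h v)"]
    have "(\<lambda>v. w p (h v)) \<in> ?Uh" .
    then have "(\<lambda>v. w p (h v)) \<in> S" using UT by blast
    from Esub_diff[OF tD(3) wS[of p] this]
    have "(\<lambda>v. w p v - w p (h v)) \<in> S" .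
    moreover have "w p v - w p (h v) = p \<cdot> \<xi> v" for v using S_split[OF wS[of p], of v] wp by simp
    ultimately show ?thesis by simp
  qed
  have "Hm e P \<subseteq> S"
  proof
    fix C assume C: "C \<in> Hm e P"
    then have Cc: "C \<in> corner e" and CP: "\<And>v. C v \<in> P" and C0: "\<And>v. v \<in> P \<Longrightarrow> C v = 0"
      by (auto simp: Hm_def)
    have CE: "C \<in> End'" using cornerD(1)[OF Cc] .
    have "h (C (h v)) = C (h v)" for v using CP[of "h v"] P(2) h_H by blast
    then have "(\<lambda>v. C (h v)) \<in> corner h"
      using End_comp[OF CE h_End] h_idem by (simp add: corner_def idem_def)
    moreover have "C (h v) = 0" if "v \<in> P" for v using h_H C0 that P(2) by auto
    ultimately have "(\<lambda>v. C (h v)) \<in> Hm h P" using CP by (simp add: Hm_def)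
    then have "(\<lambda>v. C (h v)) \<in> S" using hom by blast
    from Esub_add[OF tD(3) this rk[OF CP[of x]]]
    have "(\<lambda>v. C (h v) + C x \<cdot> \<xi> v) \<in> S" .
    moreover have "C v = C (h v) + C x \<cdot> \<xi> v" for v
    proof -
      have "C v = C (h v + x \<cdot> \<xi> v)" using cornerD(3)[OF Cc, of v] e_split by simp
      then show ?thesis by (simp add: End_add[OF CE] End_smult[OF CE])
    qed
    then have "C = (\<lambda>v. C (h v) + C x \<cdot> \<xi> v)" by blast
    ultimately show "C \<in> S" by simp
  qed
  then have inv: "\<forall>u\<in>S. \<forall>v\<in>P. u v \<in> P"
    using hom_sub_invariant[OF tD(1,3,4,5) P(1) PE] by blast
  have "P \<noteq> fixs e" using H(4) P(2) xE by blast
  then show ?thesis using irrD[OF irr P(1) PE inv] by blast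
qed

text \<open>A proper invariant \<open>W\<close> makes \<open>T\<close> contain
  \<open>Hm h W\<close>. Its rank one elements with values in the line of \<open>p\<close>, for
  \<open>p\<close> in \<open>W\<close>, turn \<open>b0_T\<close> into \<open>b0 y p = 0\<close>, at
  first when \<open>h y\<close> is outside \<open>W\<close>, then for all \<open>y\<close> by adding
  a vector \<open>y1\<close> outside \<open>W\<close>. Now \<open>null_zero\<close> applies.\<close>

lemma T_irr: assumes irr: "irr e S" shows "irr h T"
  unfolding irr_def h_fixs
proof (intro allI impI; elim conjE)
  fix W assume W: "dsub W" "W \<subseteq> H" "\<forall>u\<in>T. \<forall>x\<in>W. u x \<in> W"
  note t = tightD[OF T_tight]
  show "W = {0} \<or> W = H"
  proof (rule disjCI)
    assume "W \<noteq> H"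
    then obtain y1 where y1: "y1 \<in> H" "y1 \<notin> W" using W by blast
    have hom: "Hm h W \<subseteq> T"
      using invariant_hom_sub[OF t(1-5) _ t(7) W(1) _ W(3)] t(6) W(2) h_fixs by simp
    have 1: "b0 y p = 0" if p: "p \<in> W" and y: "h y \<notin> W" for y p
    proof -
      obtain \<eta> where \<eta>: "dlin \<eta>" "\<eta> (h y) = 1" "\<And>v. \<eta> (h v) = \<eta> v" "\<And>q. q \<in> W \<Longrightarrow> q \<in> fixs h \<Longrightarrow> \<eta> q = 0"
        "\<And>p. p \<in> fixs h \<Longrightarrow> (\<lambda>v. p \<cdot> \<eta> v) \<in> corner h"
        using corner_coordinate[OF h_idem t(12) y W(1)] by metis
      have "(\<lambda>v. p \<cdot> \<eta> v) \<in> Hm h W"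
        using \<eta>(4,5) p W(2) h_fixs dsub_smult[OF W(1) p] unfolding Hm_def by auto
      then have "(\<lambda>v. p \<cdot> \<eta> v) \<in> T" using hom by blast
      from b0_T[OF this, of y] have "b0 y (p \<cdot> \<eta> y) = 0" .
      moreover have "\<eta> y = 1" using \<eta>(2,3) by simp
      ultimately show ?thesis by (simp add: smult_one)
    qed
    have "b0 y p = 0" if p: "p \<in> W" for y p
    proof (cases "h y \<in> W")
      case True
      have h1: "h y1 = y1" using y1 h_H by blast
      have "h (y + y1) \<notin> W"
      proof
        assume "h (y + y1) \<in> W"
        then have "h (y + y1) - h y \<in> W" using True dsub_diff[OF W(1)] by blast
        then show False using y1(2) h1 by (simp add: End_add[OF h_End])
      qed
      then have "b0 (y + y1) p = 0" "b0 y1 p = 0" using 1[OF p] y1(2) h1 by auto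
      then show ?thesis by (simp add: bil_add[OF b0_bil])
    qed (use 1 p in blast)
    then show "W = {0}" using null_zero[OF irr W(1,2) _ hom] by blast
  qed
qed

text \<open>For \<open>alt_nonisotropic\<close> it remains to see that \<open>b0\<close> is nonzero
  on \<open>H\<close>; otherwise \<open>null_zero\<close> with \<open>P = H\<close> would give
  \<open>H = {0}\<close>, as \<open>Hm h H\<close> is trivial.\<close>

lemma b0_nonisotropic:
  assumes irr: "irr e S" and m: "0 < m" and y: "y \<in> H" "y \<noteq> 0"
  shows "b0 y y \<noteq> 0" "dimV (orb T y) + 1 = m * d"
proof -
  note t = tightD[OF T_tight]
  have "\<exists>y\<in>H. \<exists>p\<in>H. b0 y p \<noteq> 0"
  proof (rule ccontr)
    assume "\<not> ?thesis"
    then have n: "b0 y p = 0" if "p \<in> H" for y p using b0_h[OF that, of y] h_in that by auto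
    have "Hm h H \<subseteq> T"
    proof
      fix u assume u: "u \<in> Hm h H"
      have "u v = 0" for v
      proof -
        have "u (h v) = 0" using u h_in by (auto simp: Hm_def)
        then show ?thesis using u cornerD(3)[of u h v] by (simp add: Hm_def)
      qed
      then have "u = (\<lambda>v. 0)" by blast
      then show "u \<in> T" using Esub_0[OF ET] by simp
    qed
    then have "H = {0}" using null_zero[OF irr H(1) subset_refl n] by blast
    then show False using y by blast
  qed
  then obtain a c where ac: "a \<in> fixs h" "c \<in> fixs h" "b0 a c \<noteq> 0" using h_fixs by blast
  note * = alt_nonisotropic[OF t(1-7) T_irr[OF irr] b0_alt ac]
  have "y \<in> fixs h" using y h_fixs by simp
  then show "b0 y y \<noteq> 0" "dimV (orb T y) + 1 = m * d" using *[of y] y(2) by blast+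
qed

text \<open>The operator \<open>u\<close> from \<open>line_hom_nonzero\<close> satisfies
  \<open>u x = 0\<close>, since \<open>b0 v (u x) = 0\<close> for all \<open>v\<close> and
  \<open>b0\<close> is nonisotropic. It also takes the value \<open>y\<close>, and polarisation with
  \<open>u y = 0\<close> yields \<open>b0 y y = 0\<close>.\<close>

lemma H_generic:
  assumes irr: "irr e S" and m: "0 < m" and y: "y \<in> H" "y \<noteq> 0"
  shows "dimV (orb S y) + 1 = Suc m * d"
proof (rule ccontr)
  assume n: "\<not> ?thesis"
  have yE: "y \<in> fixs e" using y H(2) by blast
  from line_hom_nonzero[OF t yE y(2) n]
  obtain u where u: "u \<in> S" "u y = 0" "\<And>v. u v \<in> line y" "u \<noteq> (\<lambda>y. 0)" by metis
  have lH: "line y \<subseteq> H" using line_least[OF H(1) y(1)] .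
  have uxH: "u x \<in> H" using u(3) lH by blast
  have "b0 v (u x) = 0" for v
  proof -
    have "\<phi> (u v) = 0" using phi_H(2) u(3) lH by blast
    then show ?thesis using phi_b0[OF u(1), of v] by simp
  qed
  then have "u x = 0" using b0_nonisotropic(1)[OF irr m uxH] by blast
  then have uT: "u \<in> T" using u by blast
  obtain v where v: "u v \<noteq> 0" using u(4) by (auto simp: fun_eq_iff)
  obtain a where a: "u v = y \<cdot> a" using u(3)[of v] by (auto simp: line_def)
  then have "a \<noteq> 0" using v by auto
  then have "u (v \<cdot> inverse a) = y"
    using a S_End[OF u(1)] by (simp add: End_smult smult_assoc smult_one)
  moreover have "u (h (v \<cdot> inverse a)) = u (v \<cdot> inverse a)"
    using cornerD(3) tightD(9)[OF T_tight uT] by blast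
  ultimately have uy: "u (h (v \<cdot> inverse a)) = y" by simp
  have "b0 y (u (h (v \<cdot> inverse a))) = - b0 (h (v \<cdot> inverse a)) (u y)"
    using alt_polar[OF b0_alt ET h_idem uT, of y "h (v \<cdot> inverse a)"] h_fixs y(1) h_in by blast
  then have "b0 y y = 0" using uy u(2) bil_0(2)[OF b0_bil] by simp
  then show False using b0_nonisotropic(1)[OF irr m y] by blast
qed

end

context div_space begin

lemma generic_vector_exists:
  assumes t: "tight e (Suc m) S" and x: "x \<in> fixs e" "x \<noteq> 0" and dx: "dimV (orb S x) + 1 = Suc m * d"
  obtains \<phi> \<xi> w where "generic_vector \<iota> smult BV BD e m S x \<phi> \<xi> w"
proof -
  note tD = tightD[OF t]
  have xo: "x \<notin> orb S x" using TSD[OF tD(5)] x by force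
  obtain \<phi> where \<phi>: "lf \<phi>" "\<phi> x = 1" "\<And>s. s \<in> orb S x \<Longrightarrow> \<phi> s = 0"
    using lf_exists[OF orb_subspace[OF tD(3)] xo] by metis
  have "x \<notin> Dker \<phi> (fixs e)" using Dker_dim(3)[OF \<phi>(1) tD(8) x(1)] \<phi>(2) by simp
  then obtain \<xi> where \<xi>: "dlin \<xi>" "\<xi> x = 1" "\<And>v. \<xi> (e v) = \<xi> v"
    "\<And>q. q \<in> Dker \<phi> (fixs e) \<Longrightarrow> q \<in> fixs e \<Longrightarrow> \<xi> q = 0" "\<And>p. p \<in> fixs e \<Longrightarrow> (\<lambda>v. p \<cdot> \<xi> v) \<in> corner e"
    using corner_coordinate[OF tD(1) x(1) _ dsub_Dker[OF \<phi>(1) tD(8)]] by metis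
  obtain w where w: "range w \<subseteq> S" "Vector_Spaces.linear (scaleV \<iota> smult) (scaleE \<iota> smult) w"
    "\<And>a. a \<in> orb S x \<Longrightarrow> w a x = a"
    using EV.linear_exists_right_inverse_on[OF linear_ev[of x] EsubD(2)[OF tD(3)]] by auto
  have "generic_vector \<iota> smult BV BD e m S x \<phi> \<xi> w"
  proof unfold_locales
    show "\<xi> v = 0" if "v \<in> Dker \<phi> (fixs e)" for v using \<xi>(4)[OF that] that by (simp add: Dker_def)
    show "w (s + t) = w s + w t" "w (c *f s) = scaleE \<iota> smult c (w s)" for s t c
      using w(2) unfolding Vector_Spaces.linear_iff by auto
    show "w s \<in> S" for s using w(1) by blast
  qed (use t x dx \<phi> \<xi> w(3) in auto)
  then show ?thesis using that by blast
qed

end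

section \<open>Construction of the form\<close>

context generic_vector begin

lemma phi_coord: assumes "lf f" "\<forall>u\<in>S. f (u x) = 0" "p \<in> fixs e" shows "f p = \<phi> p * f x"
proof -
  have "p - \<phi> p *f x \<in> fixs e"
    using V.subspace_diff[OF dsub_subspace[OF tD(8)] assms(3) V.subspace_scale[OF dsub_subspace[OF tD(8)] xE]] .
  moreover have "\<phi> (p - \<phi> p *f x) = 0" using phi_x by (simp add: lf_diff[OF lphi] lfD(2)[OF lphi])
  ultimately have "p - \<phi> p *f x \<in> orb S x" using phi_iff by blast
  then have "f (p - \<phi> p *f x) = 0" using assms(2) by auto
  then show ?thesis by (simp add: lf_diff[OF assms(1)] lfD(2)[OF assms(1)])
qed

lemma orb_T_dim:
  assumes irr: "irr e S" and m: "0 < m" and y: "h y \<noteq> 0" shows "dimV (orb T y) + 1 = m * d"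
  using b0_nonisotropic(2)[OF irr m h_in y] orb_corner[OF tightD(4)[OF T_tight], of y] by simp

text \<open>Here \<open>y = x a\<close> and \<open>S y = (S x) a\<close>, so both orbits contain the
  same D-subspaces. The contrapositive is used: distinct complements put \<open>y\<close> outside
  the line of \<open>x\<close>.\<close>

lemma H_line:
  assumes Y: "generic_vector \<iota> smult BV BD e m S y \<phi>' \<xi>' w'" and y: "h y = 0"
  shows "Dker \<phi>' (fixs e) = H"
proof -
  interpret Y: generic_vector \<iota> smult BV BD e m S y \<phi>' \<xi>' w' by fact
  define a where "a = \<xi> y"
  have yx: "y = x \<cdot> a" using e_split[of y] fixsD[OF Y.xE] y by (simp add: a_def)
  then have a0: "a \<noteq> 0" using Y.x0 by auto
  have "H \<subseteq> Y.H"
  proof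
    fix p assume p: "p \<in> H"
    have "\<phi>' (p \<cdot> c) = 0" for c
    proof -
      have "p \<cdot> c \<cdot> inverse a \<in> orb S x" using dsub_smult[OF H(1)] p H(6) by blast
      then obtain u where u: "u \<in> S" "p \<cdot> c \<cdot> inverse a = u x" by blast
      have "p \<cdot> c = (p \<cdot> c \<cdot> inverse a) \<cdot> a" using a0 by (simp add: smult_assoc smult_one mult.assoc)
      also have "\<dots> = u y" using u yx End_smult[OF S_End[OF u(1)]] by simp
      finally show ?thesis using Y.phi_S[OF u(1)] by simp
    qed
    then show "p \<in> Y.H" using p by (simp add: Dker_def)
  qed
  then have "H = Y.H"
    using V.subspace_dim_equal[OF dsub_subspace[OF H(1)] dsub_subspace[OF Y.H(1)]] H(3) Y.H(3) by simp
  then show ?thesis by simp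
qed

text \<open>A dimension count shows that \<open>S x \<inter> S y\<close> is the sum of \<open>{v y | v. v \<in> S \<and> v x = 0}\<close> and
  \<open>{v x | v. v \<in> S \<and> v y = 0}\<close>.\<close>

lemma functional_in_span:
  assumes Y: "generic_vector \<iota> smult BV BD e m S y \<phi>' \<xi>' w'"
    and irr: "irr e S" and m: "0 < m" and ne: "H \<noteq> Dker \<phi>' (fixs e)"
    and f: "lf f" "\<And>v. v \<in> S \<Longrightarrow> v x = 0 \<Longrightarrow> f (v y) = 0" "\<And>v. v \<in> S \<Longrightarrow> v y = 0 \<Longrightarrow> f (v x) = 0"
  shows "\<exists>a c. \<forall>p\<in>fixs e. f p = a * \<phi> p + c * \<phi>' p"
proof -
  interpret Y: generic_vector \<iota> smult BV BD e m S y \<phi>' \<xi>' w' by fact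
  have hy: "h y \<noteq> 0" using H_line[OF Y] ne by blast
  have X: "generic_vector \<iota> smult BV BD e m S x \<phi> \<xi> w" by unfold_locales
  have hx: "Y.h x \<noteq> 0" using Y.H_line[OF X] ne by blast
  let ?A = "orb T y" and ?B = "orb Y.T x" and ?C = "{p\<in>orb S x. \<phi>' p = 0}"
  have A: "V.subspace ?A" and B: "V.subspace ?B" using orb_subspace ET Y.ET by blast+
  have dA: "dimV ?A + 1 = m * d" using orb_T_dim[OF irr m hy] .
  have dB: "dimV ?B + 1 = m * d" using Y.orb_T_dim[OF irr m hx] .
  have AH: "?A \<subseteq> H" using T_H by blast
  have BH: "?B \<subseteq> Y.H" using Y.T_H by blast
  \<comment> \<open>Two distinct D-subspaces of equal dimension: the intersection is smaller by at
    least \<open>d\<close>.\<close>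
  have dI: "dimV (?A \<inter> ?B) + d \<le> m * d"
  proof -
    have HI: "dsub (H \<inter> Y.H)" using dsub_Int[OF H(1) Y.H(1)] .
    obtain j where j: "dimV H = dimV (H \<inter> Y.H) + j * d" using dim_multiple[OF HI H(1)] by blast
    have "H \<inter> Y.H \<noteq> H"
    proof
      assume "H \<inter> Y.H = H"
      then have "H \<subseteq> Y.H" by blast
      then show False
        using ne V.subspace_dim_equal[OF dsub_subspace[OF H(1)] dsub_subspace[OF Y.H(1)]] H(3) Y.H(3) by simp
    qed
    then have "\<not> dimV H \<le> dimV (H \<inter> Y.H)"
      using V.subspace_dim_equal[OF dsub_subspace[OF HI] dsub_subspace[OF H(1)]] by blast
    then have "j \<noteq> 0" using j by auto
    then have "d \<le> j * d" by simp
    then have "dimV (H \<inter> Y.H) + d \<le> m * d" using j H(3) by linarith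
    moreover have "dimV (?A \<inter> ?B) \<le> dimV (H \<inter> Y.H)" using AH BH by (intro V.dim_subset) blast
    ultimately show ?thesis by linarith
  qed
  have sx: "V.subspace (orb S x)" using orb_subspace[OF tD(3)] .
  have "\<exists>s\<in>orb S x. \<phi>' s \<noteq> 0"
  proof (rule ccontr)
    assume "\<not> ?thesis"
    then have "orb S x \<subseteq> orb S y" using Y.phi_iff orbE by blast
    then have "orb S x = orb S y"
      using V.subspace_dim_equal[OF sx orb_subspace[OF tD(3)]] dx Y.dx by simp
    then have "\<phi> p = 0 \<longleftrightarrow> \<phi>' p = 0" if "p \<in> fixs e" for p
      using phi_iff[OF that] Y.phi_iff[OF that] by simp
    then have "H = Y.H" using dsub_smult[OF tD(8)] unfolding Dker_def by blast
    then show False using ne by simp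
  qed
  then obtain s where s: "s \<in> orb S x" "\<phi>' s \<noteq> 0" by blast
  have C: "V.subspace ?C" using lf_kernel_subspace[OF Y.lphi sx] .
  have dC: "dimV ?C + 2 = Suc m * d" using lf_kernel_dim[OF Y.lphi sx s] dx by simp
  let ?AB = "{a + b |a b. a \<in> ?A \<and> b \<in> ?B}"
  have AB: "V.subspace ?AB" using V.subspace_sums[OF A B] .
  have AC: "?A \<subseteq> ?C" using AH H(6) Y.phi_S by blast
  have BC: "?B \<subseteq> ?C" using BH Y.phi_H(2) by blast
  have sub: "?AB \<subseteq> ?C"
  proof
    fix z assume "z \<in> ?AB"
    then obtain a b where ab: "a \<in> ?A" "b \<in> ?B" "z = a + b" by blast
    have "a + b \<in> ?C" using V.subspace_add[OF C] ab AC BC by blast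
    then show "z \<in> ?C" using ab(3) by simp
  qed
  \<comment> \<open>The sum has dimension at least
    \<open>2 (m d - 1) - (m d - d) = (m + 1) d - 2\<close>, the dimension of
    \<open>?C\<close>.\<close>
  have "dimV ?AB + dimV (?A \<inter> ?B) = dimV ?A + dimV ?B" using V.dim_sums_Int[OF A B] .
  then have "dimV ?C \<le> dimV ?AB" using dA dB dI dC by simp
  then have ABC: "?AB = ?C" using V.subspace_dim_equal[OF AB C sub] by blast
  have fC: "f p = 0" if "p \<in> orb S x" "\<phi>' p = 0" for p
  proof -
    have "p \<in> ?AB" using that ABC by blast
    then obtain a b where ab: "a \<in> T" "b \<in> Y.T" "p = a y + b x" by blast
    have "f (a y) = 0" using f(2)[of a] ab(1) by simp
    moreover have "f (b x) = 0" using f(3)[of b] ab(2) by simp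
    ultimately show ?thesis using ab(3) lfD(1)[OF f(1)] by simp
  qed
  \<comment> \<open>As \<open>f\<close> vanishes on \<open>?C\<close>, it is a multiple of
    \<open>\<phi>'\<close> on \<open>S x\<close>. The difference vanishes on \<open>S x\<close> and
    so is a multiple of \<open>\<phi>\<close> on \<open>fixs e\<close>.\<close>
  define c where "c = f s / \<phi>' s"
  have fc: "f p = c * \<phi>' p" if "p \<in> orb S x" for p
    using lf_proportional[OF Y.lphi f(1) sx fC s that] by (simp add: c_def)
  define f' where "f' = (\<lambda>p. f p - c * \<phi>' p)"
  have "f' (p + q) = f' p + f' q" for p q
    unfolding f'_def lfD(1)[OF f(1)] lfD(1)[OF Y.lphi] by algebra
  moreover have "f' (a *f p) = a * f' p" for a p
    unfolding f'_def lfD(2)[OF f(1)] lfD(2)[OF Y.lphi] by algebra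
  ultimately have lf': "lf f'" by (simp add: lf_def)
  have f'S: "\<forall>u\<in>S. f' (u x) = 0" using fc by (simp add: f'_def)
  have "f p = f' x * \<phi> p + c * \<phi>' p" if "p \<in> fixs e" for p
  proof -
    have "f p = f' p + c * \<phi>' p" by (simp add: f'_def)
    then show ?thesis using phi_coord[OF lf' f'S that] by (simp add: mult.commute)
  qed
  then show ?thesis by blast
qed

end

locale generic_irreducible = generic_vector +
  assumes irr: "irr e S" and m: "0 < m"
begin

section \<open>Functionals normalised by the form\<close>

lemma b0_pos: "y \<in> H \<Longrightarrow> y \<noteq> 0 \<Longrightarrow> b0 y y \<noteq> 0"
  using b0_nonisotropic(1)[OF irr m] .

lemma H_nonzero: obtains y where "y \<in> H" "y \<noteq> 0"
proof -
  have "\<not> H \<subseteq> {0}" using H(3) m d_pos V.dim_eq_0[of H] by fastforce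
  then show ?thesis using that by blast
qed

lemma b0_kernel: assumes y: "y \<in> H" "y \<noteq> 0" and p: "p \<in> H" "b0 y p = 0" shows "p \<in> orb T y"
proof -
  let ?A = "{p\<in>H. b0 y p = 0}"
  have A: "V.subspace ?A" using lf_kernel_subspace[OF bilD(1)[OF b0_bil] dsub_subspace[OF H(1)]] .
  have "dimV ?A + 1 = m * d"
    using lf_kernel_dim[OF bilD(1)[OF b0_bil] dsub_subspace[OF H(1)] y(1) b0_pos[OF y]] H(3) by simp
  then have "dimV ?A \<le> dimV (orb T y)" using b0_nonisotropic(2)[OF irr m y] by simp
  moreover have "orb T y \<subseteq> ?A"
  proof clarify
    fix v assume v: "v \<in> S" "v x = 0"
    then have "v \<in> T" by simp
    from T_H[OF this] b0_T[OF this] show "v y \<in> H \<and> b0 y (v y) = 0" by blast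
  qed
  ultimately have "orb T y = ?A"
    using V.subspace_dim_equal[OF orb_subspace[OF ET] A] by blast
  then show ?thesis using p by blast
qed

text \<open>Both \<open>b0 y\<close> and \<open>\<psi>\<close> vanish on the orbit of
  \<open>y\<close> under \<open>T\<close>, a hyperplane of \<open>H\<close>; the factor is read off
  at \<open>y\<close>, where \<open>\<psi>\<close> is 1.\<close>

lemma functional_exists:
  assumes y: "y \<in> H" "y \<noteq> 0"
  obtains \<psi> \<eta> w' where "generic_vector \<iota> smult BV BD e m S y \<psi> \<eta> w'"
    "\<And>p. p \<in> H \<Longrightarrow> b0 y p = b0 y y * \<psi> p"
proof -
  have yE: "y \<in> fixs e" using y(1) H(2) by blast
  obtain \<psi> \<eta> w' where Y: "generic_vector \<iota> smult BV BD e m S y \<psi> \<eta> w'"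
    using generic_vector_exists[OF t yE y(2) H_generic[OF irr m y]] .
  interpret Y: generic_vector \<iota> smult BV BD e m S y \<psi> \<eta> w' by fact
  have ker: "b0 y p = 0" if p: "p \<in> H" "\<psi> p = 0" for p
  proof -
    let ?A = "{p\<in>H. \<psi> p = 0}"
    have A: "V.subspace ?A" using lf_kernel_subspace[OF Y.lphi dsub_subspace[OF H(1)]] .
    have "dimV ?A + 1 = m * d"
      using lf_kernel_dim[OF Y.lphi dsub_subspace[OF H(1)] y(1)] Y.phi_x H(3) by simp
    then have "dimV ?A \<le> dimV (orb T y)" using b0_nonisotropic(2)[OF irr m y] by simp
    moreover have "orb T y \<subseteq> ?A"
    proof clarify
      fix v assume v: "v \<in> S" "v x = 0"
      then have "v \<in> T" by simp
      from T_H[OF this] Y.phi_S[OF v(1)] show "v y \<in> H \<and> \<psi> (v y) = 0" by blast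
    qed
    ultimately have "orb T y = ?A" using V.subspace_dim_equal[OF orb_subspace[OF ET] A] by blast
    then obtain v where v: "v \<in> T" "p = v y" using p by blast
    then show ?thesis using b0_T by blast
  qed
  have "b0 y p = b0 y y * \<psi> p" if "p \<in> H" for p
    using lf_proportional[OF Y.lphi bilD(1)[OF b0_bil] dsub_subspace[OF H(1)] ker y(1) _ that] Y.phi_x
    by simp
  then show ?thesis using that Y by blast
qed

text \<open>The last condition determines \<open>f\<close> outside \<open>fixs e\<close>, so that
  identities checked on \<open>fixs e\<close> extend to all vectors.\<close>

definition Fprop :: "'c \<Rightarrow> ('c \<Rightarrow> 'a) \<Rightarrow> bool" where
  "Fprop y f \<longleftrightarrow> lf f \<and> (\<forall>u\<in>S. f (u y) = 0) \<and> (\<forall>p\<in>H. f p = b0 y p) \<and> (\<forall>v. f (e v) = f v)"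

text \<open>For \<open>y \<in> H\<close> nonzero, \<open>F y\<close> is the functional with kernel \<open>S y\<close> that agrees with \<open>b0 y\<close> on \<open>H\<close>.\<close>

definition F :: "'c \<Rightarrow> 'c \<Rightarrow> 'a" where
  "F y = (if y = 0 then (\<lambda>v. 0) else SOME f. Fprop y f)"

lemma F_prop: assumes y: "y \<in> H" shows "Fprop y (F y)"
proof (cases "y = 0")
  case True
  then show ?thesis using bil_0(1)[OF b0_bil] by (simp add: Fprop_def F_def lf_def)
next
  case False
  obtain \<psi> \<eta> w' where Y: "generic_vector \<iota> smult BV BD e m S y \<psi> \<eta> w'"
    and bp: "\<And>p. p \<in> H \<Longrightarrow> b0 y p = b0 y y * \<psi> p" by (rule functional_exists[OF y False]) (rule that)
  interpret Y: generic_vector \<iota> smult BV BD e m S y \<psi> \<eta> w' by fact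
  have ee: "e (e v) = e v" for v using tD(12) fixsD by blast
  have eH: "e p = p" if "p \<in> H" for p using H(2) that fixsD by blast
  have eS: "e (u y) = u y" if "u \<in> S" for u using tD(11)[OF that] fixsD by blast
  have "Fprop y (\<lambda>v. b0 y y * \<psi> (e v))"
    unfolding Fprop_def
  proof (intro conjI ballI allI)
    show "lf (\<lambda>v. b0 y y * \<psi> (e v))"
      by (simp add: lf_def lfD(1)[OF Y.lphi] lfD(2)[OF Y.lphi] End_add[OF tD(10)] End_scF[OF tD(10)]
          distrib_left mult.left_commute)
    show "b0 y y * \<psi> (e (u y)) = 0" if "u \<in> S" for u using eS[OF that] Y.phi_S[OF that] by simp
    show "b0 y y * \<psi> (e p) = b0 y p" if "p \<in> H" for p using eH[OF that] bp[OF that] by simp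
    show "b0 y y * \<psi> (e (e v)) = b0 y y * \<psi> (e v)" for v using ee by simp
  qed
  then show ?thesis using someI[of "Fprop y"] False by (simp add: F_def)
qed

lemma F_lf: "y \<in> H \<Longrightarrow> lf (F y)" and F_S: "y \<in> H \<Longrightarrow> u \<in> S \<Longrightarrow> F y (u y) = 0"
  and F_H: "y \<in> H \<Longrightarrow> p \<in> H \<Longrightarrow> F y p = b0 y p" and F_e: "y \<in> H \<Longrightarrow> F y (e v) = F y v"
  using F_prop unfolding Fprop_def by blast+

lemma F_S_all: "y \<in> H \<Longrightarrow> \<forall>u\<in>S. F y (u y) = 0"
  using F_S by blast

lemma F_0: "F 0 p = 0" by (simp add: F_def)

text \<open>\<open>S y\<close> is a hyperplane of \<open>fixs e\<close> that misses
  \<open>y\<close>, so a functional vanishing on it is determined there by its value at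
  \<open>y\<close>.\<close>

lemma F_char:
  assumes y: "y \<in> H" "y \<noteq> 0" and f: "lf f" "\<forall>u\<in>S. f (u y) = 0" "f y = b0 y y" and p: "p \<in> fixs e"
  shows "f p = F y p"
proof -
  obtain \<psi> \<eta> w' where Y: "generic_vector \<iota> smult BV BD e m S y \<psi> \<eta> w'"
    by (rule functional_exists[OF y]) (erule that)
  interpret Y: generic_vector \<iota> smult BV BD e m S y \<psi> \<eta> w' by fact
  show ?thesis
    using Y.phi_coord[OF f(1,2) p] Y.phi_coord[OF F_lf[OF y(1)] F_S_all[OF y(1)] p] f(3) F_H[OF y(1) y(1)] by simp
qed

section \<open>The conjugation of D\<close>

lemma b0_scale: "b0 y (p \<cdot> \<iota> c) = c * b0 y p" "b0 (y \<cdot> \<iota> c) p = c * b0 y p"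
  using bil_scF[OF b0_bil, where c = c] by (simp_all add: scaleV_def)

lemma b0_cancel:
  assumes y: "y \<in> H" "y \<noteq> 0" and eq: "\<And>p. p \<in> H \<Longrightarrow> b0 y (p \<cdot> a) = b0 y (p \<cdot> c)" shows "a = c"
proof (rule ccontr)
  assume "a \<noteq> c"
  then have ac: "a - c \<noteq> 0" by simp
  have "b0 y (p \<cdot> (a - c)) = 0" if "p \<in> H" for p
    using eq[OF that] lf_diff[OF bilD(1)[OF b0_bil]] by (simp add: smult_diff_right)
  from this[OF dsub_smult[OF H(1) y(1)], of "inverse (a - c)"]
  have "b0 y y = 0" using ac by (simp add: smult_assoc smult_one)
  then show False using b0_pos[OF y] by simp
qed

text \<open>On \<open>H\<close> the functional \<open>?f\<close> vanishes only on
  \<open>(T y) a\<close>, which is the orbit of \<open>y a\<close> under \<open>T\<close>, and there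
  \<open>b0 (y a)\<close> vanishes by \<open>b0_T\<close>.\<close>

lemma b0_inverse:
  assumes y: "y \<in> H" "y \<noteq> 0" and a: "a \<noteq> 0"
  shows "\<exists>N. \<forall>p\<in>H. b0 (y \<cdot> a) p = N * b0 y (p \<cdot> inverse a)"
proof -
  let ?f = "\<lambda>p. b0 y (p \<cdot> inverse a)"
  have f: "lf ?f" using lf_smult[OF bilD(1)[OF b0_bil]] .
  have ya: "y \<cdot> a \<in> H" using dsub_smult[OF H(1) y(1)] .
  have fya: "?f (y \<cdot> a) \<noteq> 0" using a b0_pos[OF y] by (simp add: smult_assoc smult_one)
  have ker: "b0 (y \<cdot> a) p = 0" if p: "p \<in> H" "?f p = 0" for p
  proof -
    obtain v where v: "v \<in> T" "p \<cdot> inverse a = v y"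
      using b0_kernel[OF y dsub_smult[OF H(1) p(1)] p(2)] by blast
    have "p = (p \<cdot> inverse a) \<cdot> a" using a by (simp add: smult_assoc smult_one)
    also have "\<dots> = v (y \<cdot> a)" using v End_smult S_End by simp
    finally show ?thesis using b0_T[OF v(1)] by simp
  qed
  have "b0 (y \<cdot> a) p = (b0 (y \<cdot> a) (y \<cdot> a) / ?f (y \<cdot> a)) * ?f p" if "p \<in> H" for p
    by (rule lf_proportional[OF f bilD(1)[OF b0_bil] dsub_subspace[OF H(1)] ker ya fya that])
  then show ?thesis by blast
qed

text \<open>By the previous lemma \<open>b0 (y a) p = b0 y (p c)\<close> with \<open>c = N\<^sub>a a\<inverse>\<close>. As the left side is additive
  in \<open>a\<close>, comparing \<open>1 + a\<close> with \<open>a\<close> shows that \<open>a + c\<close> lies in \<open>F\<close>.\<close>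

lemma conj_exists:
  assumes y: "y \<in> H" "y \<noteq> 0"
  shows "\<exists>\<kappa> N. a * (\<iota> \<kappa> - a) = \<iota> N \<and> (\<forall>p\<in>H. b0 (y \<cdot> a) p = b0 y (p \<cdot> (\<iota> \<kappa> - a)))"
proof -
  \<comment> \<open>The main case inverts both \<open>a\<close> and \<open>1 + a\<close>.\<close>
  consider "a = 0" | "a = - 1" | "a \<noteq> 0" "1 + a \<noteq> 0" by (metis add.commute eq_neg_iff_add_eq_0)
  then show ?thesis
  proof cases
    case 1
    then show ?thesis using bil_0[OF b0_bil] by (intro exI[of _ 0]) simp
  next
    case 2
    have \<kappa>: "\<iota> (- 1 - 1) - a = - 1" unfolding iota_diff iota_minus one 2 by simp
    have "b0 (y \<cdot> (- 1)) p = b0 y (p \<cdot> (- 1))" for p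
      using lf_neg[OF bilD(1)[OF b0_bil]] lf_neg[OF bilD(2)[OF b0_bil]] by (simp add: smult_minus_right smult_one)
    then show ?thesis using \<kappa> 2 one by (intro exI[of _ "- 1 - 1"] exI[of _ 1]) simp
  next
    case 3
    obtain N1 where N1: "\<And>p. p \<in> H \<Longrightarrow> b0 (y \<cdot> a) p = N1 * b0 y (p \<cdot> inverse a)"
      using b0_inverse[OF y 3(1)] by blast
    obtain N2 where N2: "\<And>p. p \<in> H \<Longrightarrow> b0 (y \<cdot> (1 + a)) p = N2 * b0 y (p \<cdot> inverse (1 + a))"
      using b0_inverse[OF y 3(2)] by blast
    have "inverse (1 + a) * \<iota> N2 = 1 + inverse a * \<iota> N1"
    proof (rule b0_cancel[OF y])
      fix p assume p: "p \<in> H"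
      have "b0 y (p \<cdot> (inverse (1 + a) * \<iota> N2)) = b0 (y \<cdot> (1 + a)) p"
        using N2[OF p] b0_scale(1)[of y "p \<cdot> inverse (1 + a)" N2] by (simp add: smult_assoc)
      also have "\<dots> = b0 y p + b0 (y \<cdot> a) p"
        by (simp add: smult_add_right smult_one bil_add[OF b0_bil])
      also have "\<dots> = b0 y (p \<cdot> (1 + inverse a * \<iota> N1))"
        using N1[OF p] b0_scale(1)[of y "p \<cdot> inverse a" N1]
        by (simp add: smult_assoc smult_add_right smult_one bil_add[OF b0_bil])
      finally show "b0 y (p \<cdot> (inverse (1 + a) * \<iota> N2)) = b0 y (p \<cdot> (1 + inverse a * \<iota> N1))" .
    qed
    then have "(1 + a) * (inverse (1 + a) * \<iota> N2) = (1 + a) * (1 + inverse a * \<iota> N1)" by simp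
    moreover have "(1 + a) * (inverse (1 + a) * \<iota> N2) = \<iota> N2" using 3(2) by (simp add: mult.assoc[symmetric])
    moreover have "(1 + a) * (1 + inverse a * \<iota> N1) = 1 + inverse a * \<iota> N1 + a + \<iota> N1"
      using 3(1) by (simp add: distrib_right distrib_left mult.assoc[symmetric] add.assoc)
    ultimately have "\<iota> N2 = 1 + inverse a * \<iota> N1 + a + \<iota> N1" by simp
    then have \<kappa>: "\<iota> (N2 - 1 - N1) - a = inverse a * \<iota> N1" by (simp add: iota_diff one local.add algebra_simps)
    have "a * (inverse a * \<iota> N1) = \<iota> N1" using 3(1) by (simp add: mult.assoc[symmetric])
    moreover have "b0 (y \<cdot> a) p = b0 y (p \<cdot> (inverse a * \<iota> N1))" if "p \<in> H" for p
      using N1[OF that] b0_scale(1)[of y "p \<cdot> inverse a" N1] by (simp add: smult_assoc)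
    ultimately show ?thesis using \<kappa> by (intro exI[of _ "N2 - 1 - N1"] exI[of _ N1]) simp
  qed
qed

text \<open>\<open>conj_exists\<close> provides \<open>\<kappa>\<close> for each \<open>y\<close>
  separately. If two of them differ, subtracting the two norm equations shows that \<open>a\<close>
  lies in F, and there the claim reduces to the homogeneity of \<open>b0\<close>.\<close>

lemma bar_exists:
  "\<exists>bar. \<forall>a. (\<exists>\<kappa>. bar a = \<iota> \<kappa> - a) \<and> (\<exists>N. a * bar a = \<iota> N)
     \<and> (\<forall>y\<in>H. \<forall>p\<in>H. b0 (y \<cdot> a) p = b0 y (p \<cdot> bar a))"
proof (intro choice allI)
  fix a
  obtain y1 where y1: "y1 \<in> H" "y1 \<noteq> 0" using H_nonzero .
  obtain \<kappa>1 N1 where 1: "a * (\<iota> \<kappa>1 - a) = \<iota> N1" "\<And>p. p \<in> H \<Longrightarrow> b0 (y1 \<cdot> a) p = b0 y1 (p \<cdot> (\<iota> \<kappa>1 - a))"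
    using conj_exists[OF y1, of a] by blast
  have "b0 (y \<cdot> a) p = b0 y (p \<cdot> (\<iota> \<kappa>1 - a))" if yp: "y \<in> H" "p \<in> H" for y p
  proof (cases "y = 0")
    case True then show ?thesis using bil_0[OF b0_bil] by simp
  next
    case y0: False
    obtain \<kappa>2 N2 where 2: "a * (\<iota> \<kappa>2 - a) = \<iota> N2" "\<And>p. p \<in> H \<Longrightarrow> b0 (y \<cdot> a) p = b0 y (p \<cdot> (\<iota> \<kappa>2 - a))"
      using conj_exists[OF yp(1) y0, of a] by blast
    show ?thesis
    proof (cases "\<kappa>1 = \<kappa>2")
      case True then show ?thesis using 2 yp by simp
    next
      case False
      have "a * \<iota> (\<kappa>1 - \<kappa>2) = a * (\<iota> \<kappa>1 - a) - a * (\<iota> \<kappa>2 - a)" by (simp add: iota_diff right_diff_distrib)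
      also have "\<dots> = \<iota> (N1 - N2)" using 1(1) 2(1) by (simp add: iota_diff)
      finally have "a * \<iota> (\<kappa>1 - \<kappa>2) * inverse (\<iota> (\<kappa>1 - \<kappa>2)) = \<iota> (N1 - N2) * inverse (\<iota> (\<kappa>1 - \<kappa>2))" by simp
      then have ac: "a = \<iota> ((N1 - N2) * inverse (\<kappa>1 - \<kappa>2))"
        using False by (simp add: mult.assoc mult iota_inverse)
      have "a = \<iota> \<kappa>1 - a"
      proof (rule b0_cancel[OF y1])
        show "b0 y1 (p \<cdot> a) = b0 y1 (p \<cdot> (\<iota> \<kappa>1 - a))" if "p \<in> H" for p
          using 1(2)[OF that] b0_scale ac by metis
      qed
      moreover have "b0 (y \<cdot> a) p = b0 y (p \<cdot> a)" using b0_scale ac by metis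
      ultimately show ?thesis by simp
    qed
  qed
  then show "\<exists>z. (\<exists>\<kappa>. z = \<iota> \<kappa> - a) \<and> (\<exists>N. a * z = \<iota> N) \<and> (\<forall>y\<in>H. \<forall>p\<in>H. b0 (y \<cdot> a) p = b0 y (p \<cdot> z))"
    using 1(1) by blast
qed

text \<open>The standard conjugation, with \<open>\<kappa>\<close> and \<open>N\<close> as trace and
  norm: every element of D satisfies a quadratic equation over F. At the same time
  \<open>bar a\<close> is the adjoint of \<open>a\<close> with respect to \<open>b0\<close>.\<close>

definition bar :: "'b \<Rightarrow> 'b" where
  "bar = (SOME bar. \<forall>a. (\<exists>\<kappa>. bar a = \<iota> \<kappa> - a) \<and> (\<exists>N. a * bar a = \<iota> N)
     \<and> (\<forall>y\<in>H. \<forall>p\<in>H. b0 (y \<cdot> a) p = b0 y (p \<cdot> bar a)))"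

lemma bar: "\<exists>\<kappa>. bar a = \<iota> \<kappa> - a" "\<exists>N. a * bar a = \<iota> N"
  "y \<in> H \<Longrightarrow> p \<in> H \<Longrightarrow> b0 (y \<cdot> a) p = b0 y (p \<cdot> bar a)"
  using someI_ex[OF bar_exists] unfolding bar_def[symmetric] by blast+

text \<open>By \<open>b0_cancel\<close> the adjoint of \<open>a\<close> is unique, so the rules for
  \<open>bar\<close> follow from rules for \<open>b0\<close>.\<close>

lemma barI: assumes "\<And>y p. y \<in> H \<Longrightarrow> p \<in> H \<Longrightarrow> b0 (y \<cdot> a) p = b0 y (p \<cdot> c)" shows "bar a = c"
proof -
  obtain y1 where y1: "y1 \<in> H" "y1 \<noteq> 0" using H_nonzero .
  show ?thesis by (rule b0_cancel[OF y1]) (use assms[OF y1(1)] bar(3)[OF y1(1)] in simp)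
qed

lemma bar_iota: "bar (\<iota> c) = \<iota> c"
  by (rule barI) (simp add: b0_scale)

lemma bar_add: "bar (a + c) = bar a + bar c"
  by (rule barI) (simp add: smult_add_right bil_add[OF b0_bil] bar(3))

lemma bar_iota_mult: "bar (a * \<iota> c) = bar a * \<iota> c"
  by (rule barI) (simp add: smult_assoc[symmetric] b0_scale bar(3))

lemma bar_0: "bar 0 = 0" and bar_1: "bar 1 = 1"
  using bar_iota[of 0] bar_iota[of 1] one by simp_all

lemma bar_bar: "bar (bar a) = a"
proof -
  obtain \<kappa> where \<kappa>: "bar a = \<iota> \<kappa> - a" using bar(1) by blast
  have "bar (bar a) + bar a = bar (bar a + a)" using bar_add by simp
  also have "\<dots> = bar a + a" using \<kappa> bar_iota by simp
  finally show ?thesis by simp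
qed

text \<open>As a functional of \<open>p\<close> the right side vanishes on \<open>S (y a)\<close>,
  because multiplying \<open>u (y a)\<close> by \<open>bar a\<close> gives \<open>N (u y)\<close>;
  then \<open>F_char\<close> identifies it.\<close>

lemma F_smult:
  assumes y: "y \<in> H" and p: "p \<in> fixs e" shows "F (y \<cdot> a) p = F y (p \<cdot> bar a)"
proof (cases "y = 0 \<or> a = 0")
  case True
  then show ?thesis using F_0 bar_0 lf_0[OF F_lf[OF y]] by auto
next
  case False
  obtain N where N: "a * bar a = \<iota> N" using bar(2) by blast
  have ya: "y \<cdot> a \<in> H" "y \<cdot> a \<noteq> 0" using dsub_smult[OF H(1) y] False by auto
  have aN: "z \<cdot> a \<cdot> bar a = N *f z" for z by (simp add: smult_assoc N scaleV_def)
  have "F y (p \<cdot> bar a) = F (y \<cdot> a) p"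
  proof (rule F_char[OF ya lf_smult[OF F_lf[OF y]] _ _ p])
    show "\<forall>u\<in>S. F y (u (y \<cdot> a) \<cdot> bar a) = 0"
    proof
      fix u assume u: "u \<in> S"
      show "F y (u (y \<cdot> a) \<cdot> bar a) = 0"
        using F_S[OF y u] aN lfD(2)[OF F_lf[OF y]] by (simp add: End_smult[OF S_End[OF u]])
    qed
    show "F y (y \<cdot> a \<cdot> bar a) = b0 (y \<cdot> a) (y \<cdot> a)"
      using bar(3)[OF y ya(1)] aN[of y] lfD(2)[OF F_lf[OF y]] F_H[OF y y] bil_scF(2)[OF b0_bil] by simp
  qed
  then show ?thesis by simp
qed

text \<open>If the D-subspaces were equal, the component \<open>k\<close> of \<open>z\<close> in
  \<open>Dker (b0 y) H\<close> would satisfy \<open>b0 k p = 0\<close> for all \<open>p\<close> in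
  \<open>Dker (b0 y) H\<close>, in particular for \<open>k\<close> itself.\<close>

lemma kernel_distinct:
  assumes y: "y \<in> H" and z: "z \<in> H" "z \<notin> line y"
    and Y: "generic_vector \<iota> smult BV BD e m S y \<psi> \<eta> w'" and Z: "generic_vector \<iota> smult BV BD e m S z \<psi>' \<eta>' w''"
  shows "Dker \<psi> (fixs e) \<noteq> Dker \<psi>' (fixs e)"
proof
  assume eq: "Dker \<psi> (fixs e) = Dker \<psi>' (fixs e)"
  interpret Y: generic_vector \<iota> smult BV BD e m S y \<psi> \<eta> w' by fact
  interpret Z: generic_vector \<iota> smult BV BD e m S z \<psi>' \<eta>' w'' by fact
  let ?P = "Dker (b0 y) H"
  note D = Dker_dim[OF bilD(1)[OF b0_bil] H(1) y b0_pos[OF y Y.x0]]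
  have "z \<in> dsum ?P (line y)" using z(1) D(2) by simp
  then obtain k a where k: "k \<in> ?P" "z = k + y \<cdot> a" by (auto simp: dsum_def line_def)
  have kH: "k \<in> H" using k(1) by (auto simp: Dker_def)
  have k0: "k \<noteq> 0" using k(2) z(2) by (auto simp: line_def)
  have "b0 k p = 0" if p: "p \<in> ?P" for p
  proof -
    have pH: "p \<in> H" and pb: "\<And>c. b0 y (p \<cdot> c) = 0" using p by (auto simp: Dker_def)
    have pcH: "p \<cdot> c \<in> H" for c using dsub_smult[OF H(1) pH] .
    have "\<psi> (p \<cdot> c) = 0" for c
    proof -
      have "p \<cdot> c \<in> fixs e" using pcH[of c] H(2) by blast
      from Y.phi_coord[OF F_lf[OF y] F_S_all[OF y] this]
      have "b0 y (p \<cdot> c) = \<psi> (p \<cdot> c) * b0 y y" using F_H[OF y pcH] F_H[OF y y] by simp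
      then show ?thesis using pb b0_pos[OF y Y.x0] by simp
    qed
    then have "p \<in> Y.H" using pH H(2) unfolding Dker_def by blast
    then have "p \<in> Z.H" using eq by simp
    then have "\<psi>' p = 0" by (rule Z.phi_H(2))
    moreover have "p \<in> fixs e" using pH H(2) by blast
    ultimately have "F z p = 0" using Z.phi_coord[OF F_lf[OF z(1)] F_S_all[OF z(1)]] by simp
    then have "b0 z p = 0" using F_H[OF z(1) pH] by simp
    moreover have "b0 (y \<cdot> a) p = 0" using bar(3)[OF y pH] pb by simp
    ultimately show ?thesis using k(2) by (simp add: bil_add[OF b0_bil])
  qed
  then show False using b0_pos[OF kH k0] k(1) by blast
qed

lemma F_add:
  assumes y: "y \<in> H" and z: "z \<in> H" and p: "p \<in> fixs e"
  shows "F (y + z) p = F y p + F z p"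
proof (cases "y = 0")
  case True then show ?thesis using F_0 by simp
next
  case y0: False
  show ?thesis
  proof (cases "z \<in> line y")
    case True
    then obtain a where a: "z = y \<cdot> a" by (auto simp: line_def)
    have "F (y + z) p = F (y \<cdot> (1 + a)) p" using a by (simp add: smult_add_right smult_one)
    also have "\<dots> = F y (p \<cdot> bar (1 + a))" by (rule F_smult[OF y p])
    also have "\<dots> = F y (p + p \<cdot> bar a)" by (simp only: bar_add bar_1 smult_add_right smult_one)
    also have "\<dots> = F y p + F z p" using F_smult[OF y p, of a] lfD(1)[OF F_lf[OF y]] a by simp
    finally show ?thesis .
  next
    case False
    have z0: "z \<noteq> 0" using False dsub_0[OF dsub_line] by auto
    have yz: "y + z \<in> H" using dsub_add[OF H(1) y z] .
    obtain \<psi> \<eta> w' where Y: "generic_vector \<iota> smult BV BD e m S y \<psi> \<eta> w'" by (rule functional_exists[OF y y0]) (erule that)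
    obtain \<psi>' \<eta>' w'' where Z: "generic_vector \<iota> smult BV BD e m S z \<psi>' \<eta>' w''" by (rule functional_exists[OF z z0]) (erule that)
    interpret Y: generic_vector \<iota> smult BV BD e m S y \<psi> \<eta> w' by fact
    interpret Z: generic_vector \<iota> smult BV BD e m S z \<psi>' \<eta>' w'' by fact
    \<comment> \<open>An operator that kills one of \<open>y\<close> and \<open>z\<close> takes the
      same value at the other one and at \<open>y + z\<close>.\<close>
    have "\<exists>a c. \<forall>p\<in>fixs e. F (y + z) p = a * \<psi> p + c * \<psi>' p"
    proof (rule Y.functional_in_span[OF Z irr m kernel_distinct[OF y z False Y Z] F_lf[OF yz]])
      show "F (y + z) (v z) = 0" if "v \<in> S" "v y = 0" for v
        using F_S[OF yz that(1)] that(2) End_add[OF S_End[OF that(1)]] by simp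
      show "F (y + z) (v y) = 0" if "v \<in> S" "v z = 0" for v
        using F_S[OF yz that(1)] that(2) End_add[OF S_End[OF that(1)]] by simp
    qed
    then obtain a c where ac: "\<And>p. p \<in> fixs e \<Longrightarrow> F (y + z) p = a * \<psi> p + c * \<psi>' p" by blast
    define a' c' where "a' = a / b0 y y" and "c' = c / b0 z z"
    have Fy: "F y p = \<psi> p * b0 y y" if "p \<in> fixs e" for p
      using Y.phi_coord[OF F_lf[OF y] F_S_all[OF y] that] F_H[OF y y] by simp
    have Fz: "F z p = \<psi>' p * b0 z z" if "p \<in> fixs e" for p
      using Z.phi_coord[OF F_lf[OF z] F_S_all[OF z] that] F_H[OF z z] by simp
    have ac': "F (y + z) p = a' * F y p + c' * F z p" if "p \<in> fixs e" for p
      using ac[OF that] Fy[OF that] Fz[OF that] b0_pos[OF y y0] b0_pos[OF z z0] by (simp add: a'_def c'_def)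
    \<comment> \<open>On \<open>H\<close> additivity is that of \<open>b0\<close>, so
      \<open>b0 k\<close> vanishes on \<open>H\<close> and \<open>k = 0\<close> by nonisotropy. As
      \<open>z\<close> is not in the line of \<open>y\<close>, both coefficients must be 1.\<close>
    define k where "k = (1 - a') *f y + (1 - c') *f z"
    have kH: "k \<in> H" unfolding k_def
      using V.subspace_add V.subspace_scale dsub_subspace[OF H(1)] y z by blast
    have "b0 k p = 0" if p: "p \<in> H" for p
    proof -
      have "p \<in> fixs e" using p H(2) by blast
      from ac'[OF this] have "b0 (y + z) p = a' * b0 y p + c' * b0 z p"
        using F_H[OF yz p] F_H[OF y p] F_H[OF z p] by simp
      then have 1: "b0 y p + b0 z p = a' * b0 y p + c' * b0 z p"
        unfolding bil_add(1)[OF b0_bil] .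
      have 2: "b0 k p = (1 - a') * b0 y p + (1 - c') * b0 z p"
        unfolding k_def bil_add(1)[OF b0_bil] bil_scF(1)[OF b0_bil] ..
      show ?thesis using 1 unfolding 2 by algebra
    qed
    then have k0: "k = 0" using b0_pos[OF kH] kH by blast
    have c1: "c' = 1"
    proof (rule ccontr)
      assume "c' \<noteq> 1"
      then have c0: "1 - c' \<noteq> 0" by simp
      have "(1 - c') *f z = - ((1 - a') *f y)" using k0 by (simp add: k_def eq_neg_iff_add_eq_0 add.commute)
      then have "(1 - c') *f z \<in> line y"
        using dsub_neg[OF dsub_line] V.subspace_scale[OF dsub_subspace[OF dsub_line] line_self] by metis
      then have "inverse (1 - c') *f ((1 - c') *f z) \<in> line y"
        by (rule V.subspace_scale[OF dsub_subspace[OF dsub_line]])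
      then show False using False c0 by simp
    qed
    then have "a' = 1" using k0 y0 by (simp add: k_def)
    then show ?thesis using ac'[OF p] c1 by simp
  qed
qed

text \<open>The point is that \<open>b0 y\<close> and \<open>F y\<close> agree on \<open>S x\<close>
  and not only on \<open>H\<close>: \<open>functional_in_span\<close> writes \<open>b0 y\<close> as
  a combination of \<open>\<phi>\<close>, which vanishes on \<open>S x\<close>, and of the
  functional belonging to \<open>y\<close>.\<close>

lemma phi_F:
  assumes y: "y \<in> H" and u: "u \<in> S" shows "\<phi> (u y) = - F y (u x)"
proof (cases "y = 0")
  case True
  then show ?thesis using F_0 lf_0[OF lphi] End_0[OF S_End[OF u]] by simp
next
  case False
  obtain \<psi> \<eta> w' where Y: "generic_vector \<iota> smult BV BD e m S y \<psi> \<eta> w'" by (rule functional_exists[OF y False]) (erule that)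
  interpret Y: generic_vector \<iota> smult BV BD e m S y \<psi> \<eta> w' by fact
  have ne: "H \<noteq> Dker \<psi> (fixs e)" using y Y.H(4) by blast
  have "\<exists>a c. \<forall>p\<in>fixs e. b0 y p = a * \<phi> p + c * \<psi> p"
  proof (rule functional_in_span[OF Y irr m ne bilD(1)[OF b0_bil]])
    show "b0 y (v y) = 0" if "v \<in> S" "v x = 0" for v using b0_T that by blast
    show "b0 y (v x) = 0" if "v \<in> S" "v y = 0" for v
      using phi_b0[OF that(1), of y] that(2) lf_0[OF lphi] by simp
  qed
  then obtain a c where ac: "\<And>p. p \<in> fixs e \<Longrightarrow> b0 y p = a * \<phi> p + c * \<psi> p" by blast
  have yE: "y \<in> fixs e" using y H(2) by blast
  have c: "c = b0 y y" using ac[OF yE] phi_H(2)[OF y] Y.phi_x by simp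
  have uE: "u x \<in> fixs e" using tD(11)[OF u] .
  have "b0 y (u x) = b0 y y * \<psi> (u x)" using ac[OF uE] phi_S[OF u] c by simp
  also have "\<dots> = F y (u x)" using Y.phi_coord[OF F_lf[OF y] F_S_all[OF y] uE] F_H[OF y y] by simp
  finally show ?thesis using phi_b0[OF u] by simp
qed

text \<open>In terms of \<open>v = y + x a\<close> with \<open>y \<in> H\<close>, the form is \<open>b v p = \<phi> (p bar(a)) + F y p\<close>.\<close>

lemma form_exists: "\<exists>b. alt e b S \<and> b x x \<noteq> 0"
proof -
  define b where "b = (\<lambda>v p. \<phi> (p \<cdot> bar (\<xi> v)) + F (h v) p)"
  have xi_add: "\<xi> (v + v') = \<xi> v + \<xi> v'" and xi_smult: "\<xi> (v \<cdot> a) = \<xi> v * a" for v v' a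
    using dxi by (auto simp: dlin_def)
  have F_add': "F (y + z) p = F y p + F z p" if "y \<in> H" "z \<in> H" for y z p
    using F_add[OF that tD(12)[of p]] F_e that dsub_add[OF H(1)] by simp
  have F_scF: "F (c *f y) p = c * F y p" if "y \<in> H" for y c p
  proof -
    have cy: "y \<cdot> \<iota> c \<in> H" using dsub_smult[OF H(1) that] .
    have "F (y \<cdot> \<iota> c) (e p) = F y (c *f e p)"
      using F_smult[OF that tD(12)[of p], of "\<iota> c"] bar_iota by (simp add: scaleV_def)
    also have "\<dots> = c * F y (e p)" using lfD(2)[OF F_lf[OF that]] .
    finally show ?thesis using F_e[OF that] F_e[OF cy] by (simp add: scaleV_def)
  qed
  have "bil b" unfolding bil_def
  proof (intro conjI allI)
    fix v
    show "lf (b v)"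
      unfolding lf_def
    proof (intro conjI allI)
      show "b v (p + q) = b v p + b v q" for p q
        unfolding b_def smult_add_left lfD(1)[OF lphi] lfD(1)[OF F_lf[OF h_in]] by algebra
      show "b v (c *f p) = c * b v p" for c p
        unfolding b_def scF_smult lfD(2)[OF lphi] lfD(2)[OF F_lf[OF h_in]] by algebra
    qed
  next
    fix p
    show "lf (\<lambda>v. b v p)" unfolding lf_def
    proof (intro conjI allI)
      fix v v'
      show "b (v + v') p = b v p + b v' p"
        unfolding b_def xi_add bar_add smult_add_right lfD(1)[OF lphi] End_add[OF h_End] F_add'[OF h_in h_in]
        by algebra
    next
      fix c v
      have "\<xi> (c *f v) = \<xi> v * \<iota> c" by (simp add: scaleV_def xi_smult)
      then have *: "p \<cdot> bar (\<xi> (c *f v)) = c *f (p \<cdot> bar (\<xi> v))"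
        by (simp add: bar_iota_mult scaleV_def smult_assoc)
      show "b (c *f v) p = c * b v p"
        unfolding b_def * lfD(2)[OF lphi] End_scF[OF h_End] F_scF[OF h_in] by algebra
    qed
  qed
  moreover have "b v (u v) = 0" if u: "u \<in> S" for u v
  proof -
    let ?y = "h v" and ?a = "\<xi> v"
    obtain N where N: "?a * bar ?a = \<iota> N" using bar(2) by blast
    have uv: "u v = u ?y + u x \<cdot> ?a" using S_split[OF u] .
    have yb: "?y \<cdot> bar ?a \<in> H" using dsub_smult[OF H(1) h_in] .
    \<comment> \<open>The contribution of \<open>u x\<close> drops out, because
      \<open>?a * bar ?a\<close> lies in F and \<open>\<phi>\<close> vanishes on \<open>S x\<close>.
      The rest becomes \<open>- F ?y (u x \<cdot> ?a)\<close> and cancels the second summand of the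
      form.\<close>
    have "\<phi> (u v \<cdot> bar ?a) = \<phi> (u (?y \<cdot> bar ?a)) + \<phi> (N *f u x)"
      using uv N by (simp add: smult_add_left smult_assoc lfD(1)[OF lphi] End_smult[OF S_End[OF u]] scaleV_def)
    also have "\<dots> = - F (?y \<cdot> bar ?a) (u x)"
      using phi_F[OF yb u] phi_S[OF u] by (simp add: lfD(2)[OF lphi])
    also have "\<dots> = - F ?y (u x \<cdot> ?a)"
      using F_smult[OF h_in tD(11)[OF u], of v "bar ?a" x] bar_bar by simp
    finally show ?thesis
      using uv F_S[OF h_in u, of v] by (simp add: b_def lfD(1)[OF F_lf[OF h_in]])
  qed
  moreover have "b x x \<noteq> 0" using h_x xi_x bar_1 F_0 phi_x by (simp add: b_def smult_one)
  ultimately show ?thesis unfolding alt_def by blast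
qed

end

context div_space begin

theorem nonisotropic_form_exists:
  assumes t: "tight e (Suc m) S" and irr: "irr e S" and m: "0 < m"
  shows "\<exists>b. alt e b S \<and> (\<forall>z\<in>fixs e. z \<noteq> 0 \<longrightarrow> b z z \<noteq> 0)"
proof -
  obtain x where x: "x \<in> fixs e" "x \<noteq> 0" "dimV (orb S x) + 1 = Suc m * d"
    using generic_exists[OF t] .
  obtain \<phi> \<xi> w where "generic_vector \<iota> smult BV BD e m S x \<phi> \<xi> w"
    using generic_vector_exists[OF t x] .
  then interpret generic_irreducible \<iota> smult BV BD e m S x \<phi> \<xi> w
    using irr m by (intro generic_irreducible.intro generic_irreducible_axioms.intro)
  obtain b where b: "alt e b S" "b x x \<noteq> 0" using form_exists by blast
  \<comment> \<open>The construction controls the form only at \<open>x\<close>; since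
    \<open>S\<close> is irreducible and optimal, \<open>alt_nonisotropic\<close> extends this to
    every nonzero vector.\<close>
  have "b z z \<noteq> 0" if "z \<in> fixs e" "z \<noteq> 0" for z
    using alt_nonisotropic(1)[OF tD(1-7) irr b(1) xE xE b(2) that] .
  then show ?thesis using b(1) by blast
qed

end

section \<open>The classification\<close>

context div_space begin

section \<open>Translation into the notions of the statement\<close>

lemma combination_dim:
  assumes "finite B" "\<forall>c. (\<Sum>b\<in>B. b \<cdot> c b) = 0 \<longrightarrow> (\<forall>b\<in>B. c b = 0)"
  shows "dsub (range (\<lambda>c. \<Sum>b\<in>B. b \<cdot> c b)) \<and> dimV (range (\<lambda>c. \<Sum>b\<in>B. b \<cdot> c b)) = card B * d"
  using assms
proof (induction B rule: finite_induct)
  case empty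
  have "dimV {0} = 0" using V.dim_eq_0 by blast
  then show ?case using dsub_singleton by simp
next
  case (insert b B)
  let ?R = "\<lambda>B. range (\<lambda>c. \<Sum>b\<in>B. b \<cdot> c b)"
  have "\<forall>c. (\<Sum>b\<in>B. b \<cdot> c b) = 0 \<longrightarrow> (\<forall>b\<in>B. c b = 0)"
  proof (intro allI impI)
    fix c assume c: "(\<Sum>b\<in>B. b \<cdot> c b) = 0"
    have "(\<Sum>i\<in>B. i \<cdot> (c(b := 0)) i) = (\<Sum>b\<in>B. b \<cdot> c b)"
      using insert.hyps by (intro sum.cong) auto
    then have "(\<Sum>i\<in>insert b B. i \<cdot> (c(b := 0)) i) = 0" using c insert.hyps by simp
    then have "\<forall>i\<in>insert b B. (c(b := 0)) i = 0" using insert.prems by blast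
    then show "\<forall>i\<in>B. c i = 0" using insert.hyps by (metis fun_upd_other insertCI)
  qed
  then have IH: "dsub (?R B)" "dimV (?R B) = card B * d" using insert.IH by blast+
  have "b \<notin> ?R B"
  proof
    assume "b \<in> ?R B"
    then obtain c where c: "b = (\<Sum>b\<in>B. b \<cdot> c b)" by blast
    have "(\<Sum>i\<in>B. i \<cdot> (c(b := - 1)) i) = (\<Sum>b\<in>B. b \<cdot> c b)"
      using insert.hyps by (intro sum.cong) auto
    then have s: "(\<Sum>i\<in>B. i \<cdot> (c(b := - 1)) i) = b" by (rule trans) (rule c[symmetric])
    have "(\<Sum>i\<in>insert b B. i \<cdot> (c(b := - 1)) i) = b \<cdot> (- 1) + (\<Sum>i\<in>B. i \<cdot> (c(b := - 1)) i)"
      using insert.hyps by simp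
    then have "(\<Sum>i\<in>insert b B. i \<cdot> (c(b := - 1)) i) = 0"
      unfolding s by (simp add: smult_minus_right smult_one)
    then have "(c(b := - 1)) b = 0" using insert.prems by blast
    then show False by simp
  qed
  then have 1: "dimV (dsum (?R B) (line b)) = card (insert b B) * d"
    using dim_dsum_line[OF IH(1)] IH(2) insert.hyps by simp
  have eq: "dsum (?R B) (line b) = ?R (insert b B)"
  proof
    show "?R (insert b B) \<subseteq> dsum (?R B) (line b)"
    proof
      fix v assume "v \<in> ?R (insert b B)"
      then obtain c where "v = (\<Sum>b\<in>insert b B. b \<cdot> c b)" by blast
      then have "v = (\<Sum>b\<in>B. b \<cdot> c b) + b \<cdot> c b" using insert.hyps by (simp add: add.commute)
      then show "v \<in> dsum (?R B) (line b)" unfolding dsum_def line_def by blast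
    qed
    show "dsum (?R B) (line b) \<subseteq> ?R (insert b B)"
    proof
      fix v assume "v \<in> dsum (?R B) (line b)"
      then obtain c a where v: "v = (\<Sum>b\<in>B. b \<cdot> c b) + b \<cdot> a" unfolding dsum_def line_def by blast
      have "(\<Sum>i\<in>B. i \<cdot> (c(b := a)) i) = (\<Sum>b\<in>B. b \<cdot> c b)"
        using insert.hyps by (intro sum.cong) auto
      then have "v = (\<Sum>i\<in>insert b B. i \<cdot> (c(b := a)) i)" using v insert.hyps by (simp add: add.commute)
      then show "v \<in> ?R (insert b B)" by (rule range_eqI[where f = "\<lambda>c. \<Sum>b\<in>insert b B. b \<cdot> c b"])
    qed
  qed
  show ?case using 1 dsub_dsum[OF IH(1) dsub_line, of b] unfolding eq by blast
qed

lemma right_dimension_dim: assumes "right_dimension smult n" shows "dimV UNIV = n * d"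
proof -
  obtain B where B: "right_basis smult B" "card B = n" using assms unfolding right_dimension_def by blast
  have "range (\<lambda>c. \<Sum>b\<in>B. b \<cdot> c b) = UNIV" using B(1) unfolding right_basis_def by blast
  moreover have "dimV (range (\<lambda>c. \<Sum>b\<in>B. b \<cdot> c b)) = card B * d"
    using combination_dim[of B] B(1) unfolding right_basis_def by blast
  ultimately show ?thesis using B(2) by simp
qed

lemma id_idem: "idem id" and fixs_id: "fixs id = UNIV" and corner_id: "corner id = End'"
  by (auto simp: idem_def fixs_def corner_def End_def)

lemma trivial_spectrum_iff: "trivial_spectrum \<iota> smult S \<longleftrightarrow> Esub S \<and> TS S"
proof
  assume t: "trivial_spectrum \<iota> smult S"
  have "x = 0" if u: "u \<in> S" "u x = x" for u x
  proof -
    obtain w where w: "w \<in> End'" "w \<circ> (id - u) = id"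
      using t u(1) unfolding trivial_spectrum_def End_invertible_def by blast
    have "w ((id - u) x) = x" using w(2) by (metis comp_apply id_apply)
    then show ?thesis using u(2) End_0[OF w(1)] by simp
  qed
  then show "Esub S \<and> TS S" using t unfolding trivial_spectrum_def TS_def by blast
next
  assume a: "Esub S \<and> TS S"
  have "End_invertible smult (id - u)" if u: "u \<in> S" for u
  proof -
    let ?v = "id - u"
    have idE: "id \<in> End'" by (simp add: End_def)
    have v: "?v \<in> End'" using End_minusI[OF idE] EsubD(1)[of S u] a u by blast
    have l: "Vector_Spaces.linear (scaleV \<iota> smult) (scaleV \<iota> smult) ?v"
      unfolding Vector_Spaces.linear_iff using End_add[OF v] End_scF[OF v] by (auto simp: V.vector_space_axioms)
    have "x = 0" if "?v x = 0" for x using that TSD[of S u x] a u by simp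
    then have inj: "inj ?v" unfolding VV.linear_inj_iff_eq_0[OF l] by blast
    have surj: "surj ?v" using V.linear_inj_imp_surj[OF l inj] .
    define w where "w = inv ?v"
    have vw: "?v (w x) = x" for x unfolding w_def using surj by (rule surj_f_inv_f)
    have wv: "w (?v x) = x" for x unfolding w_def using inj by (rule inv_f_f)
    have wI: "w z = y" if "?v y = z" for y z using wv[of y] that by simp
    have "w (x + y) = w x + w y" for x y
      by (rule wI) (simp only: End_add[OF v] vw)
    moreover have "w (x \<cdot> c) = w x \<cdot> c" for x c
      by (rule wI) (simp only: End_smult[OF v] vw)
    ultimately have "w \<in> End'" by (simp add: End_def)
    moreover have "w \<circ> ?v = id" by (rule ext) (simp only: comp_apply wv id_apply)
    moreover have "?v \<circ> w = id" by (rule ext) (simp only: comp_apply vw id_apply)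
    ultimately show ?thesis using v unfolding End_invertible_def by blast
  qed
  then show "trivial_spectrum \<iota> smult S" using a unfolding trivial_spectrum_def by blast
qed

lemma irreducible_iff: "irreducible_End smult S \<longleftrightarrow> S \<subseteq> End' \<and> (UNIV :: 'v set) \<noteq> {0} \<and> irr id S"
  unfolding irreducible_End_def irr_def fixs_id image_subset_iff by auto

lemma optimal_iff:
  assumes n: "right_dimension smult n" and big: "big (n * d)"
  shows "optimal_trivial_spectrum \<iota> smult S \<longleftrightarrow> tight id n S"
proof -
  have dim: "dimV (fixs id) = n * d" using right_dimension_dim[OF n] fixs_id by simp
  have le: "dimE T \<le> g n" if "Esub T" "TS T" for T
    using ts_bound[OF id_idem dim that(1) _ that(2) big] EsubD(1)[OF that(1)] corner_id by blast
  obtain T where T: "Esub T" "TS T" "dimE T = g n" using ts_exists[OF id_idem dim] by blast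
  have "tight id n S \<longleftrightarrow> Esub S \<and> TS S \<and> dimE S = g n"
    unfolding tight_def using id_idem dim big EsubD(1)[of S] corner_id by blast
  moreover have "dimE S = g n" if "Esub S" "TS S" "\<forall>T. Esub T \<and> TS T \<longrightarrow> dimE T \<le> dimE S"
    using that T le[OF that(1,2)] by fastforce
  ultimately show ?thesis
    unfolding optimal_trivial_spectrum_def trivial_spectrum_iff using le by auto
qed

lemma bilinear_form_iff: "bilinear_form \<iota> smult b \<longleftrightarrow> bil b"
  unfolding bilinear_form_def bil_def lf_iff_linear by blast

text \<open>Nonisotropy gives the form space trivial spectrum, and it contains \<open>S\<close>;
  optimality of \<open>S\<close> leaves only equality.\<close>

theorem irreducible_optimal_form:
  assumes n: "right_dimension smult n" "2 \<le> n" and big: "big (n * d)"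
    and S: "irreducible_End smult S" "optimal_trivial_spectrum \<iota> smult S"
  shows "\<exists>b. bilinear_form \<iota> smult b \<and> nonisotropic b \<and> S = form_space smult b"
proof -
  obtain m where m: "n = Suc m" "0 < m" using n(2) by (cases n) auto
  have t: "tight id (Suc m) S" using S(2) optimal_iff[OF n(1) big] m by simp
  have "irr id S" using S(1) irreducible_iff by blast
  then obtain b where b: "alt id b S" "\<forall>z\<in>fixs id. z \<noteq> 0 \<longrightarrow> b z z \<noteq> 0"
    using nonisotropic_form_exists[OF t _ m(2)] by blast
  have bb: "bil b" and al: "\<And>u y. u \<in> S \<Longrightarrow> b y (u y) = 0" using b(1) fixs_id by (auto simp: alt_def)
  have nb: "b z z \<noteq> 0" if "z \<noteq> 0" for z using b(2) that fixs_id by blast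
  let ?A = "form_space smult b"
  have SA: "S \<subseteq> ?A" using al EsubD(1)[OF tightD(3)[OF t]] by (auto simp: form_space_def)
  note cE = Esub_corner[OF id_idem, unfolded corner_id]
  have A: "Esub ?A"
  proof (rule EsubI)
    show "?A \<subseteq> End'" by (auto simp: form_space_def)
    show "(\<lambda>x. 0) \<in> ?A" using Esub_0[OF cE] bil_0(2)[OF bb] by (simp add: form_space_def)
    show "(\<lambda>x. u x + w x) \<in> ?A" if "u \<in> ?A" "w \<in> ?A" for u w
      using that Esub_add[OF cE, of u w] bil_add(2)[OF bb] by (simp add: form_space_def)
    show "(\<lambda>x. c *f u x) \<in> ?A" if "u \<in> ?A" for u c
      using that Esub_scF[OF cE, of u c] bil_scF(2)[OF bb] by (simp add: form_space_def)
  qed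
  have "TS ?A" unfolding TS_def
  proof (intro ballI allI impI)
    fix u x assume u: "u \<in> ?A" "u x = x"
    then have "b x x = 0" by (auto simp: form_space_def dest: spec[of _ x])
    then show "x = 0" using nb by blast
  qed
  then have "trivial_spectrum \<iota> smult ?A" using A trivial_spectrum_iff by blast
  then have "dimE ?A \<le> dimE S" using S(2) unfolding optimal_trivial_spectrum_def by blast
  then have "S = ?A" using Esub_eq[OF tightD(3)[OF t] A SA] by blast
  moreover have "nonisotropic b" using nb by (simp add: nonisotropic_def)
  ultimately show ?thesis using bb bilinear_form_iff by blast
qed

text \<open>On a line an operator is determined by its value at one nonzero vector, so
  \<open>id\<close> is the only operator with a nonzero fixed vector. Irreducibility is automatic,
  and the optimal dimension \<open>g 1 = d - 1\<close> is that of a hyperplane.\<close>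

theorem irreducible_optimal_line:
  assumes n: "right_dimension smult 1" and big: "big d"
  shows "irreducible_End smult S \<and> optimal_trivial_spectrum \<iota> smult S \<longleftrightarrow> End_hyperplane \<iota> smult S \<and> id \<notin> S"
proof -
  have dim: "dimV UNIV = d" using right_dimension_dim[OF n] by simp
  have "\<not> (UNIV :: 'v set) \<subseteq> {0}" using dim d_pos V.dim_eq_0[of UNIV] by linarith
  then obtain x :: 'v where x: "x \<noteq> 0" by blast
  have line: "line y = UNIV" if "y \<noteq> 0" for y
    using V.subspace_dim_equal[OF dsub_subspace[OF dsub_line] V.subspace_UNIV subset_UNIV] dim_line[OF that] dim
    by simp
  have un: "(UNIV :: 'v set) \<noteq> {0}" using x by blast
  have "g 1 = d - 1" by simp
  have opt: "optimal_trivial_spectrum \<iota> smult S \<longleftrightarrow> Esub S \<and> TS S \<and> dimE S = d - 1"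
    using optimal_iff[OF n, of S] big id_idem fixs_id dim EsubD(1)[of S] corner_id
    unfolding tight_def by auto
  have irr: "irreducible_End smult S" if "Esub S"
  proof -
    have "W = {0} \<or> W = UNIV" if W: "dsub W" for W
    proof (cases "W = {0}")
      case False
      then obtain y where y: "y \<in> W" "y \<noteq> 0" using dsub_0[OF W] by blast
      then show ?thesis using line_least[OF W y(1)] line[OF y(2)] by blast
    qed simp
    then have "irr id S" unfolding irr_def fixs_id by blast
    then show ?thesis unfolding irreducible_iff using EsubD(1)[OF \<open>Esub S\<close>] un by blast
  qed
  note cE = Esub_corner[OF id_idem, unfolded corner_id]
  have eq: "u = w" if uw: "u \<in> End'" "w \<in> End'" "u y = w y" "y \<noteq> 0" for u w y
  proof
    fix v
    have "v \<in> line y" using line[OF uw(4)] by simp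
    then obtain a where "v = y \<cdot> a" unfolding line_def by blast
    then show "u v = w v" using uw(3) by (simp add: End_smult[OF uw(1)] End_smult[OF uw(2)])
  qed
  have dE: "dimE End' = d"
  proof -
    have "orb End' x = UNIV"
    proof (intro equalityI subset_UNIV subsetI)
      fix p :: 'v
      obtain \<xi> where \<xi>: "dlin \<xi>" "\<xi> x = 1" using coordinate_exists[OF dsub_singleton, of x] x by blast
      show "p \<in> orb End' x"
        by (rule image_eqI[OF _ rank1_End[OF \<xi>(1), of p]]) (simp add: \<xi>(2) smult_one)
    qed
    moreover have "{u\<in>End'. u x = 0} = {\<lambda>v. 0}"
    proof -
      have "u = (\<lambda>v. 0)" if "u \<in> End'" "u x = 0" for u
        using eq[OF that(1) Esub_0[OF cE] _ x] that(2) by simp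
      then show ?thesis using Esub_0[OF cE] by blast
    qed
    ultimately show ?thesis using dim_orb[OF cE, of x] dim zero_dim_E by simp
  qed
  show ?thesis
  proof
    assume "irreducible_End smult S \<and> optimal_trivial_spectrum \<iota> smult S"
    then have S: "Esub S" "TS S" "dimE S = d - 1" using opt by auto
    have "id \<notin> S" using TSD[OF S(2), of id x] x by auto
    then show "End_hyperplane \<iota> smult S \<and> id \<notin> S" unfolding End_hyperplane_def using S dE d_pos by simp
  next
    assume h: "End_hyperplane \<iota> smult S \<and> id \<notin> S"
    then have S: "Esub S" "dimE S = d - 1" unfolding End_hyperplane_def using dE by auto
    have idE: "id \<in> End'" by (simp add: End_def)
    have "TS S" unfolding TS_def
    proof (intro ballI allI impI, rule ccontr)
      fix u y assume u: "u \<in> S" "u y = y" "y \<noteq> 0"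
      have "u = id" by (rule eq[OF EsubD(1)[OF S(1) u(1)] idE _ u(3)]) (use u in simp)
      then show False using u(1) h by simp
    qed
    then show "irreducible_End smult S \<and> optimal_trivial_spectrum \<iota> smult S" using opt irr S by blast
  qed
qed

end

text \<open>The products of a D-basis of the space with an F-basis of D span it over F; an
  independent subset is extracted because the locale asks for a basis.\<close>

lemma finite_basis_exists:
  fixes \<iota> :: "'f::field \<Rightarrow> 'd::division_ring" and smult :: "'v::ab_group_add \<Rightarrow> 'd \<Rightarrow> 'v"
  assumes "central_subfield \<iota>" "right_vector_space smult"
    and D: "finite_dimensional_vector_space (\<lambda>a x. \<iota> a * x) BD" and B: "right_basis smult B"
  shows "\<exists>BV. finite_dimensional_vector_space (scaleV \<iota> smult) BV"
proof -
  interpret central_subfield \<iota> by fact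
  interpret right_vector_space smult by fact
  interpret K: finite_dimensional_vector_space "\<lambda>a x. \<iota> a * x" BD by fact
  interpret V: vector_space "scaleV \<iota> smult" using assms(1,2) by (rule vector_space_scaleV)
  let ?G = "(\<lambda>(b, a). smult b a) ` (B \<times> BD)"
  have fG: "finite ?G" using B K.finite_Basis by (simp add: right_basis_def)
  have in_span: "smult b a \<in> V.span ?G" if b: "b \<in> B" for b a
  proof -
    have z: "smult b 0 = 0" using smult_add_right[of b 0 0] by simp
    have "K.subspace {a. smult b a \<in> V.span ?G}"
    proof (rule K.subspaceI)
      show "0 \<in> {a. smult b a \<in> V.span ?G}" using z V.span_zero by simp
      show "x + y \<in> {a. smult b a \<in> V.span ?G}"
        if "x \<in> {a. smult b a \<in> V.span ?G}" "y \<in> {a. smult b a \<in> V.span ?G}" for x y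
        using that V.span_add by (simp add: smult_add_right)
      show "\<iota> c * x \<in> {a. smult b a \<in> V.span ?G}" if "x \<in> {a. smult b a \<in> V.span ?G}" for c x
      proof -
        have "smult b (\<iota> c * x) = scaleV \<iota> smult c (smult b x)"
          by (simp add: central[of c x] scaleV_def smult_assoc)
        then show ?thesis using that V.span_scale by simp
      qed
    qed
    moreover have "BD \<subseteq> {a. smult b a \<in> V.span ?G}"
    proof clarify
      fix a assume "a \<in> BD"
      then have "(b, a) \<in> B \<times> BD" using b by blast
      from imageI[OF this, of "\<lambda>(b, a). smult b a"]
      have "smult b a \<in> ?G" by simp
      then show "smult b a \<in> V.span ?G" by (rule V.span_base)
    qed
    ultimately have "K.span BD \<subseteq> {a. smult b a \<in> V.span ?G}" by (intro K.span_minimal)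
    then show ?thesis using K.span_Basis by auto
  qed
  have sG: "V.span ?G = UNIV"
  proof (intro equalityI subset_UNIV subsetI)
    fix v :: 'v
    obtain c where "v = (\<Sum>b\<in>B. smult b (c b))" using B unfolding right_basis_def by blast
    moreover have "(\<Sum>b\<in>B. smult b (c b)) \<in> V.span ?G" by (rule V.span_sum) (rule in_span)
    ultimately show "v \<in> V.span ?G" by simp
  qed
  obtain C where C: "C \<subseteq> ?G" "\<not> V.dependent C" "?G \<subseteq> V.span C"
    using V.maximal_independent_subset[of ?G] by blast
  have "V.span C = UNIV" using V.span_minimal[OF C(3) V.subspace_span] sG by blast
  then have "finite_dimensional_vector_space (scaleV \<iota> smult) C"
    using C fG finite_subset by unfold_locales auto
  then show ?thesis by blast
qed

theorem theorem1p9: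
  fixes \<iota> :: "'f::field \<Rightarrow> 'd::division_ring"
    and smult :: "'v::ab_group_add \<Rightarrow> 'd \<Rightarrow> 'v"
    and n d :: nat
  assumes "central_subfield \<iota>"
    and "field_dimension \<iota> d"
    and "right_vector_space smult"
    and "right_dimension smult n"
    and "n > 0"
    and "infinite (UNIV :: 'f set) \<or> card (UNIV :: 'f set) \<ge> n * d"
  shows "(n = 1 \<longrightarrow>
            {S. irreducible_End smult S \<and> optimal_trivial_spectrum \<iota> smult S}
              = {H. End_hyperplane \<iota> smult H \<and> id \<notin> H})
       \<and> (n \<ge> 2 \<longrightarrow>
            (\<forall>S. irreducible_End smult S \<and> optimal_trivial_spectrum \<iota> smult S \<longrightarrow>
              (\<exists>b. bilinear_form \<iota> smult b \<and> nonisotropic b \<and> S = form_space smult b)))"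
proof -
  obtain BD where BD: "finite_dimensional_vector_space (\<lambda>a x. \<iota> a * x) BD" "card BD = d"
    using assms(2) unfolding field_dimension_def by blast
  obtain B where "right_basis smult B" using assms(4) unfolding right_dimension_def by blast
  then obtain BV where BV: "finite_dimensional_vector_space (scaleV \<iota> smult) BV"
    using finite_basis_exists[OF assms(1,3) BD(1)] by blast
  interpret div_space \<iota> smult BV BD
    using assms(1,3) BV BD(1) by (intro div_space.intro)
  \<comment> \<open>\<open>big\<close> counts \<open>range \<iota>\<close>; injectivity makes this
    the cardinality of F.\<close>
  have "inj \<iota>" using iota_inj by (auto intro: injI)
  then have big: "big (n * card BD)"
    using assms(6) BD(2) card_image[of \<iota> UNIV] finite_imageD[of \<iota> UNIV] by auto
  show ?thesis
  proof (intro conjI impI allI)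
    assume n: "n = 1"
    show "{S. irreducible_End smult S \<and> optimal_trivial_spectrum \<iota> smult S}
      = {H. End_hyperplane \<iota> smult H \<and> id \<notin> H}"
      using irreducible_optimal_line assms(4) big unfolding n by simp
  next
    fix S assume "2 \<le> n" "irreducible_End smult S \<and> optimal_trivial_spectrum \<iota> smult S"
    then show "\<exists>b. bilinear_form \<iota> smult b \<and> nonisotropic b \<and> S = form_space smult b"
      using irreducible_optimal_form[OF assms(4) _ big] by blast
  qed
qed

end
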